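(* Let $n\ge1$, $r\ge2$, let $\mathbf m=(m_1,\dots,m_r)\in\mathbb Z_{>0}^r$ with $m_k\ge n$ for all $k$, and let $R$ be a commutative ring with parameters $q,Q_1,\dots,Q_r\in R$, $q$ invertible. Put $\omega=(\emptyset,\dots,\emptyset,(1^n))\in\Lambda^+_{n,r}(\mathbf m)$, and in $\mathscr S_{n,r}$ put $$C_0=1_\omega f_{(m_{r-1},r-1)}e_{(m_{r-1},r-1)}1_\omega,\qquad C_i=1_\omega f_{(i,r)}e_{(i,r)}1_\omega\quad(1\le i\le n-1).$$ (i) The subalgebra of $\mathscr S_{n,r}$ (with identity element $1_\omega$) generated by $C_0,C_1,\dots,C_{n-1}$ is isomorphic to the Ariki–Koike algebra $\mathscr H_{n,r}$. Moreover, the subalgebra (with identity element $1_\omega$) generated by $C_1,\dots,C_{n-1}$ is isomorphic to the Iwahori–Hecke algebra $\mathscr H_n$ of the symmetric group $\mathfrak S_n$. (ii) Under the isomorphism $1_\omega\mathscr S_{n,r}1_\omega=\operatorname{End}_{\mathscr H_{n,r}}(M^\omega)\cong\mathscr H_{n,r}$, $\varphi\mapsto\varphi(m_\omega)$ (note $m_\omega=1$), we have $T_0=C_0+Q_r1_\omega$ and $T_i=C_i-q^{-1}1_\omega$ for $1\le i\le n-1$.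
   Context: **Ariki–Koike algebra.** $\mathscr H_{n,r}$ is the unital associative $R$-algebra with generators $T_0,\dots,T_{n-1}$ and relations $(T_0-Q_1)\cdots(T_0-Q_r)=0$, $(T_i-q)(T_i+q^{-1})=0$ ($1\le i\le n-1$), $T_0T_1T_0T_1=T_1T_0T_1T_0$, $T_iT_{i+1}T_i=T_{i+1}T_iT_{i+1}$ ($1\le i\le n-2$), $T_iT_j=T_jT_i$ ($|i-j|\ge2$). $\mathscr H_n$ is the subalgebra generated by $T_1,\dots,T_{n-1}$, which is the Iwahori–Hecke algebra of $\mathfrak S_n$. Put $L_1=T_0$, $L_i=T_{i-1}L_{i-1}T_{i-1}$. For $w\in\mathfrak S_n$ with reduced expression $w=s_{i_1}\cdots s_{i_l}$ ($s_j=(j,j+1)$), $T_w=T_{i_1}\cdots T_{i_l}$, $\ell(w)=l$. **Compositions.** $\Lambda_{n,r}(\mathbf m)$ is the set of $\mu=(\mu^{(1)},\dots,\mu^{(r)})$ with $\mu^{(k)}\in\mathbb Z_{\ge0}^{m_k}$ and $\sum_{k,i}\mu^{(k)}_i=n$; $\Lambda^+_{n,r}(\mathbf m)$ is the subset where each $\mu^{(k)}$ is weakly decreasing. $|\mu^{(k)}|=\sum_i\mu_i^{(k)}$. $\Gamma(\mathbf m)=\{(i,k):1\le i\le m_k,1\le k\le r\}$, $\Gamma'(\mathbf m)=\Gamma(\mathbf m)\setminus\{(m_r,r)\}$, with convention $(m_k+1,k)=(1,k+1)$ (so $\mu^{(k)}_{m_k+1}=\mu^{(k+1)}_1$). $\Lambda_{n,r}(\mathbf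 m)$ is embedded in $\bigoplus_{(i,k)\in\Gamma(\mathbf m)}\mathbb Z\varepsilon_{(i,k)}$ by $\mu\mapsto\sum\mu_i^{(k)}\varepsilon_{(i,k)}$, and $\alpha_{(i,k)}=\varepsilon_{(i,k)}-\varepsilon_{(i+1,k)}$. **Cyclotomic $q$-Schur algebra.** For $\mu\in\Lambda_{n,r}(\mathbf m)$, $m_\mu=\big(\sum_{w\in\mathfrak S_\mu}q^{\ell(w)}T_w\big)\prod_{k=1}^r\prod_{i=1}^{a_k}(L_i-Q_k)$, where $\mathfrak S_\mu$ is the Young subgroup and $a_k=\sum_{j<k}|\mu^{(j)}|$; $M^\mu=m_\mu\mathscr H_{n,r}$ (a right $\mathscr H_{n,r}$-module); $\mathscr S_{n,r}=\operatorname{End}_{\mathscr H_{n,r}}(\bigoplus_{\mu\in\Lambda_{n,r}(\mathbf m)}M^\mu)$. Elements of $\mathscr S_{n,r}$: $1_\mu$ is the projection to $M^\mu$; for $(i,k)\in\Gamma'(\mathbf m)$, with $N=\sum_{l<k}|\mu^{(l)}|+\sum_{j\le i}\mu^{(k)}_j$, $e_{(i,k)}(m_\mu)=q^{-\mu^{(k)}_{i+1}+1}m_{\mu+\alpha_{(i,k)}}\sum_{y}q^{\ell(y)}T_y$ with $y\in\{1,s_{N+1},s_{N+1}s_{N+2},\dots,s_{N+1}\cdots s_{N+\mu^{(k)}_{i+1}-1}\}$, and $f_{(i,k)}(m_\mu)=q^{-\mu^{(k)}_i+1}m_{\mu-\alpha_{(i,k)}}h\sum_xq^{\ell(x)}T_x$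 with $x\in\{1,s_{N-1},s_{N-1}s_{N-2},\dots,s_{N-1}\cdots s_{N-\mu_i^{(k)}+1}\}$, $h=1$ if $i\ne m_k$ and $h=L_N-Q_{k+1}$ if $i=m_k$ (value $0$ if $\mu\pm\alpha_{(i,k)}\notin\Lambda_{n,r}(\mathbf m)$). *)

theory Defs
  imports
    "HOL-Algebra.QuotRing"
    "HOL-Algebra.Module"
    "HOL-Algebra.Subrings"
    "HOL-Combinatorics.Permutations"
    "HOL-Library.Function_Algebras"
begin

section \<open>Associative algebras over a commutative ring\<close>

text \<open>
  An associative unital (not necessarily commutative) \<open>R\<close>-algebra is carried by the library record
  \<open>module\<close>, which has both a multiplication and a scalar multiplication.  (The library locale
  \<open>algebra\<close> is for commutative algebras only, so it is not used.)
\<close>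

definition lprod :: "('a, 'b) monoid_scheme \<Rightarrow> 'a list \<Rightarrow> 'a" where
  "lprod G xs = foldr (monoid.mult G) xs \<one>\<^bsub>G\<^esub>"

definition subalgebra_of ::
    "'a set \<Rightarrow> ('r, 'b) ring_scheme \<Rightarrow> ('r, 'a, 'c) module_scheme \<Rightarrow> bool" where
  "subalgebra_of B R A \<longleftrightarrow> subring B A \<and> submodule B R A"

definition generated_subalgebra ::
    "('r, 'b) ring_scheme \<Rightarrow> ('r, 'a) module \<Rightarrow> 'a set \<Rightarrow> ('r, 'a) module" where
  "generated_subalgebra R A X = A\<lparr>carrier := \<Inter>{B. subalgebra_of B R A \<and> X \<subseteq> B}\<rparr>"

definition alg_iso ::
    "('r, 'b) ring_scheme \<Rightarrow> ('r, 'a1) module \<Rightarrow> ('r, 'a2) module \<Rightarrow> ('a1 \<Rightarrow> 'a2) set" where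
  "alg_iso R A B = {h \<in> ring_iso A B.
     \<forall>a\<in>carrier R. \<forall>x\<in>carrier A. h (a \<odot>\<^bsub>A\<^esub> x) = a \<odot>\<^bsub>B\<^esub> h x}"

definition alg_isomorphic ::
    "('r, 'b) ring_scheme \<Rightarrow> ('r, 'a1) module \<Rightarrow> ('r, 'a2) module \<Rightarrow> bool" where
  "alg_isomorphic R A B \<longleftrightarrow> alg_iso R A B \<noteq> {}"

text \<open>For an idempotent \<open>e\<close>, the algebra \<open>e A e\<close> with identity element \<open>e\<close>.\<close>

definition corner :: "('r, 'a) module \<Rightarrow> 'a \<Rightarrow> ('r, 'a) module" where
  "corner A e = A\<lparr>carrier := {e \<otimes>\<^bsub>A\<^esub> x \<otimes>\<^bsub>A\<^esub> e | x. x \<in> carrier A}, one := e\<rparr>"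

text \<open>
  The free associative algebra on the generators \<open>I\<close>: finitely supported coefficient functions on
  the words in \<open>I\<close>, multiplied by convolution with respect to concatenation.
\<close>

definition free_algebra :: "('r, 'b) ring_scheme \<Rightarrow> 'i set \<Rightarrow> ('r, 'i list \<Rightarrow> 'r) module" where
  "free_algebra R I =
    \<lparr>carrier = {f. (\<forall>w. f w \<in> carrier R) \<and> finite {w. f w \<noteq> \<zero>\<^bsub>R\<^esub>} \<and>
                   {w. f w \<noteq> \<zero>\<^bsub>R\<^esub>} \<subseteq> lists I},
     monoid.mult = (\<lambda>f g w. \<Oplus>\<^bsub>R\<^esub>k\<in>{..length w}. f (take k w) \<otimes>\<^bsub>R\<^esub> g (drop k w)),
     monoid.one = (\<lambda>w. if w = [] then \<one>\<^bsub>R\<^esub> else \<zero>\<^bsub>R\<^esub>),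
     ring.zero = (\<lambda>w. \<zero>\<^bsub>R\<^esub>),
     ring.add = (\<lambda>f g w. f w \<oplus>\<^bsub>R\<^esub> g w),
     module.smult = (\<lambda>a f w. a \<otimes>\<^bsub>R\<^esub> f w)\<rparr>"

definition free_gen :: "('r, 'b) ring_scheme \<Rightarrow> 'i \<Rightarrow> 'i list \<Rightarrow> 'r" where
  "free_gen R i = (\<lambda>w. if w = [i] then \<one>\<^bsub>R\<^esub> else \<zero>\<^bsub>R\<^esub>)"

text \<open>The library quotient ring, together with the induced scalar multiplication.\<close>

definition quotient_algebra :: "('r, 'a) module \<Rightarrow> 'a set \<Rightarrow> ('r, 'a set) module" where
  "quotient_algebra A J =
    \<lparr>carrier = carrier (A Quot J), monoid.mult = monoid.mult (A Quot J), monoid.one = monoid.one (A Quot J),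
     ring.zero = ring.zero (A Quot J), ring.add = ring.add (A Quot J),
     module.smult = (\<lambda>a X. \<Union>x\<in>X. J +>\<^bsub>A\<^esub> (a \<odot>\<^bsub>A\<^esub> x))\<rparr>"

definition presented_algebra ::
    "('r, 'b) ring_scheme \<Rightarrow> 'i set \<Rightarrow> ('i list \<Rightarrow> 'r) set \<Rightarrow> ('r, ('i list \<Rightarrow> 'r) set) module" where
  "presented_algebra R I rels =
     quotient_algebra (free_algebra R I) (genideal (free_algebra R I) rels)"

definition presented_gen ::
    "('r, 'b) ring_scheme \<Rightarrow> 'i set \<Rightarrow> ('i list \<Rightarrow> 'r) set \<Rightarrow> 'i \<Rightarrow> ('i list \<Rightarrow> 'r) set" where
  "presented_gen R I rels i =
     genideal (free_algebra R I) rels +>\<^bsub>free_algebra R I\<^esub> free_gen R i"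


section \<open>Right modules and their endomorphism algebras\<close>

text \<open>\<open>vact V v h\<close> is the right action \<open>v h\<close> of \<open>h\<close> on \<open>v\<close>.\<close>

record ('h, 'v) right_module = "'v partial_object" +
  vzero :: 'v
  vadd :: "'v \<Rightarrow> 'v \<Rightarrow> 'v"
  vact :: "'v \<Rightarrow> 'h \<Rightarrow> 'v"

text \<open>
  Endomorphisms of a right module over the \<open>R\<close>-algebra \<open>H\<close>, written on the left; they are
  \<open>undefined\<close> outside the carrier.  Scalars act through \<open>a \<mapsto> a 1\<^sub>H\<close>.
\<close>

definition end_algebra ::
    "('r, 'b) ring_scheme \<Rightarrow> ('r, 'h) module \<Rightarrow> ('h, 'v) right_module \<Rightarrow> ('r, 'v \<Rightarrow> 'v) module" where
  "end_algebra R H V =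
    \<lparr>carrier = {\<phi> \<in> carrier V \<rightarrow>\<^sub>E carrier V.
        (\<forall>x\<in>carrier V. \<forall>y\<in>carrier V. \<phi> (vadd V x y) = vadd V (\<phi> x) (\<phi> y)) \<and>
        (\<forall>x\<in>carrier V. \<forall>h\<in>carrier H. \<phi> (vact V x h) = vact V (\<phi> x) h)},
     monoid.mult = (\<lambda>\<phi> \<psi>. compose (carrier V) \<phi> \<psi>),
     monoid.one = (\<lambda>x\<in>carrier V. x),
     ring.zero = (\<lambda>x\<in>carrier V. vzero V),
     ring.add = (\<lambda>\<phi> \<psi>. \<lambda>x\<in>carrier V. vadd V (\<phi> x) (\<psi> x)),
     module.smult = (\<lambda>a \<phi>. \<lambda>x\<in>carrier V. vact V (\<phi> x) (a \<odot>\<^bsub>H\<^esub> \<one>\<^bsub>H\<^esub>))\<rparr>"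

definition principal_right_ideal :: "('r, 'h) module \<Rightarrow> 'h \<Rightarrow> ('h, 'h) right_module" where
  "principal_right_ideal H g =
    \<lparr>carrier = {g \<otimes>\<^bsub>H\<^esub> h | h. h \<in> carrier H}, vzero = \<zero>\<^bsub>H\<^esub>, vadd = ring.add H, vact = monoid.mult H\<rparr>"

text \<open>The direct sum of a \<^emph>\<open>finite\<close> family of right modules.\<close>

definition direct_sum :: "'i set \<Rightarrow> ('i \<Rightarrow> ('h, 'v) right_module) \<Rightarrow> ('h, 'i \<Rightarrow> 'v) right_module" where
  "direct_sum I V =
    \<lparr>carrier = (\<Pi>\<^sub>E i\<in>I. carrier (V i)),
     vzero = (\<lambda>i\<in>I. vzero (V i)),
     vadd = (\<lambda>x y. \<lambda>i\<in>I. vadd (V i) (x i) (y i)),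
     vact = (\<lambda>x h. \<lambda>i\<in>I. vact (V i) (x i) h)\<rparr>"

text \<open>
  The \<open>H\<close>-linear map on \<open>g H\<close> with prescribed value \<open>v\<close> on the generator: \<open>g h \<mapsto> v h\<close>.  The value
  does not depend on the chosen \<open>h\<close> whenever such a linear map exists.
\<close>

definition map_of_generator :: "('r, 'h) module \<Rightarrow> 'h \<Rightarrow> 'h \<Rightarrow> 'h \<Rightarrow> 'h" where
  "map_of_generator H g v x = v \<otimes>\<^bsub>H\<^esub> (SOME h. h \<in> carrier H \<and> x = g \<otimes>\<^bsub>H\<^esub> h)"


section \<open>Permutations and words in the simple transpositions\<close>

definition word_perm :: "nat list \<Rightarrow> nat \<Rightarrow> nat" where
  "word_perm js = foldr (\<lambda>j p. transpose j (j + 1) \<circ> p) js id"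

definition perm_length :: "nat \<Rightarrow> (nat \<Rightarrow> nat) \<Rightarrow> nat" where
  "perm_length n w = (LEAST l. \<exists>js\<in>lists {1..<n}. word_perm js = w \<and> length js = l)"

definition reduced_word :: "nat \<Rightarrow> (nat \<Rightarrow> nat) \<Rightarrow> nat list \<Rightarrow> bool" where
  "reduced_word n w js \<longleftrightarrow>
     js \<in> lists {1..<n} \<and> word_perm js = w \<and> length js = perm_length n w"


section \<open>Compositions\<close>

text \<open>
  A multicomposition is a function on pairs \<open>(i, k)\<close> (row \<open>i\<close> of component \<open>k\<close>, both counted
  from 1) that vanishes off \<open>\<Gamma>(m)\<close>; it takes values in \<open>int\<close> so that it is literally an element
  of the weight lattice and \<open>\<mu> \<plusminus> \<alpha>\<close> is pointwise.
\<close>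

definition Gam :: "nat \<Rightarrow> (nat \<Rightarrow> nat) \<Rightarrow> (nat \<times> nat) set" where
  "Gam r m = {(i, k). 1 \<le> i \<and> i \<le> m k \<and> 1 \<le> k \<and> k \<le> r}"

definition compositions :: "nat \<Rightarrow> nat \<Rightarrow> (nat \<Rightarrow> nat) \<Rightarrow> (nat \<times> nat \<Rightarrow> int) set" where
  "compositions n r m = {\<mu>. (\<forall>c. 0 \<le> \<mu> c) \<and> (\<forall>c. c \<notin> Gam r m \<longrightarrow> \<mu> c = 0) \<and>
     (\<Sum>c\<in>Gam r m. \<mu> c) = int n}"

definition partitions :: "nat \<Rightarrow> nat \<Rightarrow> (nat \<Rightarrow> nat) \<Rightarrow> (nat \<times> nat \<Rightarrow> int) set" where
  "partitions n r m = {\<mu> \<in> compositions n r m.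
     \<forall>k\<in>{1..r}. \<forall>i j. 1 \<le> i \<and> i \<le> j \<and> j \<le> m k \<longrightarrow> \<mu> (j, k) \<le> \<mu> (i, k)}"

text \<open>The convention \<open>(m\<^sub>k + 1, k) = (1, k + 1)\<close>.\<close>

definition next_row :: "(nat \<Rightarrow> nat) \<Rightarrow> nat \<times> nat \<Rightarrow> nat \<times> nat" where
  "next_row m = (\<lambda>(i, k). if i = m k then (1, k + 1) else (i + 1, k))"

definition eps :: "nat \<times> nat \<Rightarrow> nat \<times> nat \<Rightarrow> int" where
  "eps c = (\<lambda>d. if d = c then 1 else 0)"

definition simple_root :: "(nat \<Rightarrow> nat) \<Rightarrow> nat \<times> nat \<Rightarrow> nat \<times> nat \<Rightarrow> int" where
  "simple_root m c = eps c - eps (next_row m c)"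

definition part_size :: "(nat \<Rightarrow> nat) \<Rightarrow> (nat \<times> nat \<Rightarrow> int) \<Rightarrow> nat \<Rightarrow> int" where
  "part_size m \<mu> k = (\<Sum>i\<in>{1..m k}. \<mu> (i, k))"

text \<open>The number \<open>a\<^sub>k\<close> of boxes in the components before \<open>k\<close>.\<close>

definition boxes_before :: "(nat \<Rightarrow> nat) \<Rightarrow> (nat \<times> nat \<Rightarrow> int) \<Rightarrow> nat \<Rightarrow> nat" where
  "boxes_before m \<mu> k = nat (\<Sum>l\<in>{1..<k}. part_size m \<mu> l)"

text \<open>The number \<open>N\<close> of boxes up to and including row \<open>(i, k)\<close>.\<close>

definition boxes_upto :: "(nat \<Rightarrow> nat) \<Rightarrow> (nat \<times> nat \<Rightarrow> int) \<Rightarrow> nat \<times> nat \<Rightarrow> nat" where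
  "boxes_upto m \<mu> = (\<lambda>(i, k).
     nat ((\<Sum>l\<in>{1..<k}. part_size m \<mu> l) + (\<Sum>j\<in>{1..i}. \<mu> (j, k))))"

definition young_subgroup ::
    "nat \<Rightarrow> nat \<Rightarrow> (nat \<Rightarrow> nat) \<Rightarrow> (nat \<times> nat \<Rightarrow> int) \<Rightarrow> (nat \<Rightarrow> nat) set" where
  "young_subgroup n r m \<mu> = {w. w permutes {1..n} \<and>
     (\<forall>c\<in>Gam r m. let B = {boxes_upto m \<mu> c - nat (\<mu> c) <.. boxes_upto m \<mu> c} in w ` B = B)}"

text \<open>The multipartition \<open>(\<emptyset>, \<dots>, \<emptyset>, (1\<^sup>n))\<close>.\<close>

definition omega :: "nat \<Rightarrow> nat \<Rightarrow> nat \<times> nat \<Rightarrow> int" where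
  "omega n r = (\<lambda>(i, k). if k = r \<and> 1 \<le> i \<and> i \<le> n then 1 else 0)"


section \<open>Presentations of the Hecke algebras\<close>

text \<open>
  Defining relations, as elements of a free algebra \<open>F\<close> on generators indexed by natural
  numbers, to be set equal to zero.
\<close>

definition hecke_relations ::
    "('r, 'b) ring_scheme \<Rightarrow> ('r, nat list \<Rightarrow> 'r) module \<Rightarrow> nat \<Rightarrow> 'r \<Rightarrow> (nat list \<Rightarrow> 'r) set" where
  "hecke_relations R F n q = (let X = free_gen R in
     {(X i \<ominus>\<^bsub>F\<^esub> q \<odot>\<^bsub>F\<^esub> \<one>\<^bsub>F\<^esub>) \<otimes>\<^bsub>F\<^esub> (X i \<oplus>\<^bsub>F\<^esub> (inv\<^bsub>R\<^esub> q) \<odot>\<^bsub>F\<^esub> \<one>\<^bsub>F\<^esub>) | i. 1 \<le> i \<and> i < n}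
   \<union> {(X i \<otimes>\<^bsub>F\<^esub> X (i + 1) \<otimes>\<^bsub>F\<^esub> X i) \<ominus>\<^bsub>F\<^esub> (X (i + 1) \<otimes>\<^bsub>F\<^esub> X i \<otimes>\<^bsub>F\<^esub> X (i + 1)) | i. 1 \<le> i \<and> i + 1 < n}
   \<union> {(X i \<otimes>\<^bsub>F\<^esub> X j) \<ominus>\<^bsub>F\<^esub> (X j \<otimes>\<^bsub>F\<^esub> X i) | i j. 1 \<le> i \<and> i + 2 \<le> j \<and> j < n})"

definition ariki_koike_relations ::
    "('r, 'b) ring_scheme \<Rightarrow> ('r, nat list \<Rightarrow> 'r) module \<Rightarrow> nat \<Rightarrow> nat \<Rightarrow> 'r \<Rightarrow> (nat \<Rightarrow> 'r)
       \<Rightarrow> (nat list \<Rightarrow> 'r) set" where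
  "ariki_koike_relations R F n r q Q = (let X = free_gen R in
     hecke_relations R F n q
   \<union> {lprod F (map (\<lambda>k. X 0 \<ominus>\<^bsub>F\<^esub> Q k \<odot>\<^bsub>F\<^esub> \<one>\<^bsub>F\<^esub>) [1..<r + 1])}
   \<union> (if 1 < n then {(X 0 \<otimes>\<^bsub>F\<^esub> X 1 \<otimes>\<^bsub>F\<^esub> X 0 \<otimes>\<^bsub>F\<^esub> X 1) \<ominus>\<^bsub>F\<^esub> (X 1 \<otimes>\<^bsub>F\<^esub> X 0 \<otimes>\<^bsub>F\<^esub> X 1 \<otimes>\<^bsub>F\<^esub> X 0)} else {})
   \<union> {(X 0 \<otimes>\<^bsub>F\<^esub> X j) \<ominus>\<^bsub>F\<^esub> (X j \<otimes>\<^bsub>F\<^esub> X 0) | j. 2 \<le> j \<and> j < n})"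

text \<open>The Iwahori-Hecke algebra of the symmetric group on \<open>n\<close> letters, by generators and relations.\<close>

definition iwahori_hecke ::
    "('r, 'b) ring_scheme \<Rightarrow> nat \<Rightarrow> 'r \<Rightarrow> ('r, (nat list \<Rightarrow> 'r) set) module" where
  "iwahori_hecke R n q =
     presented_algebra R {1..<n} (hecke_relations R (free_algebra R {1..<n}) n q)"


section \<open>The Ariki-Koike algebra and the cyclotomic q-Schur algebra\<close>

text \<open>
  The locale carries no assumptions; it only keeps the parameters implicit.  Of \<open>m\<close> and \<open>Q\<close> only
  the values at \<open>1, \<dots>, r\<close> matter.
\<close>

locale cyclotomic =
  fixes R :: "('r, 'b) ring_scheme" (structure)
    and n r :: nat
    and m :: "nat \<Rightarrow> nat"
    and q :: 'r
    and Q :: "nat \<Rightarrow> 'r"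
begin

definition AK :: "('r, (nat list \<Rightarrow> 'r) set) module" where
  "AK = presented_algebra R {..<n} (ariki_koike_relations R (free_algebra R {..<n}) n r q Q)"

definition T :: "nat \<Rightarrow> (nat list \<Rightarrow> 'r) set" where
  "T = presented_gen R {..<n} (ariki_koike_relations R (free_algebra R {..<n}) n r q Q)"

definition hecke_subalgebra :: "('r, (nat list \<Rightarrow> 'r) set) module" where
  "hecke_subalgebra = generated_subalgebra R AK (T ` {1..<n})"

text \<open>Jucys-Murphy elements, with the usual index starting at 1; \<open>JM 0\<close> is not used.\<close>

primrec JM :: "nat \<Rightarrow> (nat list \<Rightarrow> 'r) set" where
  "JM 0 = undefined"
| "JM (Suc i) = (if i = 0 then T 0 else T i \<otimes>\<^bsub>AK\<^esub> JM i \<otimes>\<^bsub>AK\<^esub> T i)"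

definition T_perm :: "(nat \<Rightarrow> nat) \<Rightarrow> (nat list \<Rightarrow> 'r) set" where
  "T_perm w = lprod AK (map T (SOME js. reduced_word n w js))"

definition weighted_sum :: "(nat \<Rightarrow> nat) set \<Rightarrow> (nat list \<Rightarrow> 'r) set" where
  "weighted_sum W = (\<Oplus>\<^bsub>AK\<^esub>w\<in>W. (q [^] perm_length n w) \<odot>\<^bsub>AK\<^esub> T_perm w)"

definition m_elem :: "(nat \<times> nat \<Rightarrow> int) \<Rightarrow> (nat list \<Rightarrow> 'r) set" where
  "m_elem \<mu> = weighted_sum (young_subgroup n r m \<mu>) \<otimes>\<^bsub>AK\<^esub>
     lprod AK (map (\<lambda>k. lprod AK (map (\<lambda>i. JM i \<ominus>\<^bsub>AK\<^esub> Q k \<odot>\<^bsub>AK\<^esub> \<one>\<^bsub>AK\<^esub>) [1..<boxes_before m \<mu> k + 1]))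
                 [1..<r + 1])"

definition perm_module :: "(nat \<times> nat \<Rightarrow> int) \<Rightarrow>
    ((nat list \<Rightarrow> 'r) set, (nat list \<Rightarrow> 'r) set) right_module" where
  "perm_module \<mu> = principal_right_ideal AK (m_elem \<mu>)"

definition tensor_space ::
    "((nat list \<Rightarrow> 'r) set, (nat \<times> nat \<Rightarrow> int) \<Rightarrow> (nat list \<Rightarrow> 'r) set) right_module" where
  "tensor_space = direct_sum (compositions n r m) perm_module"

definition schur :: "('r, ((nat \<times> nat \<Rightarrow> int) \<Rightarrow> (nat list \<Rightarrow> 'r) set)
    \<Rightarrow> (nat \<times> nat \<Rightarrow> int) \<Rightarrow> (nat list \<Rightarrow> 'r) set) module" where
  "schur = end_algebra R AK tensor_space"

definition incl :: "(nat \<times> nat \<Rightarrow> int) \<Rightarrow> (nat list \<Rightarrow> 'r) set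
    \<Rightarrow> (nat \<times> nat \<Rightarrow> int) \<Rightarrow> (nat list \<Rightarrow> 'r) set" where
  "incl \<mu> v = (\<lambda>\<nu>\<in>compositions n r m. if \<nu> = \<mu> then v else \<zero>\<^bsub>AK\<^esub>)"

definition proj :: "(nat \<times> nat \<Rightarrow> int) \<Rightarrow> ((nat \<times> nat \<Rightarrow> int) \<Rightarrow> (nat list \<Rightarrow> 'r) set)
    \<Rightarrow> (nat \<times> nat \<Rightarrow> int) \<Rightarrow> (nat list \<Rightarrow> 'r) set" where
  "proj \<mu> = (\<lambda>x\<in>carrier tensor_space. incl \<mu> (x \<mu>))"

text \<open>The values \<open>e(m\<^sub>\<mu>)\<close> and \<open>f(m\<^sub>\<mu>)\<close>.\<close>

definition e_value :: "nat \<times> nat \<Rightarrow> (nat \<times> nat \<Rightarrow> int) \<Rightarrow> (nat list \<Rightarrow> 'r) set" where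
  "e_value c \<mu> = (let N = boxes_upto m \<mu> c; p = \<mu> (next_row m c) in
     (q [^] (1 - p)) \<odot>\<^bsub>AK\<^esub> (m_elem (\<mu> + simple_root m c) \<otimes>\<^bsub>AK\<^esub>
        weighted_sum {word_perm [N + 1..<N + 1 + j] | j. j < nat p}))"

definition f_value :: "nat \<times> nat \<Rightarrow> (nat \<times> nat \<Rightarrow> int) \<Rightarrow> (nat list \<Rightarrow> 'r) set" where
  "f_value c \<mu> = (let N = boxes_upto m \<mu> c; p = \<mu> c;
       h = (if fst c = m (snd c) then JM N \<ominus>\<^bsub>AK\<^esub> Q (snd c + 1) \<odot>\<^bsub>AK\<^esub> \<one>\<^bsub>AK\<^esub> else \<one>\<^bsub>AK\<^esub>) in
     (q [^] (1 - p)) \<odot>\<^bsub>AK\<^esub> (m_elem (\<mu> - simple_root m c) \<otimes>\<^bsub>AK\<^esub> h \<otimes>\<^bsub>AK\<^esub>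
        weighted_sum {word_perm (rev [N - j..<N]) | j. j < nat p}))"

text \<open>
  \<open>e\<close> maps the summand \<open>M\<^sup>\<mu>\<close> to \<open>M\<^bsup>\<mu>+\<alpha>\<^esup>\<close> and \<open>f\<close> maps it to \<open>M\<^bsup>\<mu>-\<alpha>\<^esup>\<close> (to zero if that index
  is not a composition), so the \<open>\<nu>\<close>-component of the image comes from \<open>\<nu> - \<alpha>\<close>, resp. \<open>\<nu> + \<alpha>\<close>.
\<close>

definition e_map :: "nat \<times> nat \<Rightarrow> ((nat \<times> nat \<Rightarrow> int) \<Rightarrow> (nat list \<Rightarrow> 'r) set)
    \<Rightarrow> (nat \<times> nat \<Rightarrow> int) \<Rightarrow> (nat list \<Rightarrow> 'r) set" where
  "e_map c = (\<lambda>x\<in>carrier tensor_space. \<lambda>\<nu>\<in>compositions n r m.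
     let \<mu> = \<nu> - simple_root m c in
     if \<mu> \<in> compositions n r m then map_of_generator AK (m_elem \<mu>) (e_value c \<mu>) (x \<mu>) else \<zero>\<^bsub>AK\<^esub>)"

definition f_map :: "nat \<times> nat \<Rightarrow> ((nat \<times> nat \<Rightarrow> int) \<Rightarrow> (nat list \<Rightarrow> 'r) set)
    \<Rightarrow> (nat \<times> nat \<Rightarrow> int) \<Rightarrow> (nat list \<Rightarrow> 'r) set" where
  "f_map c = (\<lambda>x\<in>carrier tensor_space. \<lambda>\<nu>\<in>compositions n r m.
     let \<mu> = \<nu> + simple_root m c in
     if \<mu> \<in> compositions n r m then map_of_generator AK (m_elem \<mu>) (f_value c \<mu>) (x \<mu>) else \<zero>\<^bsub>AK\<^esub>)"

definition C :: "nat \<Rightarrow> ((nat \<times> nat \<Rightarrow> int) \<Rightarrow> (nat list \<Rightarrow> 'r) set)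
    \<Rightarrow> (nat \<times> nat \<Rightarrow> int) \<Rightarrow> (nat list \<Rightarrow> 'r) set" where
  "C i = (let c = (if i = 0 then (m (r - 1), r - 1) else (i, r)) in
     proj (omega n r) \<otimes>\<^bsub>schur\<^esub> f_map c \<otimes>\<^bsub>schur\<^esub> e_map c \<otimes>\<^bsub>schur\<^esub> proj (omega n r))"

definition omega_corner :: "('r, ((nat \<times> nat \<Rightarrow> int) \<Rightarrow> (nat list \<Rightarrow> 'r) set)
    \<Rightarrow> (nat \<times> nat \<Rightarrow> int) \<Rightarrow> (nat list \<Rightarrow> 'r) set) module" where
  "omega_corner = corner schur (proj (omega n r))"

definition omega_end ::
    "('r, (nat list \<Rightarrow> 'r) set \<Rightarrow> (nat list \<Rightarrow> 'r) set) module" where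
  "omega_end = end_algebra R AK (perm_module (omega n r))"

text \<open>
  The identification of \<open>1\<^sub>\<omega> \<S> 1\<^sub>\<omega>\<close> with the endomorphism algebra of the summand \<open>M\<^sup>\<omega>\<close>, and
  evaluation at \<open>m\<^sub>\<omega>\<close>.
\<close>

definition restrict_omega ::
    "(((nat \<times> nat \<Rightarrow> int) \<Rightarrow> (nat list \<Rightarrow> 'r) set) \<Rightarrow> (nat \<times> nat \<Rightarrow> int) \<Rightarrow> (nat list \<Rightarrow> 'r) set)
     \<Rightarrow> (nat list \<Rightarrow> 'r) set \<Rightarrow> (nat list \<Rightarrow> 'r) set" where
  "restrict_omega \<phi> =
     (\<lambda>v\<in>carrier (perm_module (omega n r)). \<phi> (incl (omega n r) v) (omega n r))"

definition eval_omega ::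
    "((nat list \<Rightarrow> 'r) set \<Rightarrow> (nat list \<Rightarrow> 'r) set) \<Rightarrow> (nat list \<Rightarrow> 'r) set" where
  "eval_omega \<psi> = \<psi> (m_elem (omega n r))"

end

end

theory Submission
  imports Defs
begin

text \<open>
  Since \<open>m\<^sub>\<omega> = 1\<close>, the summand \<open>M\<^sup>\<omega>\<close> is the regular right module of the Ariki-Koike algebra \<open>H\<close>, so
  every element of \<open>1\<^sub>\<omega> S 1\<^sub>\<omega>\<close> is left multiplication by a unique element of \<open>H\<close>.  The maps in \<open>C\<^sub>i\<close>
  pass through \<open>\<mu> = \<omega> + \<alpha>\<close>, and the prescribed value \<open>f(m\<^sub>\<mu>)\<close> is a scalar multiple of \<open>m\<^sub>\<mu>\<close>, so \<open>C\<^sub>i\<close> is left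
  multiplication by that multiple: \<open>m\<^sub>\<mu> = T\<^sub>0 - Q\<^sub>r\<close> for \<open>i = 0\<close>, and \<open>q\<^sup>-\<^sup>1 m\<^sub>\<mu> = q\<^sup>-\<^sup>1 (1 + q T\<^sub>i)\<close> for \<open>i \<ge> 1\<close>.
  The subalgebra of \<open>H\<close> generated by \<open>T\<^sub>1, \<dots>, T\<^bsub>n-1\<^esub>\<close> satisfies no relations beyond those of the Hecke
  algebra, because \<open>T\<^sub>0 \<mapsto> Q\<^sub>1\<close> defines a homomorphism from \<open>H\<close> back to the Hecke algebra.
\<close>

section \<open>Associative algebras and their homomorphisms\<close>

text \<open>\<open>map_of_generator\<close> picks some \<open>h\<close> with
  \<open>x = m_elem \<mu> \<otimes> h\<close>, which is ambiguous as soon as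
  \<open>m_elem \<mu>\<close> is annihilated from the right by a nonzero element. Along the path
  \<omega>, \<omega> + \<alpha>, \<omega> travelled by \<open>C i\<close> the ambiguity disappears
  for two different reasons: on the way up the generator is 1, so \<open>h = x\<close>; on the way
  down the prescribed value is a scalar times the generator itself, so that only the product with
  \<open>h\<close> enters. What has to be secured for all compositions is membership. Composition is
  restricted to the tensor space, so the intermediate vectors have to stay inside it whichever
  \<open>h\<close> is picked; hence the prescribed values are shown to lie in the target summands.
  The scalars come from the box count p in \<open>q [^] (1 - p)\<close>: the row from which
  \<open>f\<close> takes a box has p = 1 for i = 0 and p = 2 for i \<ge> 1. In the second case the
  unit in 1 + q T_i turns into the shift by the inverse of q; in the first case the shift by -Q_r
  stems from the factor \<open>h\<close> of \<open>f\<close>, because the box crosses from component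
  r - 1 to component r.\<close>

locale assoc_algebra = module R M + M?: ring M
  for R :: "('r, 'b) ring_scheme" (structure) and M :: "('r, 'a) module" (structure) +
  assumes smult_mult_l: "\<lbrakk>a \<in> carrier R; x \<in> carrier M; y \<in> carrier M\<rbrakk> \<Longrightarrow>
      (a \<odot>\<^bsub>M\<^esub> x) \<otimes>\<^bsub>M\<^esub> y = a \<odot>\<^bsub>M\<^esub> (x \<otimes>\<^bsub>M\<^esub> y)"
    and smult_mult_r: "\<lbrakk>a \<in> carrier R; x \<in> carrier M; y \<in> carrier M\<rbrakk> \<Longrightarrow>
      x \<otimes>\<^bsub>M\<^esub> (a \<odot>\<^bsub>M\<^esub> y) = a \<odot>\<^bsub>M\<^esub> (x \<otimes>\<^bsub>M\<^esub> y)"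

definition alg_hom ::
    "('r, 'b) ring_scheme \<Rightarrow> ('r, 'a1) module \<Rightarrow> ('r, 'a2) module \<Rightarrow> ('a1 \<Rightarrow> 'a2) set" where
  "alg_hom R A B = {h \<in> ring_hom A B.
     \<forall>a\<in>carrier R. \<forall>x\<in>carrier A. h (a \<odot>\<^bsub>A\<^esub> x) = a \<odot>\<^bsub>B\<^esub> h x}"

lemma alg_homI:
  assumes "\<And>x. x \<in> carrier A \<Longrightarrow> h x \<in> carrier B"
    and "\<And>x y. \<lbrakk>x \<in> carrier A; y \<in> carrier A\<rbrakk> \<Longrightarrow> h (x \<otimes>\<^bsub>A\<^esub> y) = h x \<otimes>\<^bsub>B\<^esub> h y"
    and "\<And>x y. \<lbrakk>x \<in> carrier A; y \<in> carrier A\<rbrakk> \<Longrightarrow> h (x \<oplus>\<^bsub>A\<^esub> y) = h x \<oplus>\<^bsub>B\<^esub> h y"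
    and "h \<one>\<^bsub>A\<^esub> = \<one>\<^bsub>B\<^esub>"
    and "\<And>a x. \<lbrakk>a \<in> carrier R; x \<in> carrier A\<rbrakk> \<Longrightarrow> h (a \<odot>\<^bsub>A\<^esub> x) = a \<odot>\<^bsub>B\<^esub> h x"
  shows "h \<in> alg_hom R A B"
  using assms by (auto simp: alg_hom_def ring_hom_def)

lemma alg_homD:
  assumes "h \<in> alg_hom R A B"
  shows "\<And>x. x \<in> carrier A \<Longrightarrow> h x \<in> carrier B"
    and "\<And>x y. \<lbrakk>x \<in> carrier A; y \<in> carrier A\<rbrakk> \<Longrightarrow> h (x \<otimes>\<^bsub>A\<^esub> y) = h x \<otimes>\<^bsub>B\<^esub> h y"
    and "\<And>x y. \<lbrakk>x \<in> carrier A; y \<in> carrier A\<rbrakk> \<Longrightarrow> h (x \<oplus>\<^bsub>A\<^esub> y) = h x \<oplus>\<^bsub>B\<^esub> h y"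
    and "h \<one>\<^bsub>A\<^esub> = \<one>\<^bsub>B\<^esub>"
    and "\<And>a x. \<lbrakk>a \<in> carrier R; x \<in> carrier A\<rbrakk> \<Longrightarrow> h (a \<odot>\<^bsub>A\<^esub> x) = a \<odot>\<^bsub>B\<^esub> h x"
  using assms by (auto simp: alg_hom_def ring_hom_def)

lemma alg_hom_compose:
  "\<lbrakk>g \<in> alg_hom R A B; h \<in> alg_hom R B C\<rbrakk> \<Longrightarrow> (\<lambda>x. h (g x)) \<in> alg_hom R A C"
  by (rule alg_homI) (simp_all add: alg_homD)

lemma alg_iso_iff: "h \<in> alg_iso R A B \<longleftrightarrow> h \<in> alg_hom R A B \<and> bij_betw h (carrier A) (carrier B)"
  by (auto simp: alg_iso_def alg_hom_def ring_iso_def)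

text \<open>The equations for \<open>h'\<close> are evaluated at sums, products and scalar
  multiples, so \<open>A\<close> has to be closed under its operations. This is for maps that agree
  with a known isomorphism only on the carrier.\<close>

lemma alg_iso_cong:
  assumes "h \<in> alg_iso R A B" "\<And>x. x \<in> carrier A \<Longrightarrow> h' x = h x" "assoc_algebra R A"
  shows "h' \<in> alg_iso R A B"
proof -
  interpret A: assoc_algebra R A by fact
  have h: "h \<in> alg_hom R A B" and b: "bij_betw h (carrier A) (carrier B)"
    using assms(1) by (auto simp: alg_iso_iff)
  have "h' \<in> alg_hom R A B"
    by (rule alg_homI) (simp_all add: assms(2) alg_homD[OF h])
  moreover have "bij_betw h' (carrier A) (carrier B)"
    using b assms(2) bij_betw_cong[of "carrier A" h' h] by blast
  ultimately show ?thesis by (simp add: alg_iso_iff)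
qed

text \<open>Every element of \<open>carrier B\<close> is some \<open>h x\<close>, so the operations
  of \<open>B\<close> are read off from those of \<open>A\<close>; surjectivity also makes the
  one-sided identity for \<open>g\<close> two-sided. The main use is with left multiplications,
  whose inverse is evaluation at the unit.\<close>

lemma alg_iso_inverse:
  assumes h: "h \<in> alg_iso R A B" and A: "assoc_algebra R A"
    and g: "\<And>x. x \<in> carrier A \<Longrightarrow> g (h x) = x"
  shows "g \<in> alg_iso R B A"
proof -
  interpret A: assoc_algebra R A by fact
  have hh: "h \<in> alg_hom R A B" and b: "bij_betw h (carrier A) (carrier B)"
    using h by (auto simp: alg_iso_iff)
  note hD = alg_homD(2-5)[OF hh, symmetric] and closed = alg_homD(1)[OF hh]
  have im: "y \<in> carrier B \<Longrightarrow> \<exists>x\<in>carrier A. y = h x" for y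
    using b by (auto simp: bij_betw_def)
  have "g \<in> alg_hom R B A"
  proof (rule alg_homI)
    show "g y \<in> carrier A" if "y \<in> carrier B" for y using im[OF that] g by auto
    show "g (y \<otimes>\<^bsub>B\<^esub> z) = g y \<otimes>\<^bsub>A\<^esub> g z" if "y \<in> carrier B" "z \<in> carrier B" for y z
      using im[OF that(1)] im[OF that(2)] g by (auto simp: hD)
    show "g (y \<oplus>\<^bsub>B\<^esub> z) = g y \<oplus>\<^bsub>A\<^esub> g z" if "y \<in> carrier B" "z \<in> carrier B" for y z
      using im[OF that(1)] im[OF that(2)] g by (auto simp: hD)
    show "g \<one>\<^bsub>B\<^esub> = \<one>\<^bsub>A\<^esub>" using g by (simp add: hD)
    show "g (a \<odot>\<^bsub>B\<^esub> y) = a \<odot>\<^bsub>A\<^esub> g y" if "a \<in> carrier R" "y \<in> carrier B" for a y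
      using im[OF that(2)] that(1) g by (auto simp: hD)
  qed
  moreover have "bij_betw g (carrier B) (carrier A)"
  proof (rule bij_betw_byWitness[of _ h])
    show "\<forall>y\<in>carrier B. h (g y) = y" using im g by force
    show "g ` carrier B \<subseteq> carrier A" using im g by force
  qed (use g closed in auto)
  ultimately show ?thesis by (simp add: alg_iso_iff)
qed

lemma alg_isomorphic_sym:
  assumes "assoc_algebra R A" "alg_isomorphic R A B"
  shows "alg_isomorphic R B A"
proof -
  obtain h where h: "h \<in> alg_iso R A B"
    using assms(2) by (auto simp: alg_isomorphic_def)
  then have "inj_on h (carrier A)"
    by (auto simp: alg_iso_iff bij_betw_def)
  then show ?thesis
    using alg_iso_inverse[OF h assms(1), of "inv_into (carrier A) h"]
    by (auto simp: alg_isomorphic_def)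
qed

lemma alg_isomorphic_trans:
  assumes "alg_isomorphic R A B" "alg_isomorphic R B C"
  shows "alg_isomorphic R A C"
proof -
  obtain g h where "g \<in> alg_iso R A B" "h \<in> alg_iso R B C"
    using assms by (auto simp: alg_isomorphic_def)
  then have "h \<circ> g \<in> alg_iso R A C"
    using alg_hom_compose[of g R A B h C] bij_betw_trans[of g "carrier A" "carrier B" h "carrier C"]
    by (auto simp: alg_iso_iff comp_def)
  then show ?thesis by (auto simp: alg_isomorphic_def)
qed

text \<open>Transport of structure: the algebra laws are identities between elements, and these
  survive a surjection that respects the operations. The zero is treated separately because
  \<open>ring_hom\<close> does not mention it and \<open>B\<close> is not yet known to be a group.
  Quotients and the corner at \<omega> both get their algebra laws in this way.\<close>

lemma assoc_algebra_image:
  assumes A: "assoc_algebra R A" and h: "h \<in> alg_hom R A B"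
    and surj: "h ` carrier A = carrier B" and zero: "h \<zero>\<^bsub>A\<^esub> = \<zero>\<^bsub>B\<^esub>"
  shows "assoc_algebra R B"
proof -
  interpret A: assoc_algebra R A by fact
  note hD = alg_homD(2-5)[OF h, symmetric]
  note closed = alg_homD(1)[OF h]
  note z = zero[symmetric]
  have im: "\<exists>x\<in>carrier A. y = h x" if "y \<in> carrier B" for y
    using that surj by auto
  have ag: "abelian_group B"
  proof (rule abelian_groupI)
    show "x \<oplus>\<^bsub>B\<^esub> y \<in> carrier B" if "x \<in> carrier B" "y \<in> carrier B" for x y
      using im[OF that(1)] im[OF that(2)] by (auto simp: hD closed)
    show "\<zero>\<^bsub>B\<^esub> \<in> carrier B" by (simp add: z closed)
    show "x \<oplus>\<^bsub>B\<^esub> y \<oplus>\<^bsub>B\<^esub> w = x \<oplus>\<^bsub>B\<^esub> (y \<oplus>\<^bsub>B\<^esub> w)"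
      if "x \<in> carrier B" "y \<in> carrier B" "w \<in> carrier B" for x y w
      using im[OF that(1)] im[OF that(2)] im[OF that(3)] by (auto simp: hD A.M.a_assoc)
    show "x \<oplus>\<^bsub>B\<^esub> y = y \<oplus>\<^bsub>B\<^esub> x" if "x \<in> carrier B" "y \<in> carrier B" for x y
      using im[OF that(1)] im[OF that(2)] by (auto simp: hD A.M.a_comm)
    show "\<zero>\<^bsub>B\<^esub> \<oplus>\<^bsub>B\<^esub> x = x" if "x \<in> carrier B" for x
      using im[OF that] by (auto simp: hD z)
    show "\<exists>y\<in>carrier B. y \<oplus>\<^bsub>B\<^esub> x = \<zero>\<^bsub>B\<^esub>" if x: "x \<in> carrier B" for x
    proof -
      obtain a where a: "a \<in> carrier A" "x = h a" using im[OF x] by auto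
      then have "h (\<ominus>\<^bsub>A\<^esub> a) \<oplus>\<^bsub>B\<^esub> x = \<zero>\<^bsub>B\<^esub>" by (simp add: hD z A.M.l_neg)
      then show ?thesis using a closed by blast
    qed
  qed
  have mon: "Group.monoid B"
  proof (rule monoidI)
    show "x \<otimes>\<^bsub>B\<^esub> y \<in> carrier B" if "x \<in> carrier B" "y \<in> carrier B" for x y
      using im[OF that(1)] im[OF that(2)] by (auto simp: hD closed)
    show "\<one>\<^bsub>B\<^esub> \<in> carrier B" by (simp add: hD closed)
    show "x \<otimes>\<^bsub>B\<^esub> y \<otimes>\<^bsub>B\<^esub> w = x \<otimes>\<^bsub>B\<^esub> (y \<otimes>\<^bsub>B\<^esub> w)"
      if "x \<in> carrier B" "y \<in> carrier B" "w \<in> carrier B" for x y w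
      using im[OF that(1)] im[OF that(2)] im[OF that(3)] by (auto simp: hD A.M.m_assoc)
    show "\<one>\<^bsub>B\<^esub> \<otimes>\<^bsub>B\<^esub> x = x" "x \<otimes>\<^bsub>B\<^esub> \<one>\<^bsub>B\<^esub> = x" if "x \<in> carrier B" for x
      using im[OF that] by (auto simp: hD)
  qed
  have ring: "ring B"
  proof (rule ringI[OF ag mon])
    show "(x \<oplus>\<^bsub>B\<^esub> y) \<otimes>\<^bsub>B\<^esub> w = x \<otimes>\<^bsub>B\<^esub> w \<oplus>\<^bsub>B\<^esub> y \<otimes>\<^bsub>B\<^esub> w"
      "w \<otimes>\<^bsub>B\<^esub> (x \<oplus>\<^bsub>B\<^esub> y) = w \<otimes>\<^bsub>B\<^esub> x \<oplus>\<^bsub>B\<^esub> w \<otimes>\<^bsub>B\<^esub> y"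
      if "x \<in> carrier B" "y \<in> carrier B" "w \<in> carrier B" for x y w
      using im[OF that(1)] im[OF that(2)] im[OF that(3)] by (auto simp: hD A.M.l_distr A.M.r_distr)
  qed
  have mod: "module R B"
  proof (rule moduleI[OF A.R.is_cring ag])
    show "a \<odot>\<^bsub>B\<^esub> x \<in> carrier B" if "a \<in> carrier R" "x \<in> carrier B" for a x
      using that(1) im[OF that(2)] by (auto simp: hD closed)
    show "(a \<oplus>\<^bsub>R\<^esub> b) \<odot>\<^bsub>B\<^esub> x = a \<odot>\<^bsub>B\<^esub> x \<oplus>\<^bsub>B\<^esub> b \<odot>\<^bsub>B\<^esub> x"
      "(a \<otimes>\<^bsub>R\<^esub> b) \<odot>\<^bsub>B\<^esub> x = a \<odot>\<^bsub>B\<^esub> (b \<odot>\<^bsub>B\<^esub> x)"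
      if "a \<in> carrier R" "b \<in> carrier R" "x \<in> carrier B" for a b x
      using that(1,2) im[OF that(3)] by (auto simp: hD A.smult_l_distr A.smult_assoc1)
    show "a \<odot>\<^bsub>B\<^esub> (x \<oplus>\<^bsub>B\<^esub> y) = a \<odot>\<^bsub>B\<^esub> x \<oplus>\<^bsub>B\<^esub> a \<odot>\<^bsub>B\<^esub> y"
      if "a \<in> carrier R" "x \<in> carrier B" "y \<in> carrier B" for a x y
      using that(1) im[OF that(2)] im[OF that(3)] by (auto simp: hD A.smult_r_distr)
    show "\<one>\<^bsub>R\<^esub> \<odot>\<^bsub>B\<^esub> x = x" if "x \<in> carrier B" for x using im[OF that] by (auto simp: hD)
  qed
  have "assoc_algebra_axioms R B"
  proof (rule assoc_algebra_axioms.intro)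
    fix a x y
    assume a: "a \<in> carrier R" and "x \<in> carrier B" and "y \<in> carrier B"
    then obtain x' y' where x: "x' \<in> carrier A" "x = h x'" and y: "y' \<in> carrier A" "y = h y'"
      using im by metis
    show "(a \<odot>\<^bsub>B\<^esub> x) \<otimes>\<^bsub>B\<^esub> y = a \<odot>\<^bsub>B\<^esub> (x \<otimes>\<^bsub>B\<^esub> y)"
      "x \<otimes>\<^bsub>B\<^esub> (a \<odot>\<^bsub>B\<^esub> y) = a \<odot>\<^bsub>B\<^esub> (x \<otimes>\<^bsub>B\<^esub> y)"
      using a x y by (simp_all add: hD A.smult_mult_l A.smult_mult_r)
  qed
  then show ?thesis by (intro assoc_algebra.intro mod ring)
qed

lemma alg_hom_ring_hom_ring:
  assumes "assoc_algebra R A" "assoc_algebra R B" "h \<in> alg_hom R A B"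
  shows "ring_hom_ring A B h"
  using assms by (intro ring_hom_ringI2) (auto simp: alg_hom_def assoc_algebra_def)

section \<open>Generated subalgebras\<close>

lemma generated_subalgebra_simps [simp]:
  "monoid.mult (generated_subalgebra R A X) = monoid.mult A"
  "monoid.one (generated_subalgebra R A X) = monoid.one A"
  "ring.zero (generated_subalgebra R A X) = ring.zero A"
  "ring.add (generated_subalgebra R A X) = ring.add A"
  "module.smult (generated_subalgebra R A X) = module.smult A"
  by (simp_all add: generated_subalgebra_def)

context assoc_algebra
begin

lemma lprod_closed: "set xs \<subseteq> carrier M \<Longrightarrow> lprod M xs \<in> carrier M"
  by (induction xs) (auto simp: lprod_def)

lemma lprod_append:
  "\<lbrakk>set xs \<subseteq> carrier M; set ys \<subseteq> carrier M\<rbrakk> \<Longrightarrow>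
    lprod M (xs @ ys) = lprod M xs \<otimes>\<^bsub>M\<^esub> lprod M ys"
  using lprod_closed by (induction xs) (auto simp: lprod_def M.m_assoc)

lemma lprod_singleton: "x \<in> carrier M \<Longrightarrow> lprod M [x] = x"
  by (simp add: lprod_def)

lemma a_inv_eq_smult: "x \<in> carrier M \<Longrightarrow> \<ominus>\<^bsub>M\<^esub> x = (\<ominus> \<one>) \<odot>\<^bsub>M\<^esub> x"
  by (simp add: smult_l_minus)

text \<open>Zero and negatives come for free from the scalars, as 0 times the unit and as (-1)
  x.\<close>

lemma subalgebra_ofI:
  assumes "B \<subseteq> carrier M" "\<one>\<^bsub>M\<^esub> \<in> B"
    and "\<And>x y. \<lbrakk>x \<in> B; y \<in> B\<rbrakk> \<Longrightarrow> x \<oplus>\<^bsub>M\<^esub> y \<in> B"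
    and "\<And>x y. \<lbrakk>x \<in> B; y \<in> B\<rbrakk> \<Longrightarrow> x \<otimes>\<^bsub>M\<^esub> y \<in> B"
    and smult: "\<And>a x. \<lbrakk>a \<in> carrier R; x \<in> B\<rbrakk> \<Longrightarrow> a \<odot>\<^bsub>M\<^esub> x \<in> B"
  shows "subalgebra_of B R M"
proof -
  have neg: "\<ominus>\<^bsub>M\<^esub> x \<in> B" if "x \<in> B" for x
    using assms(1) smult[of "\<ominus> \<one>" x] that by (auto simp: a_inv_eq_smult)
  have "\<zero> \<odot>\<^bsub>M\<^esub> \<one>\<^bsub>M\<^esub> \<in> B" using assms(2) smult by blast
  then have "\<zero>\<^bsub>M\<^esub> \<in> B" by simp
  then show ?thesis
    unfolding subalgebra_of_def using assms neg
    by (auto intro!: M.subringI submoduleI)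
qed

lemma subalgebra_ofD:
  assumes "subalgebra_of B R M"
  shows "B \<subseteq> carrier M" "\<one>\<^bsub>M\<^esub> \<in> B"
    and "\<And>x y. \<lbrakk>x \<in> B; y \<in> B\<rbrakk> \<Longrightarrow> x \<oplus>\<^bsub>M\<^esub> y \<in> B"
    and "\<And>x y. \<lbrakk>x \<in> B; y \<in> B\<rbrakk> \<Longrightarrow> x \<otimes>\<^bsub>M\<^esub> y \<in> B"
    and "\<And>a x. \<lbrakk>a \<in> carrier R; x \<in> B\<rbrakk> \<Longrightarrow> a \<odot>\<^bsub>M\<^esub> x \<in> B"
proof -
  have 1: "subring B M" and 2: "submodule B R M" using assms by (auto simp: subalgebra_of_def)
  show "B \<subseteq> carrier M" "\<one>\<^bsub>M\<^esub> \<in> B"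
    "\<And>x y. \<lbrakk>x \<in> B; y \<in> B\<rbrakk> \<Longrightarrow> x \<oplus>\<^bsub>M\<^esub> y \<in> B"
    "\<And>x y. \<lbrakk>x \<in> B; y \<in> B\<rbrakk> \<Longrightarrow> x \<otimes>\<^bsub>M\<^esub> y \<in> B"
    using subringE[OF 1] by auto
  show "\<And>a x. \<lbrakk>a \<in> carrier R; x \<in> B\<rbrakk> \<Longrightarrow> a \<odot>\<^bsub>M\<^esub> x \<in> B"
    using submodule.smult_closed[OF 2] by auto
qed

lemma subalgebra_of_carrier: "subalgebra_of (carrier M) R M"
  by (rule subalgebra_ofI) auto

lemma subalgebra_of_generated:
  assumes "X \<subseteq> carrier M"
  shows "subalgebra_of (carrier (generated_subalgebra R M X)) R M"
  unfolding generated_subalgebra_def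
proof (simp, rule subalgebra_ofI)
  let ?S = "{B. subalgebra_of B R M \<and> X \<subseteq> B}"
  \<comment> \<open>The whole carrier is one of the intersected subalgebras, so the intersection is
    not over an empty family.\<close>
  show "\<Inter> ?S \<subseteq> carrier M" using subalgebra_of_carrier assms by blast
qed (auto dest: subalgebra_ofD)

lemma generated_minimal:
  "\<lbrakk>subalgebra_of B R M; X \<subseteq> B\<rbrakk> \<Longrightarrow> carrier (generated_subalgebra R M X) \<subseteq> B"
  by (auto simp: generated_subalgebra_def)

lemma generated_incl: "X \<subseteq> carrier (generated_subalgebra R M X)"
  by (auto simp: generated_subalgebra_def)

lemma generated_eqI:
  assumes "X \<subseteq> carrier M" "Y \<subseteq> carrier M"
    and "X \<subseteq> carrier (generated_subalgebra R M Y)" "Y \<subseteq> carrier (generated_subalgebra R M X)"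
  shows "generated_subalgebra R M X = generated_subalgebra R M Y"
proof -
  have "carrier (generated_subalgebra R M X) = carrier (generated_subalgebra R M Y)"
    using assms by (intro equalityI generated_minimal subalgebra_of_generated)
  then show ?thesis by (simp add: generated_subalgebra_def)
qed

text \<open>A subalgebra contains the unit, so adding scalars to the generators changes nothing.
  This is what allows passing from the generators \<open>T i\<close> to the shifted elements that
  represent \<open>C i\<close>.\<close>

lemma generated_translate:
  assumes X: "\<And>i. i \<in> S \<Longrightarrow> x i \<in> carrier M" and c: "\<And>i. i \<in> S \<Longrightarrow> c i \<in> carrier R"
  shows "generated_subalgebra R M ((\<lambda>i. x i \<oplus>\<^bsub>M\<^esub> c i \<odot>\<^bsub>M\<^esub> \<one>\<^bsub>M\<^esub>) ` S) = generated_subalgebra R M (x ` S)"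
    (is "generated_subalgebra R M ?Y = generated_subalgebra R M ?X")
proof (rule generated_eqI)
  show XM: "?X \<subseteq> carrier M" and YM: "?Y \<subseteq> carrier M" using X c by auto
  note GX = subalgebra_ofD[OF subalgebra_of_generated[OF XM]]
  note GY = subalgebra_ofD[OF subalgebra_of_generated[OF YM]]
  show "?Y \<subseteq> carrier (generated_subalgebra R M ?X)"
    using generated_incl[of ?X] c by (auto intro!: GX)
  show "?X \<subseteq> carrier (generated_subalgebra R M ?Y)"
  proof
    fix y assume "y \<in> ?X"
    then obtain i where i: "i \<in> S" "y = x i" by auto
    have "(x i \<oplus>\<^bsub>M\<^esub> c i \<odot>\<^bsub>M\<^esub> \<one>\<^bsub>M\<^esub>) \<oplus>\<^bsub>M\<^esub> (\<ominus> c i) \<odot>\<^bsub>M\<^esub> \<one>\<^bsub>M\<^esub> \<in> carrier (generated_subalgebra R M ?Y)"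
      by (rule GY(3)[OF _ GY(5)[OF _ GY(2)]]) (use generated_incl[of ?Y] c i in auto)
    also have "(x i \<oplus>\<^bsub>M\<^esub> c i \<odot>\<^bsub>M\<^esub> \<one>\<^bsub>M\<^esub>) \<oplus>\<^bsub>M\<^esub> (\<ominus> c i) \<odot>\<^bsub>M\<^esub> \<one>\<^bsub>M\<^esub> = x i"
      using i X c by (simp add: smult_l_minus M.a_assoc M.r_neg)
    finally show "y \<in> carrier (generated_subalgebra R M ?Y)" by (simp add: i)
  qed
qed

end

lemma generated_image:
  assumes A: "assoc_algebra R A" and B: "assoc_algebra R B" and h: "h \<in> alg_hom R A B"
    and X: "X \<subseteq> carrier A"
  shows "h ` carrier (generated_subalgebra R A X) = carrier (generated_subalgebra R B (h ` X))"
proof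
  interpret A: assoc_algebra R A by fact
  interpret B: assoc_algebra R B by fact
  note hD = alg_homD[OF h]
  have hX: "h ` X \<subseteq> carrier B" using X hD(1) by auto
  note GA = A.subalgebra_of_generated[OF X] and GB = B.subalgebra_of_generated[OF hX]
  note DA = A.subalgebra_ofD[OF GA] and DB = B.subalgebra_ofD[OF GB]
  have "subalgebra_of {x \<in> carrier A. h x \<in> carrier (generated_subalgebra R B (h ` X))} R A"
    by (rule A.subalgebra_ofI) (auto simp: hD DB)
  then have "carrier (generated_subalgebra R A X)
      \<subseteq> {x \<in> carrier A. h x \<in> carrier (generated_subalgebra R B (h ` X))}"
    by (rule A.generated_minimal) (use X B.generated_incl[of "h ` X"] in auto)
  then show "h ` carrier (generated_subalgebra R A X) \<subseteq> carrier (generated_subalgebra R B (h ` X))"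
    by auto
  show "carrier (generated_subalgebra R B (h ` X)) \<subseteq> h ` carrier (generated_subalgebra R A X)"
  proof (rule B.generated_minimal)
    let ?G = "carrier (generated_subalgebra R A X)"
    have G: "x \<in> carrier A" if "x \<in> ?G" for x using that DA(1) by auto
    show "subalgebra_of (h ` ?G) R B"
    proof (rule B.subalgebra_ofI)
      show "h ` ?G \<subseteq> carrier B" using G hD(1) by auto
      show "\<one>\<^bsub>B\<^esub> \<in> h ` ?G" using DA(2) hD(4) by (metis imageI)
      show "x \<oplus>\<^bsub>B\<^esub> y \<in> h ` ?G" if "x \<in> h ` ?G" "y \<in> h ` ?G" for x y
        using that DA(3) G by (auto simp: hD(3)[symmetric])
      show "x \<otimes>\<^bsub>B\<^esub> y \<in> h ` ?G" if "x \<in> h ` ?G" "y \<in> h ` ?G" for x y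
        using that DA(4) G by (auto simp: hD(2)[symmetric])
      show "a \<odot>\<^bsub>B\<^esub> x \<in> h ` ?G" if "a \<in> carrier R" "x \<in> h ` ?G" for a x
        using that DA(5) G by (auto simp: hD(5)[symmetric])
    qed
    show "h ` X \<subseteq> h ` ?G" using A.generated_incl[of X] by auto
  qed
qed

text \<open>Injectivity is asked for on the generated part only, because the map from the
  Ariki-Koike algebra back to the Hecke algebra sends \<open>T 0\<close> to a scalar and need not be
  injective as a whole.\<close>

lemma alg_iso_generated:
  assumes A: "assoc_algebra R A" and B: "assoc_algebra R B" and h: "h \<in> alg_hom R A B"
    and X: "X \<subseteq> carrier A" and inj: "inj_on h (carrier (generated_subalgebra R A X))"
  shows "h \<in> alg_iso R (generated_subalgebra R A X) (generated_subalgebra R B (h ` X))"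
proof -
  interpret A: assoc_algebra R A by fact
  note im = generated_image[OF A B h X]
  have "x \<in> carrier A" if "x \<in> carrier (generated_subalgebra R A X)" for x
    using that A.subalgebra_ofD(1)[OF A.subalgebra_of_generated[OF X]] by blast
  then have "h \<in> alg_hom R (generated_subalgebra R A X) (generated_subalgebra R B (h ` X))"
    using im by (intro alg_homI) (auto simp: alg_homD[OF h])
  then show ?thesis using im inj by (auto simp: alg_iso_iff bij_betw_def)
qed

lemma assoc_algebra_generated:
  assumes A: "assoc_algebra R A" and X: "X \<subseteq> carrier A"
  shows "assoc_algebra R (generated_subalgebra R A X)"
proof -
  interpret A: assoc_algebra R A by fact
  have S: "subalgebra_of (carrier (generated_subalgebra R A X)) R A"
    by (rule A.subalgebra_of_generated[OF X])
  then have "module R (A\<lparr>carrier := carrier (generated_subalgebra R A X)\<rparr>)"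
    and "ring (A\<lparr>carrier := carrier (generated_subalgebra R A X)\<rparr>)"
    using submodule.submodule_is_module[OF _ A.module_axioms] A.subring_is_ring
    by (auto simp: subalgebra_of_def)
  moreover have "A\<lparr>carrier := carrier (generated_subalgebra R A X)\<rparr> = generated_subalgebra R A X"
    by (simp add: generated_subalgebra_def)
  ultimately have "module R (generated_subalgebra R A X)" "ring (generated_subalgebra R A X)"
    by simp_all
  moreover have "x \<in> carrier A" if "x \<in> carrier (generated_subalgebra R A X)" for x
    using that A.subalgebra_ofD(1)[OF S] by blast
  then have "assoc_algebra_axioms R (generated_subalgebra R A X)"
    by (intro assoc_algebra_axioms.intro)
      (auto simp: A.smult_mult_l A.smult_mult_r)
  ultimately show ?thesis by (intro assoc_algebra.intro)
qed

section \<open>Quotient algebras\<close>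

context assoc_algebra
begin

text \<open>A ring ideal is stable under scalars because a x is the product of the ring element a 1
  with x.\<close>

lemma smult_ideal:
  assumes "ideal J M" "a \<in> carrier R" "x \<in> J"
  shows "a \<odot>\<^bsub>M\<^esub> x \<in> J"
proof -
  interpret J: ideal J M by fact
  have x: "x \<in> carrier M" using assms(3) by (rule J.a_Hcarr)
  have "(a \<odot>\<^bsub>M\<^esub> \<one>\<^bsub>M\<^esub>) \<otimes>\<^bsub>M\<^esub> x \<in> J" using assms by (intro J.I_l_closed) auto
  then show ?thesis using assms x by (simp add: smult_mult_l)
qed

text \<open>The scalar action on a coset is a union over all representatives. Since \<open>J\<close>
  is stable under scalars, each representative contributes the same coset.\<close>

lemma quotient_smult:
  assumes "ideal J M" "a \<in> carrier R" "x \<in> carrier M"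
  shows "a \<odot>\<^bsub>quotient_algebra M J\<^esub> (J +>\<^bsub>M\<^esub> x) = J +>\<^bsub>M\<^esub> (a \<odot>\<^bsub>M\<^esub> x)"
proof -
  interpret J: ideal J M by fact
  have "J +>\<^bsub>M\<^esub> (a \<odot>\<^bsub>M\<^esub> y) = J +>\<^bsub>M\<^esub> (a \<odot>\<^bsub>M\<^esub> x)" if "y \<in> J +>\<^bsub>M\<^esub> x" for y
  proof -
    obtain j where j: "j \<in> J" "y = j \<oplus>\<^bsub>M\<^esub> x"
      using \<open>y \<in> J +>\<^bsub>M\<^esub> x\<close> by (auto simp: a_r_coset_def r_coset_def)
    have "a \<odot>\<^bsub>M\<^esub> y = a \<odot>\<^bsub>M\<^esub> j \<oplus>\<^bsub>M\<^esub> a \<odot>\<^bsub>M\<^esub> x"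
      using j assms by (simp add: smult_r_distr)
    then have "a \<odot>\<^bsub>M\<^esub> y \<in> J +>\<^bsub>M\<^esub> (a \<odot>\<^bsub>M\<^esub> x)"
      using smult_ideal[OF assms(1,2) j(1)] by (auto simp: a_r_coset_def r_coset_def)
    then show ?thesis
      using M.a_repr_independence[OF _ _ J.a_subgroup] assms by simp
  qed
  then have "(\<Union>y\<in>J +>\<^bsub>M\<^esub> x. J +>\<^bsub>M\<^esub> (a \<odot>\<^bsub>M\<^esub> y)) = (\<Union>y\<in>J +>\<^bsub>M\<^esub> x. J +>\<^bsub>M\<^esub> (a \<odot>\<^bsub>M\<^esub> x))"
    by (rule SUP_cong[OF refl])
  \<comment> \<open>The index set of the union is inhabited, so the union of the constant family is
    that constant.\<close>
  moreover have "x \<in> J +>\<^bsub>M\<^esub> x" using assms(3) by (rule J.a_rcos_self)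
  ultimately show ?thesis unfolding quotient_algebra_def by (simp only: module.simps) blast
qed

lemma coset_alg_hom:
  assumes "ideal J M"
  shows "(\<lambda>x. J +>\<^bsub>M\<^esub> x) \<in> alg_hom R M (quotient_algebra M J)"
  using ideal.rcos_ring_hom[OF assms] quotient_smult[OF assms]
  by (auto simp: alg_hom_def ring_hom_def) (auto simp: quotient_algebra_def)

lemma quotient_carrier: "carrier (quotient_algebra M J) = (\<lambda>x. J +>\<^bsub>M\<^esub> x) ` carrier M"
  by (auto simp: quotient_algebra_def FactRing_def A_RCOSETS_def')

lemma coset_eq_zero_iff:
  assumes "ideal J M" "x \<in> carrier M"
  shows "J +>\<^bsub>M\<^esub> x = \<zero>\<^bsub>quotient_algebra M J\<^esub> \<longleftrightarrow> x \<in> J"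
proof -
  interpret J: ideal J M by fact
  show ?thesis
    using assms(2) M.a_coset_join1[OF _ _ J.a_subgroup] M.a_coset_join2[OF _ J.a_subgroup]
    by (auto simp: quotient_algebra_def FactRing_def)
qed

lemma quotient_assoc_algebra:
  assumes "ideal J M"
  shows "assoc_algebra R (quotient_algebra M J)"
proof (rule assoc_algebra_image[OF assoc_algebra_axioms coset_alg_hom[OF assms]])
  interpret J: ideal J M by fact
  show "J +>\<^bsub>M\<^esub> \<zero>\<^bsub>M\<^esub> = \<zero>\<^bsub>quotient_algebra M J\<^esub>" using coset_eq_zero_iff[OF assms] by simp
qed (simp add: quotient_carrier)

end

lemma quotient_universal:
  assumes A: "assoc_algebra R A" and B: "assoc_algebra R B" and h: "h \<in> alg_hom R A B"
    and J: "ideal J A" and ker: "\<And>x. x \<in> J \<Longrightarrow> h x = \<zero>\<^bsub>B\<^esub>"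
  obtains g where "g \<in> alg_hom R (quotient_algebra A J) B"
    and "\<And>x. x \<in> carrier A \<Longrightarrow> g (J +>\<^bsub>A\<^esub> x) = h x"
proof
  interpret A: assoc_algebra R A by fact
  interpret B: assoc_algebra R B by fact
  interpret J: ideal J A by fact
  note hD = alg_homD[OF h] and cD = alg_homD[OF A.coset_alg_hom[OF J]]
  \<comment> \<open>Any representative will do: two of them differ by an element of
    \<open>J\<close>, which \<open>h\<close> kills.\<close>
  define g where "g X = h (SOME y. y \<in> X)" for X
  show g: "g (J +>\<^bsub>A\<^esub> x) = h x" if "x \<in> carrier A" for x
  proof -
    have "x \<in> J +>\<^bsub>A\<^esub> x" using that by (rule J.a_rcos_self)
    then have "(SOME y. y \<in> J +>\<^bsub>A\<^esub> x) \<in> J +>\<^bsub>A\<^esub> x" by (rule someI)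
    then obtain j where "j \<in> J" "(SOME y. y \<in> J +>\<^bsub>A\<^esub> x) = j \<oplus>\<^bsub>A\<^esub> x"
      by (auto simp: a_r_coset_def r_coset_def)
    then show ?thesis using that hD(1,3) ker by (simp add: g_def)
  qed
  let ?Q = "quotient_algebra A J"
  have im: "\<exists>x\<in>carrier A. X = J +>\<^bsub>A\<^esub> x" if "X \<in> carrier ?Q" for X
    using that by (auto simp: A.quotient_carrier)
  show "g \<in> alg_hom R ?Q B"
  proof (rule alg_homI)
    fix X Y a
    assume "X \<in> carrier ?Q" then obtain x where x: "x \<in> carrier A" "X = J +>\<^bsub>A\<^esub> x" using im by blast
    show "g X \<in> carrier B" using hD(1) x by (simp add: g)
    show "g (a \<odot>\<^bsub>?Q\<^esub> X) = a \<odot>\<^bsub>B\<^esub> g X" if "a \<in> carrier R"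
      using that x by (simp add: g hD(5) cD(5)[symmetric])
    assume "Y \<in> carrier ?Q" then obtain y where y: "y \<in> carrier A" "Y = J +>\<^bsub>A\<^esub> y" using im by blast
    show "g (X \<otimes>\<^bsub>?Q\<^esub> Y) = g X \<otimes>\<^bsub>B\<^esub> g Y"
      using x y by (simp add: g hD(2) cD(2)[symmetric])
    show "g (X \<oplus>\<^bsub>?Q\<^esub> Y) = g X \<oplus>\<^bsub>B\<^esub> g Y"
      using x y by (simp add: g hD(3) cD(3)[symmetric])
  next
    show "g \<one>\<^bsub>?Q\<^esub> = \<one>\<^bsub>B\<^esub>"
      by (simp add: g hD(4) cD(4)[symmetric])
  qed
qed

section \<open>Free and presented algebras\<close>

definition free_monom :: "('r, 'b) ring_scheme \<Rightarrow> 'r \<Rightarrow> 'i list \<Rightarrow> 'i list \<Rightarrow> 'r" where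
  "free_monom R c w = (\<lambda>v. if v = w then c else \<zero>\<^bsub>R\<^esub>)"

lemma free_algebra_simps [simp]:
  "monoid.mult (free_algebra R I) = (\<lambda>f g w. \<Oplus>\<^bsub>R\<^esub>k\<in>{..length w}. f (take k w) \<otimes>\<^bsub>R\<^esub> g (drop k w))"
  "monoid.one (free_algebra R I) = free_monom R \<one>\<^bsub>R\<^esub> []"
  "ring.zero (free_algebra R I) = (\<lambda>w. \<zero>\<^bsub>R\<^esub>)"
  "ring.add (free_algebra R I) = (\<lambda>f g w. f w \<oplus>\<^bsub>R\<^esub> g w)"
  "module.smult (free_algebra R I) = (\<lambda>a f w. a \<otimes>\<^bsub>R\<^esub> f w)"
  by (auto simp: free_algebra_def free_monom_def)

lemma free_algebra_carrier:
  "f \<in> carrier (free_algebra R I) \<longleftrightarrow>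
    (\<forall>w. f w \<in> carrier R) \<and> finite {w. f w \<noteq> \<zero>\<^bsub>R\<^esub>} \<and> {w. f w \<noteq> \<zero>\<^bsub>R\<^esub>} \<subseteq> lists I"
  by (simp add: free_algebra_def)

lemma free_gen_eq: "free_gen R i = free_monom R \<one>\<^bsub>R\<^esub> [i]"
  by (simp add: free_gen_def free_monom_def)

context cring
begin

lemma free_algebra_value: "f \<in> carrier (free_algebra R I) \<Longrightarrow> f w \<in> carrier R"
  by (simp add: free_algebra_carrier)

lemma free_monom_closed: "\<lbrakk>c \<in> carrier R; w \<in> lists I\<rbrakk> \<Longrightarrow> free_monom R c w \<in> carrier (free_algebra R I)"
  by (auto simp: free_algebra_carrier free_monom_def intro: finite_subset[of _ "{w}"])

lemma free_add_closed:
  assumes "f \<in> carrier (free_algebra R I)" "g \<in> carrier (free_algebra R I)"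
  shows "f \<oplus>\<^bsub>free_algebra R I\<^esub> g \<in> carrier (free_algebra R I)"
proof -
  have sub: "{w. f w \<oplus> g w \<noteq> \<zero>} \<subseteq> {w. f w \<noteq> \<zero>} \<union> {w. g w \<noteq> \<zero>}" by auto
  then have "finite {w. f w \<oplus> g w \<noteq> \<zero>}"
    by (rule finite_subset) (use assms in \<open>simp add: free_algebra_carrier\<close>)
  moreover have "{w. f w \<oplus> g w \<noteq> \<zero>} \<subseteq> lists I"
    using sub by (rule subset_trans) (use assms in \<open>simp add: free_algebra_carrier\<close>)
  ultimately show ?thesis using assms by (simp add: free_algebra_carrier)
qed

lemma free_smult_closed:
  assumes "a \<in> carrier R" "f \<in> carrier (free_algebra R I)"
  shows "a \<odot>\<^bsub>free_algebra R I\<^esub> f \<in> carrier (free_algebra R I)"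
proof -
  have sub: "{w. a \<otimes> f w \<noteq> \<zero>} \<subseteq> {w. f w \<noteq> \<zero>}" using assms by auto
  then have "finite {w. a \<otimes> f w \<noteq> \<zero>}"
    by (rule finite_subset) (use assms in \<open>simp add: free_algebra_carrier\<close>)
  moreover have "{w. a \<otimes> f w \<noteq> \<zero>} \<subseteq> lists I"
    using sub by (rule subset_trans) (use assms in \<open>simp add: free_algebra_carrier\<close>)
  ultimately show ?thesis using assms by (simp add: free_algebra_carrier)
qed

text \<open>Finite support lets a function be written as a sum of monomials. Every law of the
  convolution product below that is additive in each factor is reduced by this rule to
  words.\<close>

lemma free_algebra_induct [consumes 1, case_names zero monom add]:
  assumes f: "f \<in> carrier (free_algebra R I)"
    and zero: "P (\<lambda>w. \<zero>)"
    and monom: "\<And>c w. \<lbrakk>c \<in> carrier R; w \<in> lists I\<rbrakk> \<Longrightarrow> P (free_monom R c w)"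
    and add: "\<And>f g. \<lbrakk>f \<in> carrier (free_algebra R I); g \<in> carrier (free_algebra R I); P f; P g\<rbrakk>
      \<Longrightarrow> P (\<lambda>w. f w \<oplus> g w)"
  shows "P f"
proof -
  \<comment> \<open>The induction runs over a finite set that contains the support, so a word can be
    removed even if its coefficient happens to vanish.\<close>
  have "P f" if "finite S" "f \<in> carrier (free_algebra R I)" "{w. f w \<noteq> \<zero>} \<subseteq> S" for S f
    using that
  proof (induction S arbitrary: f rule: finite_induct)
    case empty
    then have "f = (\<lambda>w. \<zero>)" by auto
    then show ?case by (simp add: zero)
  next
    case (insert w S)
    show ?case
    proof (cases "f w = \<zero>")
      case True
      then show ?thesis using insert by (intro insert.IH) auto
    next
      case False
      then have w: "w \<in> lists I" "f w \<in> carrier R"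
        using insert.prems by (auto simp: free_algebra_carrier)
      define g where "g = f(w := \<zero>)"
      have sub: "{v. g v \<noteq> \<zero>} \<subseteq> {v. f v \<noteq> \<zero>}" "{v. g v \<noteq> \<zero>} \<subseteq> S"
        using insert.prems(2) by (auto simp: g_def)
      then have g: "g \<in> carrier (free_algebra R I)"
        using insert.prems(1) finite_subset[OF sub(1)]
        by (auto simp: free_algebra_carrier g_def)
      have "P (\<lambda>v. free_monom R (f w) w v \<oplus> g v)"
        using w g sub(2) by (intro add monom free_monom_closed insert.IH)
      also have "(\<lambda>v. free_monom R (f w) w v \<oplus> g v) = f"
        using insert.prems(1) by (auto simp: free_monom_def free_algebra_carrier g_def)
      finally show ?thesis .
    qed
  qed
  then show ?thesis using f by (auto simp: free_algebra_carrier)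
qed

lemma free_mult_monom:
  assumes c: "c \<in> carrier R" and d: "d \<in> carrier R"
  shows "free_monom R c u \<otimes>\<^bsub>free_algebra R I\<^esub> free_monom R d v = free_monom R (c \<otimes> d) (u @ v)"
proof
  fix w
  \<comment> \<open>Among all cuts of \<open>w\<close>, only the cut after \<open>length u\<close>
    letters can contribute, and only if \<open>w\<close> is \<open>u @ v\<close>; the convolution
    sum becomes a sum with a single possibly nonzero term.\<close>
  have eq: "free_monom R c u (take k w) \<otimes> free_monom R d v (drop k w)
      = (if length u = k then (if w = u @ v then c \<otimes> d else \<zero>) else \<zero>)" if "k \<le> length w" for k
  proof (cases "take k w = u \<and> drop k w = v")
    case True
    then have "length u = k" using that by auto
    moreover have "w = u @ v" using True append_take_drop_id[of k w] by simp
    ultimately show ?thesis using True by (simp add: free_monom_def)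
  next
    case False
    moreover have "\<not> (length u = k \<and> w = u @ v)" using False by auto
    ultimately show ?thesis using c d by (auto simp: free_monom_def)
  qed
  have "(free_monom R c u \<otimes>\<^bsub>free_algebra R I\<^esub> free_monom R d v) w
      = (\<Oplus>k\<in>{..length w}. if length u = k then (if w = u @ v then c \<otimes> d else \<zero>) else \<zero>)"
    unfolding free_algebra_simps using c d by (intro finsum_cong') (auto simp: eq)
  also have "\<dots> = free_monom R (c \<otimes> d) (u @ v) w"
  \<comment> \<open>If \<open>u\<close> is longer than \<open>w\<close>, the critical cut is outside
    the range of summation, and then \<open>w\<close> differs from \<open>u @ v\<close>, so both
    sides vanish.\<close>
  proof (cases "length u \<le> length w")
    case True
    then show ?thesis
      using finsum_singleton[of "length u" "{..length w}" "\<lambda>_. if w = u @ v then c \<otimes> d else \<zero>"] c d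
      by (auto simp: free_monom_def)
  next
    case False
    then have "(\<Oplus>k\<in>{..length w}. if length u = k then (if w = u @ v then c \<otimes> d else \<zero>) else \<zero>)
        = (\<Oplus>k\<in>{..length w}. \<zero>)"
      by (intro finsum_cong') auto
    then show ?thesis using False by (auto simp: free_monom_def)
  qed
  finally show "(free_monom R c u \<otimes>\<^bsub>free_algebra R I\<^esub> free_monom R d v) w = \<dots>" .
qed

lemma free_mult_zero:
  assumes "f \<in> carrier (free_algebra R I)"
  shows "f \<otimes>\<^bsub>free_algebra R I\<^esub> (\<lambda>w. \<zero>) = (\<lambda>w. \<zero>)" "(\<lambda>w. \<zero>) \<otimes>\<^bsub>free_algebra R I\<^esub> f = (\<lambda>w. \<zero>)"
  using free_algebra_value[OF assms] by simp_all

lemma free_mult_add: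
  assumes "f \<in> carrier (free_algebra R I)" "g \<in> carrier (free_algebra R I)" "h \<in> carrier (free_algebra R I)"
  shows "(f \<oplus>\<^bsub>free_algebra R I\<^esub> g) \<otimes>\<^bsub>free_algebra R I\<^esub> h =
      f \<otimes>\<^bsub>free_algebra R I\<^esub> h \<oplus>\<^bsub>free_algebra R I\<^esub> g \<otimes>\<^bsub>free_algebra R I\<^esub> h"
    and "h \<otimes>\<^bsub>free_algebra R I\<^esub> (f \<oplus>\<^bsub>free_algebra R I\<^esub> g) =
      h \<otimes>\<^bsub>free_algebra R I\<^esub> f \<oplus>\<^bsub>free_algebra R I\<^esub> h \<otimes>\<^bsub>free_algebra R I\<^esub> g"
  using assms[THEN free_algebra_value]
  by (auto simp: l_distr r_distr finsum_addf fun_eq_iff)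

text \<open>Finiteness of the support of a product is not estimated directly: the product is
  additive in both factors, and for monomials it is again a monomial.\<close>

lemma free_mult_closed:
  assumes f: "f \<in> carrier (free_algebra R I)" and g: "g \<in> carrier (free_algebra R I)"
  shows "f \<otimes>\<^bsub>free_algebra R I\<^esub> g \<in> carrier (free_algebra R I)"
proof -
  have zero: "(\<lambda>w. \<zero>) \<in> carrier (free_algebra R I)" by (simp add: free_algebra_carrier)
  show ?thesis
    using f g
  proof (induction arbitrary: g rule: free_algebra_induct)
    case zero
    then show ?case using \<open>(\<lambda>w. \<zero>) \<in> _\<close> by (simp only: free_mult_zero)
  next
    case (monom c u)
    from monom(3) show ?case
    proof (induction rule: free_algebra_induct)
      case zero
      then show ?case using \<open>(\<lambda>w. \<zero>) \<in> _\<close> free_monom_closed[OF monom(1,2)] by (simp only: free_mult_zero)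
    next
      case (monom d v)
      then show ?case using \<open>c \<in> carrier R\<close> \<open>u \<in> lists I\<close>
        by (simp only: free_mult_monom free_monom_closed m_closed append_in_lists_conv simp_thms)
    next
      case (add f g)
      then show ?case
        using free_add_closed[OF add(3,4)] free_mult_add(2)[OF add(1,2) free_monom_closed[OF monom(1,2)]]
        by (simp only: free_algebra_simps)
    qed
  next
    case (add f h)
    then show ?case
      using free_add_closed[OF add(3)[OF add(5)] add(4)[OF add(5)]] free_mult_add(1)[OF add(1,2,5)]
      by (simp only: free_algebra_simps)
  qed
qed

text \<open>Both sides are additive in each of the three factors, so everything reduces to
  concatenation of words and multiplication in \<open>R\<close>. The nested inductions free the
  third factor, then the second, then the first.\<close>

lemma free_mult_assoc:
  assumes f: "f \<in> carrier (free_algebra R I)" and g: "g \<in> carrier (free_algebra R I)"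
    and h: "h \<in> carrier (free_algebra R I)"
  shows "(f \<otimes>\<^bsub>free_algebra R I\<^esub> g) \<otimes>\<^bsub>free_algebra R I\<^esub> h = f \<otimes>\<^bsub>free_algebra R I\<^esub> (g \<otimes>\<^bsub>free_algebra R I\<^esub> h)"
    (is "?m (?m f g) h = ?m f (?m g h)")
proof -
  let ?F = "free_algebra R I"
  let ?a = "ring.add ?F"
  note zero = free_mult_zero and cl = free_mult_closed and mc = free_monom_closed
  have dl: "?m (\<lambda>w. f w \<oplus> g w) h = ?a (?m f h) (?m g h)"
    and dr: "?m h (\<lambda>w. f w \<oplus> g w) = ?a (?m h f) (?m h g)"
    if "f \<in> carrier ?F" "g \<in> carrier ?F" "h \<in> carrier ?F" for f g h
    using free_mult_add[OF that] by (simp_all only: free_algebra_simps)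
  have 1: "?m (?m (free_monom R a u) (free_monom R b v)) h = ?m (free_monom R a u) (?m (free_monom R b v) h)"
    if "a \<in> carrier R" "u \<in> lists I" "b \<in> carrier R" "v \<in> lists I" "h \<in> carrier ?F" for a u b v h
    using that(5)
  proof (induction rule: free_algebra_induct)
    case zero
    show ?case using that by (simp only: free_mult_zero[of _ I] cl mc)
  next
    case (monom c w)
    then show ?case using that by (simp only: free_mult_monom m_closed m_assoc append_assoc)
  next
    case (add f g)
    then show ?case
      using that dr[OF cl[OF mc[OF that(3,4)] add(1)] cl[OF mc[OF that(3,4)] add(2)] mc[OF that(1,2)]]
      by (simp only: dr cl mc free_algebra_simps(4))
  qed
  have 2: "?m (?m (free_monom R a u) g) h = ?m (free_monom R a u) (?m g h)"
    if "a \<in> carrier R" "u \<in> lists I" "g \<in> carrier ?F" "h \<in> carrier ?F" for a u g h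
    using that(3)
  proof (induction rule: free_algebra_induct)
    case zero
    show ?case using that by (simp only: free_mult_zero[of _ I] cl mc)
  next
    case (monom c w)
    then show ?case using that 1 by blast
  next
    case (add f g)
    then show ?case using that dl[OF cl[OF mc[OF that(1,2)] add(1)] cl[OF mc[OF that(1,2)] add(2)] that(4)]
      by (simp only: dr dl cl mc free_algebra_simps(4))
  qed
  show ?thesis
    using f
  proof (induction rule: free_algebra_induct)
    case zero
    show ?case using g h by (simp only: free_mult_zero[of _ I] cl)
  next
    case (monom c w)
    then show ?case using g h 2 by blast
  next
    case (add f f')
    then show ?case using g h dl[OF cl[OF add(1) g] cl[OF add(2) g] h]
      by (simp only: dl cl free_algebra_simps(4))
  qed
qed

lemma free_one_mult:
  assumes "f \<in> carrier (free_algebra R I)"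
  shows "\<one>\<^bsub>free_algebra R I\<^esub> \<otimes>\<^bsub>free_algebra R I\<^esub> f = f" "f \<otimes>\<^bsub>free_algebra R I\<^esub> \<one>\<^bsub>free_algebra R I\<^esub> = f"
proof -
  let ?F = "free_algebra R I"
  have one: "free_monom R \<one> [] \<in> carrier ?F" by (simp add: free_monom_closed)
  have dist: "free_monom R \<one> [] \<otimes>\<^bsub>?F\<^esub> (\<lambda>w. f w \<oplus> g w) =
      (\<lambda>w. (free_monom R \<one> [] \<otimes>\<^bsub>?F\<^esub> f) w \<oplus> (free_monom R \<one> [] \<otimes>\<^bsub>?F\<^esub> g) w)"
    "(\<lambda>w. f w \<oplus> g w) \<otimes>\<^bsub>?F\<^esub> free_monom R \<one> [] =
      (\<lambda>w. (f \<otimes>\<^bsub>?F\<^esub> free_monom R \<one> []) w \<oplus> (g \<otimes>\<^bsub>?F\<^esub> free_monom R \<one> []) w)"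
    if "f \<in> carrier ?F" "g \<in> carrier ?F" for f g
    using free_mult_add[OF that one] by (simp_all only: free_algebra_simps)
  have "free_monom R \<one> [] \<otimes>\<^bsub>?F\<^esub> f = f \<and> f \<otimes>\<^bsub>?F\<^esub> free_monom R \<one> [] = f"
    using assms
  proof (induction rule: free_algebra_induct)
    case zero
    show ?case using one by (simp only: free_mult_zero[of _ I] simp_thms)
  next
    case (monom c w)
    then show ?case
      by (simp only: free_mult_monom one_closed l_one r_one append_Nil append_Nil2 simp_thms)
  next
    case (add f g)
    then show ?case by (simp only: dist simp_thms)
  qed
  then show "\<one>\<^bsub>?F\<^esub> \<otimes>\<^bsub>?F\<^esub> f = f" "f \<otimes>\<^bsub>?F\<^esub> \<one>\<^bsub>?F\<^esub> = f" by (simp_all only: free_algebra_simps(2))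
qed

lemma free_assoc_algebra: "assoc_algebra R (free_algebra R I)"
proof -
  let ?F = "free_algebra R I"
  have ag: "abelian_group ?F"
  proof (rule abelian_groupI)
    fix x y z
    assume x: "x \<in> carrier ?F"
    show "\<exists>y\<in>carrier ?F. y \<oplus>\<^bsub>?F\<^esub> x = \<zero>\<^bsub>?F\<^esub>"
    proof
      show "(\<ominus> \<one>) \<odot>\<^bsub>?F\<^esub> x \<in> carrier ?F" using x by (intro free_smult_closed) auto
      show "((\<ominus> \<one>) \<odot>\<^bsub>?F\<^esub> x) \<oplus>\<^bsub>?F\<^esub> x = \<zero>\<^bsub>?F\<^esub>"
        using free_algebra_value[OF x] by (auto simp: l_minus l_neg)
    qed
    show "\<zero>\<^bsub>?F\<^esub> \<oplus>\<^bsub>?F\<^esub> x = x" using free_algebra_value[OF x] by simp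
    assume y: "y \<in> carrier ?F"
    show "x \<oplus>\<^bsub>?F\<^esub> y \<in> carrier ?F" using x y by (rule free_add_closed)
    show "x \<oplus>\<^bsub>?F\<^esub> y = y \<oplus>\<^bsub>?F\<^esub> x" using x y by (simp add: free_algebra_value a_comm)
    assume z: "z \<in> carrier ?F"
    show "x \<oplus>\<^bsub>?F\<^esub> y \<oplus>\<^bsub>?F\<^esub> z = x \<oplus>\<^bsub>?F\<^esub> (y \<oplus>\<^bsub>?F\<^esub> z)"
      using x y z by (simp add: free_algebra_value a_assoc)
  qed (simp add: free_algebra_carrier)
  have mon: "Group.monoid ?F"
    by (rule monoidI) (rule free_mult_closed free_mult_assoc free_one_mult | assumption
      | simp add: free_monom_closed)+
  have ring: "ring ?F" by (rule ringI[OF ag mon free_mult_add])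
  have mod: "module R ?F"
    by (rule moduleI[OF is_cring ag free_smult_closed])
      (auto simp: free_algebra_value l_distr r_distr m_assoc)
  have "assoc_algebra_axioms R ?F"
  proof
    fix a x y
    assume a: "a \<in> carrier R" and x: "x \<in> carrier ?F" and y: "y \<in> carrier ?F"
    note v = free_algebra_value[OF x] free_algebra_value[OF y]
    show "(a \<odot>\<^bsub>?F\<^esub> x) \<otimes>\<^bsub>?F\<^esub> y = a \<odot>\<^bsub>?F\<^esub> (x \<otimes>\<^bsub>?F\<^esub> y)"
      using a v by (auto simp: m_assoc finsum_rdistr)
    show "x \<otimes>\<^bsub>?F\<^esub> (a \<odot>\<^bsub>?F\<^esub> y) = a \<odot>\<^bsub>?F\<^esub> (x \<otimes>\<^bsub>?F\<^esub> y)"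
      using a v by (auto simp: m_lcomm finsum_rdistr)
  qed
  then show ?thesis by (intro assoc_algebra.intro mod ring)
qed

lemma free_gen_closed: "i \<in> I \<Longrightarrow> free_gen R i \<in> carrier (free_algebra R I)"
  by (simp add: free_gen_eq free_monom_closed)

lemma free_monom_eq_lprod:
  assumes "c \<in> carrier R" "w \<in> lists I"
  shows "free_monom R c w = c \<odot>\<^bsub>free_algebra R I\<^esub> lprod (free_algebra R I) (map (free_gen R) w)"
proof -
  have "lprod (free_algebra R I) (map (free_gen R) w) = free_monom R \<one> w"
    using assms(2)
  proof (induction w)
    case Nil
    then show ?case by (simp add: lprod_def)
  next
    case (Cons i w)
    then show ?case
      using free_mult_monom[where c = \<one> and d = \<one> and u = "[i]" and v = w] by (simp add: lprod_def free_gen_eq del: free_algebra_simps(1))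
  qed
  then show ?thesis using assms(1) by (auto simp: free_monom_def)
qed

lemma free_generated:
  "carrier (generated_subalgebra R (free_algebra R I) (free_gen R ` I)) = carrier (free_algebra R I)"
    (is "carrier ?G = _")
proof
  interpret F: assoc_algebra R "free_algebra R I" by (rule free_assoc_algebra)
  have XF: "free_gen R ` I \<subseteq> carrier (free_algebra R I)" using free_gen_closed by auto
  note G = F.subalgebra_ofD[OF F.subalgebra_of_generated[OF XF]]
  show "carrier ?G \<subseteq> carrier (free_algebra R I)" by (rule G)
  show "carrier (free_algebra R I) \<subseteq> carrier ?G"
  proof
    fix f assume "f \<in> carrier (free_algebra R I)"
    then show "f \<in> carrier ?G"
    proof (induction rule: free_algebra_induct)
      case zero
      show ?case using G(5)[OF zero_closed G(2)] by (simp add: free_monom_def cong: if_cong)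
    next
      case (monom c w)
      have "lprod (free_algebra R I) (map (free_gen R) w) \<in> carrier ?G"
        using monom(2) G(2,4) F.generated_incl[of "free_gen R ` I"]
        by (induction w) (auto simp: lprod_def simp del: free_algebra_simps)
      then show ?case using monom G(5) by (simp only: free_monom_eq_lprod[of c w I])
    next
      case (add f g)
      then show ?case using G(3)[of f g] by simp
    qed
  qed
qed

lemma free_universal:
  assumes A: "assoc_algebra R A" and x: "\<And>i. i \<in> I \<Longrightarrow> x i \<in> carrier A"
  obtains h where "h \<in> alg_hom R (free_algebra R I) A" "\<And>i. i \<in> I \<Longrightarrow> h (free_gen R i) = x i"
proof
  let ?F = "free_algebra R I"
  interpret A: assoc_algebra R A by fact
  define p where "p w = lprod A (map x w)" for w
  have pc: "p w \<in> carrier A" if "w \<in> lists I" for w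
    using that x by (auto simp: p_def intro!: A.lprod_closed)
  have p_append: "p (u @ v) = p u \<otimes>\<^bsub>A\<^esub> p v" if "u \<in> lists I" "v \<in> lists I" for u v
  proof -
    have "set (map x u) \<subseteq> carrier A" "set (map x v) \<subseteq> carrier A" using that x by auto
    then show ?thesis by (simp add: p_def A.lprod_append)
  qed
  \<comment> \<open>The forced formula: \<open>p w\<close> is the image of the word
    \<open>w\<close>, extended linearly.\<close>
  define h where "h f = (\<Oplus>\<^bsub>A\<^esub>w\<in>{w. f w \<noteq> \<zero>}. f w \<odot>\<^bsub>A\<^esub> p w)" for f
  \<comment> \<open>The supports of f, g and their sum differ; additivity needs all three sums over
    one common finite set of words.\<close>
  have h_supp: "h f = (\<Oplus>\<^bsub>A\<^esub>w\<in>S. f w \<odot>\<^bsub>A\<^esub> p w)"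
    if "f \<in> carrier ?F" "finite S" "{w. f w \<noteq> \<zero>} \<subseteq> S" "S \<subseteq> lists I" for f S
    unfolding h_def
  proof (rule A.M.add.finprod_mono_neutral_cong_left[OF that(2,3)])
    have pS: "p w \<in> carrier A" if "w \<in> S" for w using that \<open>S \<subseteq> lists I\<close> pc by blast
    show "f w \<odot>\<^bsub>A\<^esub> p w = \<zero>\<^bsub>A\<^esub>" if "w \<in> S - {w. f w \<noteq> \<zero>}" for w using that pS by simp
    show "(\<lambda>w. f w \<odot>\<^bsub>A\<^esub> p w) \<in> S \<rightarrow> carrier A"
      using pS free_algebra_value[OF \<open>f \<in> carrier ?F\<close>] by simp
  qed simp
  have h_add: "h (f \<oplus>\<^bsub>?F\<^esub> g) = h f \<oplus>\<^bsub>A\<^esub> h g" if f: "f \<in> carrier ?F" and g: "g \<in> carrier ?F" for f g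
  proof -
    let ?S = "{w. f w \<noteq> \<zero>} \<union> {w. g w \<noteq> \<zero>}"
    have S: "finite ?S" "?S \<subseteq> lists I" using f g by (auto simp: free_algebra_carrier)
    have "h (f \<oplus>\<^bsub>?F\<^esub> g) = (\<Oplus>\<^bsub>A\<^esub>w\<in>?S. (f \<oplus>\<^bsub>?F\<^esub> g) w \<odot>\<^bsub>A\<^esub> p w)"
      by (rule h_supp[OF free_add_closed[OF f g] S(1) _ S(2)]) auto
    also have "\<dots> = (\<Oplus>\<^bsub>A\<^esub>w\<in>?S. f w \<odot>\<^bsub>A\<^esub> p w \<oplus>\<^bsub>A\<^esub> g w \<odot>\<^bsub>A\<^esub> p w)"
      using S(2) by (intro A.M.finsum_cong')
        (auto simp: A.smult_l_distr free_algebra_value[OF f] free_algebra_value[OF g] pc subset_iff)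
    also have "\<dots> = (\<Oplus>\<^bsub>A\<^esub>w\<in>?S. f w \<odot>\<^bsub>A\<^esub> p w) \<oplus>\<^bsub>A\<^esub> (\<Oplus>\<^bsub>A\<^esub>w\<in>?S. g w \<odot>\<^bsub>A\<^esub> p w)"
      using S(2) by (intro A.M.finsum_addf)
        (auto simp: free_algebra_value[OF f] free_algebra_value[OF g] pc subset_iff)
    also have "\<dots> = h f \<oplus>\<^bsub>A\<^esub> h g"
      using h_supp[OF f S(1) _ S(2)] h_supp[OF g S(1) _ S(2)] by simp
    finally show ?thesis .
  qed
  have h_monom: "h (free_monom R c w) = c \<odot>\<^bsub>A\<^esub> p w" if "c \<in> carrier R" "w \<in> lists I" for c w
  proof -
    have "h (free_monom R c w) = (\<Oplus>\<^bsub>A\<^esub>v\<in>{w}. free_monom R c w v \<odot>\<^bsub>A\<^esub> p v)"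
      using that by (intro h_supp free_monom_closed) (auto simp: free_monom_def)
    then show ?thesis using that pc by (simp add: free_monom_def)
  qed
  have h_zero: "h (\<lambda>w. \<zero>) = \<zero>\<^bsub>A\<^esub>" by (simp add: h_def)
  have h_closed: "h f \<in> carrier A" if "f \<in> carrier ?F" for f
    using that
  proof (induction rule: free_algebra_induct)
    case (add f g)
    then show ?case using h_add[of f g] by simp
  qed (simp_all add: h_zero h_monom pc)
  have h_add': "h (\<lambda>w. f w \<oplus> g w) = h f \<oplus>\<^bsub>A\<^esub> h g" if f: "f \<in> carrier ?F" and g: "g \<in> carrier ?F" for f g
    using h_add[OF that] by simp
  interpret F: assoc_algebra R ?F by (rule free_assoc_algebra)
  have h_mult_monom: "h (free_monom R c u \<otimes>\<^bsub>?F\<^esub> g) = h (free_monom R c u) \<otimes>\<^bsub>A\<^esub> h g"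
    if "c \<in> carrier R" "u \<in> lists I" "g \<in> carrier ?F" for c u g
    using that(3)
  proof (induction rule: free_algebra_induct)
    case zero
    show ?case using that
      by (simp only: free_mult_zero[of _ I] free_monom_closed h_zero h_monom pc A.M.r_null A.smult_closed)
  next
    case (monom d v)
    have "h (free_monom R c u \<otimes>\<^bsub>?F\<^esub> free_monom R d v) = (c \<otimes> d) \<odot>\<^bsub>A\<^esub> (p u \<otimes>\<^bsub>A\<^esub> p v)"
      using that monom h_monom[of "c \<otimes> d" "u @ v"] by (simp add: free_mult_monom p_append del: free_algebra_simps)
    moreover have "c \<odot>\<^bsub>A\<^esub> (d \<odot>\<^bsub>A\<^esub> y) = d \<odot>\<^bsub>A\<^esub> (c \<odot>\<^bsub>A\<^esub> y)" if "y \<in> carrier A" for y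
      using that \<open>c \<in> carrier R\<close> monom(1) by (simp add: m_comm flip: A.smult_assoc1)
    ultimately show ?case
      using that monom by (simp add: h_monom pc A.smult_mult_l A.smult_mult_r A.smult_assoc1 del: free_algebra_simps)
  next
    case (add f g)
    have m: "free_monom R c u \<in> carrier ?F" using that by (simp add: free_monom_closed)
    have "free_monom R c u \<otimes>\<^bsub>?F\<^esub> (f \<oplus>\<^bsub>?F\<^esub> g) =
        free_monom R c u \<otimes>\<^bsub>?F\<^esub> f \<oplus>\<^bsub>?F\<^esub> free_monom R c u \<otimes>\<^bsub>?F\<^esub> g"
      using m add by (intro F.M.r_distr)
    then have "h (free_monom R c u \<otimes>\<^bsub>?F\<^esub> (f \<oplus>\<^bsub>?F\<^esub> g)) =
        h (free_monom R c u \<otimes>\<^bsub>?F\<^esub> f) \<oplus>\<^bsub>A\<^esub> h (free_monom R c u \<otimes>\<^bsub>?F\<^esub> g)"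
      using m add h_add by (simp only: free_mult_closed)
    also have "\<dots> = h (free_monom R c u) \<otimes>\<^bsub>A\<^esub> h (f \<oplus>\<^bsub>?F\<^esub> g)"
      using m add by (simp only: h_add h_closed A.M.r_distr)
    finally show ?case by (simp only: free_algebra_simps(4))
  qed
  have h_mult: "h (f \<otimes>\<^bsub>?F\<^esub> g) = h f \<otimes>\<^bsub>A\<^esub> h g" if "f \<in> carrier ?F" "g \<in> carrier ?F" for f g
    using that(1)
  proof (induction rule: free_algebra_induct)
    case zero
    show ?case using that(2)
      by (simp only: free_mult_zero[of _ I] h_zero h_closed A.M.l_null)
  next
    case (monom c u)
    then show ?case using that(2) by (rule h_mult_monom)
  next
    case (add f f')
    have "(f \<oplus>\<^bsub>?F\<^esub> f') \<otimes>\<^bsub>?F\<^esub> g = f \<otimes>\<^bsub>?F\<^esub> g \<oplus>\<^bsub>?F\<^esub> f' \<otimes>\<^bsub>?F\<^esub> g"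
      using add that by (intro F.M.l_distr)
    then have "h ((f \<oplus>\<^bsub>?F\<^esub> f') \<otimes>\<^bsub>?F\<^esub> g) = h (f \<otimes>\<^bsub>?F\<^esub> g) \<oplus>\<^bsub>A\<^esub> h (f' \<otimes>\<^bsub>?F\<^esub> g)"
      using add that h_add by (simp only: free_mult_closed)
    also have "\<dots> = h (f \<oplus>\<^bsub>?F\<^esub> f') \<otimes>\<^bsub>A\<^esub> h g"
      using add that by (simp only: h_add h_closed A.M.l_distr)
    finally show ?case by (simp only: free_algebra_simps(4))
  qed
  show "h \<in> alg_hom R ?F A"
  proof (rule alg_homI)
    show "h \<one>\<^bsub>?F\<^esub> = \<one>\<^bsub>A\<^esub>" by (simp add: h_monom) (simp add: p_def lprod_def)
    show "h (a \<odot>\<^bsub>?F\<^esub> f) = a \<odot>\<^bsub>A\<^esub> h f" if a: "a \<in> carrier R" and f: "f \<in> carrier ?F" for a f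
    proof -
      \<comment> \<open>A scalar is multiplication by a constant monomial, so compatibility with
        scalars follows from multiplicativity.\<close>
      have "h (a \<odot>\<^bsub>?F\<^esub> f) = h ((a \<odot>\<^bsub>?F\<^esub> \<one>\<^bsub>?F\<^esub>) \<otimes>\<^bsub>?F\<^esub> f)"
        using a f F.smult_mult_l[of a "\<one>\<^bsub>?F\<^esub>" f] F.M.l_one[OF f] F.M.one_closed by (simp only:)
      also have "\<dots> = h (a \<odot>\<^bsub>?F\<^esub> \<one>\<^bsub>?F\<^esub>) \<otimes>\<^bsub>A\<^esub> h f"
        using a f F.M.one_closed by (intro h_mult free_smult_closed)
      also have "a \<odot>\<^bsub>?F\<^esub> \<one>\<^bsub>?F\<^esub> = free_monom R a []" using a by (auto simp: free_monom_def)
      finally show ?thesis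
        using a f pc[of "[]"] h_closed[OF f] by (simp add: h_monom A.smult_mult_l) (simp add: p_def lprod_def)
    qed
  qed (use h_closed h_add h_mult in blast)+
  show "h (free_gen R i) = x i" if "i \<in> I" for i
    using that x h_monom[of \<one> "[i]"] by (simp add: free_gen_eq p_def lprod_def)
qed

section \<open>Presented algebras and their universal property\<close>

lemma presented_assoc_algebra:
  assumes "rels \<subseteq> carrier (free_algebra R I)"
  shows "assoc_algebra R (presented_algebra R I rels)"
proof -
  interpret F: assoc_algebra R "free_algebra R I" by (rule free_assoc_algebra)
  show ?thesis
    unfolding presented_algebra_def by (intro F.quotient_assoc_algebra F.M.genideal_ideal assms)
qed

lemma presented_gen_closed:
  "i \<in> I \<Longrightarrow> presented_gen R I rels i \<in> carrier (presented_algebra R I rels)"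
  unfolding presented_algebra_def presented_gen_def
  by (simp add: assoc_algebra.quotient_carrier[OF free_assoc_algebra] free_gen_closed)

lemma presented_coset_alg_hom:
  assumes "rels \<subseteq> carrier (free_algebra R I)"
  shows "(\<lambda>f. genideal (free_algebra R I) rels +>\<^bsub>free_algebra R I\<^esub> f)
      \<in> alg_hom R (free_algebra R I) (presented_algebra R I rels)"
proof -
  interpret F: assoc_algebra R "free_algebra R I" by (rule free_assoc_algebra)
  show ?thesis
    unfolding presented_algebra_def by (intro F.coset_alg_hom F.M.genideal_ideal assms)
qed

lemma presented_relation:
  assumes "rels \<subseteq> carrier (free_algebra R I)" "f \<in> rels"
  shows "genideal (free_algebra R I) rels +>\<^bsub>free_algebra R I\<^esub> f = \<zero>\<^bsub>presented_algebra R I rels\<^esub>"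
proof -
  interpret F: assoc_algebra R "free_algebra R I" by (rule free_assoc_algebra)
  have "f \<in> carrier (free_algebra R I)" using assms by blast
  then show ?thesis
    unfolding presented_algebra_def
    using F.coset_eq_zero_iff[OF F.M.genideal_ideal[OF assms(1)]] F.M.genideal_self[OF assms(1)] assms(2)
    by blast
qed

lemma presented_generated:
  assumes "rels \<subseteq> carrier (free_algebra R I)"
  shows "carrier (generated_subalgebra R (presented_algebra R I rels) (presented_gen R I rels ` I))
    = carrier (presented_algebra R I rels)"
proof -
  interpret F: assoc_algebra R "free_algebra R I" by (rule free_assoc_algebra)
  let ?c = "\<lambda>f. genideal (free_algebra R I) rels +>\<^bsub>free_algebra R I\<^esub> f"
  have "?c ` carrier (generated_subalgebra R (free_algebra R I) (free_gen R ` I)) =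
      carrier (generated_subalgebra R (presented_algebra R I rels) (?c ` free_gen R ` I))"
    by (rule generated_image[OF F.assoc_algebra_axioms presented_assoc_algebra[OF assms]
          presented_coset_alg_hom[OF assms]]) (auto simp: free_gen_closed)
  moreover have "?c ` free_gen R ` I = presented_gen R I rels ` I"
    by (simp add: presented_gen_def image_image)
  moreover have "?c ` carrier (free_algebra R I) = carrier (presented_algebra R I rels)"
    by (simp add: presented_algebra_def F.quotient_carrier)
  ultimately show ?thesis by (simp only: free_generated)
qed

lemma presented_universal:
  assumes rels: "rels \<subseteq> carrier (free_algebra R I)" and B: "assoc_algebra R B"
    and h: "h \<in> alg_hom R (free_algebra R I) B" and kill: "\<And>f. f \<in> rels \<Longrightarrow> h f = \<zero>\<^bsub>B\<^esub>"
  obtains g where "g \<in> alg_hom R (presented_algebra R I rels) B"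
    and "\<And>f. f \<in> carrier (free_algebra R I) \<Longrightarrow>
      g (genideal (free_algebra R I) rels +>\<^bsub>free_algebra R I\<^esub> f) = h f"
proof -
  interpret F: assoc_algebra R "free_algebra R I" by (rule free_assoc_algebra)
  interpret h: ring_hom_ring "free_algebra R I" B h
    by (rule alg_hom_ring_hom_ring[OF F.assoc_algebra_axioms B h])
  \<comment> \<open>The kernel of \<open>h\<close> is an ideal that contains the relations, hence
    contains the ideal they generate.\<close>
  have "genideal (free_algebra R I) rels \<subseteq> a_kernel (free_algebra R I) B h"
    by (rule F.M.genideal_minimal[OF h.kernel_is_ideal]) (unfold a_kernel_def', use rels kill in blast)
  then have ker: "h f = \<zero>\<^bsub>B\<^esub>" if "f \<in> genideal (free_algebra R I) rels" for f
    using that unfolding a_kernel_def' by blast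
  show thesis
  proof (rule quotient_universal[OF F.assoc_algebra_axioms B h F.M.genideal_ideal[OF rels]])
    show "h f = \<zero>\<^bsub>B\<^esub>" if "f \<in> genideal (free_algebra R I) rels" for f using that by (rule ker)
    fix g assume "g \<in> alg_hom R (quotient_algebra (free_algebra R I) (genideal (free_algebra R I) rels)) B"
      and "\<And>f. f \<in> carrier (free_algebra R I) \<Longrightarrow>
        g (genideal (free_algebra R I) rels +>\<^bsub>free_algebra R I\<^esub> f) = h f"
    then show thesis by (intro that[of g]) (simp_all only: presented_algebra_def)
  qed
qed

end

section \<open>The Hecke algebra inside the Ariki-Koike algebra\<close>

text \<open>A form of the relations that makes sense for a family in an arbitrary algebra. It lets
  them travel between the two presented algebras, whose free algebras have different sets of
  generators.\<close>

definition hecke_relations_hold ::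
    "('r, 'b) ring_scheme \<Rightarrow> ('r, 'a) module \<Rightarrow> nat \<Rightarrow> 'r \<Rightarrow> (nat \<Rightarrow> 'a) \<Rightarrow> bool" where
  "hecke_relations_hold R B n q t \<longleftrightarrow>
     (\<forall>i. 1 \<le> i \<and> i < n \<longrightarrow>
       (t i \<ominus>\<^bsub>B\<^esub> q \<odot>\<^bsub>B\<^esub> \<one>\<^bsub>B\<^esub>) \<otimes>\<^bsub>B\<^esub> (t i \<oplus>\<^bsub>B\<^esub> (inv\<^bsub>R\<^esub> q) \<odot>\<^bsub>B\<^esub> \<one>\<^bsub>B\<^esub>) = \<zero>\<^bsub>B\<^esub>) \<and>
     (\<forall>i. 1 \<le> i \<and> i + 1 < n \<longrightarrow>
       (t i \<otimes>\<^bsub>B\<^esub> t (i + 1) \<otimes>\<^bsub>B\<^esub> t i) \<ominus>\<^bsub>B\<^esub> (t (i + 1) \<otimes>\<^bsub>B\<^esub> t i \<otimes>\<^bsub>B\<^esub> t (i + 1)) = \<zero>\<^bsub>B\<^esub>) \<and>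
     (\<forall>i j. 1 \<le> i \<and> i + 2 \<le> j \<and> j < n \<longrightarrow>
       (t i \<otimes>\<^bsub>B\<^esub> t j) \<ominus>\<^bsub>B\<^esub> (t j \<otimes>\<^bsub>B\<^esub> t i) = \<zero>\<^bsub>B\<^esub>)"

lemma (in ring_hom_ring) hom_a_minus:
  "\<lbrakk>x \<in> carrier R; y \<in> carrier R\<rbrakk> \<Longrightarrow> h (x \<ominus>\<^bsub>R\<^esub> y) = h x \<ominus>\<^bsub>S\<^esub> h y"
  by (simp add: a_minus_def)

lemma ivl_subset_lessThan: "{1..<n} \<subseteq> {..<n}" for n :: nat
  by auto

context cring
begin

lemma hecke_relations_closed:
  assumes "{1..<n} \<subseteq> I" "q \<in> Units R"
  shows "hecke_relations R (free_algebra R I) n q \<subseteq> carrier (free_algebra R I)"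
proof -
  interpret F: assoc_algebra R "free_algebra R I" by (rule free_assoc_algebra)
  have "free_gen R i \<in> carrier (free_algebra R I)" if "1 \<le> i" "i < n" for i
    using that assms(1) by (auto intro!: free_gen_closed)
  moreover have "q \<in> carrier R" "inv q \<in> carrier R" using assms(2) by auto
  ultimately show ?thesis
    by (auto simp: hecke_relations_def Let_def simp del: free_algebra_simps)
qed

text \<open>The index set is left open, so that the same bridge serves the generators 1, ..., n - 1
  of the Hecke algebra and 0, ..., n - 1 of the Ariki-Koike algebra, and in both directions: reading
  relations off and verifying them.\<close>

lemma hecke_relations_eval:
  assumes B: "assoc_algebra R B" and h: "h \<in> alg_hom R (free_algebra R I) B"
    and I: "{1..<n} \<subseteq> I" and q: "q \<in> Units R"
  shows "(\<forall>f\<in>hecke_relations R (free_algebra R I) n q. h f = \<zero>\<^bsub>B\<^esub>) \<longleftrightarrow>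
    hecke_relations_hold R B n q (\<lambda>i. h (free_gen R i))"
proof -
  let ?F = "free_algebra R I"
  interpret F: assoc_algebra R ?F by (rule free_assoc_algebra)
  interpret h: ring_hom_ring ?F B h by (rule alg_hom_ring_hom_ring[OF F.assoc_algebra_axioms B h])
  have X: "free_gen R i \<in> carrier ?F" if "1 \<le> i" "i < n" for i
    using that I by (auto intro!: free_gen_closed)
  have sm: "h (a \<odot>\<^bsub>?F\<^esub> \<one>\<^bsub>?F\<^esub>) = a \<odot>\<^bsub>B\<^esub> \<one>\<^bsub>B\<^esub>" if "a \<in> carrier R" for a
    using that alg_homD(5)[OF h that F.M.one_closed] by (simp only: h.hom_one)
  let ?X = "free_gen R :: nat \<Rightarrow> _"
  have 1: "h ((?X i \<ominus>\<^bsub>?F\<^esub> q \<odot>\<^bsub>?F\<^esub> \<one>\<^bsub>?F\<^esub>) \<otimes>\<^bsub>?F\<^esub> (?X i \<oplus>\<^bsub>?F\<^esub> (inv\<^bsub>R\<^esub> q) \<odot>\<^bsub>?F\<^esub> \<one>\<^bsub>?F\<^esub>)) =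
      (h (?X i) \<ominus>\<^bsub>B\<^esub> q \<odot>\<^bsub>B\<^esub> \<one>\<^bsub>B\<^esub>) \<otimes>\<^bsub>B\<^esub> (h (?X i) \<oplus>\<^bsub>B\<^esub> (inv\<^bsub>R\<^esub> q) \<odot>\<^bsub>B\<^esub> \<one>\<^bsub>B\<^esub>)"
    if "1 \<le> i \<and> i < n" for i
    using X[of i] that q Units_closed[OF q] Units_inv_closed[OF q] by (simp add: h.hom_a_minus sm del: free_algebra_simps)
  have 2: "h ((?X i \<otimes>\<^bsub>?F\<^esub> ?X (i + 1) \<otimes>\<^bsub>?F\<^esub> ?X i) \<ominus>\<^bsub>?F\<^esub> (?X (i + 1) \<otimes>\<^bsub>?F\<^esub> ?X i \<otimes>\<^bsub>?F\<^esub> ?X (i + 1))) =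
      (h (?X i) \<otimes>\<^bsub>B\<^esub> h (?X (i + 1)) \<otimes>\<^bsub>B\<^esub> h (?X i)) \<ominus>\<^bsub>B\<^esub> (h (?X (i + 1)) \<otimes>\<^bsub>B\<^esub> h (?X i) \<otimes>\<^bsub>B\<^esub> h (?X (i + 1)))"
    if "1 \<le> i \<and> i + 1 < n" for i
    using X[of i] X[of "i + 1"] that by (simp add: h.hom_a_minus del: free_algebra_simps)
  have 3: "h ((?X i \<otimes>\<^bsub>?F\<^esub> ?X j) \<ominus>\<^bsub>?F\<^esub> (?X j \<otimes>\<^bsub>?F\<^esub> ?X i)) =
      (h (?X i) \<otimes>\<^bsub>B\<^esub> h (?X j)) \<ominus>\<^bsub>B\<^esub> (h (?X j) \<otimes>\<^bsub>B\<^esub> h (?X i))"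
    if "1 \<le> i \<and> i + 2 \<le> j \<and> j < n" for i j
    using X[of i] X[of j] that by (simp add: h.hom_a_minus del: free_algebra_simps)
  have ball1: "(\<forall>f\<in>{e i | i. P i}. K f) \<longleftrightarrow> (\<forall>i. P i \<longrightarrow> K (e i))"
    for e :: "nat \<Rightarrow> nat list \<Rightarrow> 'a" and P K by blast
  have ball2: "(\<forall>f\<in>{e i j | i j. P i j}. K f) \<longleftrightarrow> (\<forall>i j. P i j \<longrightarrow> K (e i j))"
    for e :: "nat \<Rightarrow> nat \<Rightarrow> nat list \<Rightarrow> 'a" and P K by blast
  show ?thesis
    unfolding hecke_relations_def hecke_relations_hold_def Let_def ball_Un ball1 ball2 conj_assoc
    by (intro conj_cong all_cong1 imp_cong refl) (simp_all only: 1 2 3)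
qed

lemma ariki_koike_relations_closed:
  assumes n: "1 \<le> n" and q: "q \<in> Units R" and Q: "\<And>k. k \<in> {1..r} \<Longrightarrow> Q k \<in> carrier R"
  shows "ariki_koike_relations R (free_algebra R {..<n}) n r q Q \<subseteq> carrier (free_algebra R {..<n})"
proof -
  let ?F = "free_algebra R {..<n}"
  interpret F: assoc_algebra R ?F by (rule free_assoc_algebra)
  have X: "free_gen R i \<in> carrier ?F" if "i < n" for i
    using that by (auto intro!: free_gen_closed)
  have "hecke_relations R ?F n q \<subseteq> carrier ?F"
    by (rule hecke_relations_closed) (use q in auto)
  moreover have "lprod ?F (map (\<lambda>k. free_gen R 0 \<ominus>\<^bsub>?F\<^esub> Q k \<odot>\<^bsub>?F\<^esub> \<one>\<^bsub>?F\<^esub>) [1..<r + 1]) \<in> carrier ?F"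
    using X[of 0] n Q by (intro F.lprod_closed) (auto simp del: free_algebra_simps)
  ultimately show ?thesis
    using X n by (auto simp: ariki_koike_relations_def Let_def simp del: free_algebra_simps)
qed

end

locale ariki_koike = cyclotomic R n r m q Q + R?: cring R
  for R :: "('r, 'b) ring_scheme" (structure) and n r :: nat and m :: "nat \<Rightarrow> nat"
    and q :: 'r and Q :: "nat \<Rightarrow> 'r" +
  assumes n_pos: "1 \<le> n" and r_ge_2: "2 \<le> r"
    and m_ge: "k \<in> {1..r} \<Longrightarrow> n \<le> m k"
    and q_unit: "q \<in> Units R"
    and Q_closed: "k \<in> {1..r} \<Longrightarrow> Q k \<in> carrier R"
begin

abbreviation "AKF \<equiv> free_algebra R {..<n}"
abbreviation "AK_rels \<equiv> ariki_koike_relations R AKF n r q Q"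

lemma AK_rels_closed: "AK_rels \<subseteq> carrier AKF"
  by (rule ariki_koike_relations_closed[OF n_pos q_unit Q_closed])

lemma AK_assoc_algebra: "assoc_algebra R AK"
  unfolding AK_def by (rule presented_assoc_algebra[OF AK_rels_closed])

sublocale H: assoc_algebra R AK by (rule AK_assoc_algebra)

lemma T_closed: "i < n \<Longrightarrow> T i \<in> carrier AK"
  unfolding AK_def T_def by (rule presented_gen_closed) simp

lemma AK_generated: "carrier (generated_subalgebra R AK (T ` {..<n})) = carrier AK"
  unfolding AK_def T_def by (rule presented_generated[OF AK_rels_closed])

lemma AK_hecke_relations_hold: "hecke_relations_hold R AK n q T"
proof -
  let ?c = "\<lambda>f. genideal AKF AK_rels +>\<^bsub>AKF\<^esub> f"
  have "\<forall>f\<in>hecke_relations R AKF n q. ?c f = \<zero>\<^bsub>AK\<^esub>"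
    unfolding AK_def using presented_relation[OF AK_rels_closed]
    by (auto simp: ariki_koike_relations_def Let_def)
  moreover have "?c \<in> alg_hom R AKF AK"
    unfolding AK_def by (rule presented_coset_alg_hom[OF AK_rels_closed])
  ultimately have "hecke_relations_hold R AK n q (\<lambda>i. ?c (free_gen R i))"
    using hecke_relations_eval[OF AK_assoc_algebra _ _ q_unit, of ?c "{..<n}" n] ivl_subset_lessThan
    by blast
  then show ?thesis by (simp add: T_def presented_gen_def[abs_def])
qed

text \<open>
  Sending \<open>T\<^sub>0\<close> to the scalar \<open>Q\<^sub>1\<close> respects every defining relation, so the Hecke algebra is a
  retract of the Ariki-Koike algebra.
\<close>

lemma hecke_subalgebra_iso: "alg_isomorphic R hecke_subalgebra (iwahori_hecke R n q)"
proof -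
  let ?IF = "free_algebra R {1..<n}"
  let ?rels = "hecke_relations R ?IF n q"
  let ?IH = "iwahori_hecke R n q"
  let ?t = "presented_gen R {1..<n} ?rels"
  have rels: "?rels \<subseteq> carrier ?IF" by (rule hecke_relations_closed[OF _ q_unit]) simp
  interpret IH: assoc_algebra R ?IH
    unfolding iwahori_hecke_def by (rule presented_assoc_algebra[OF rels])
  interpret F: assoc_algebra R AKF by (rule free_assoc_algebra)
  have t: "?t i \<in> carrier ?IH" if "i \<in> {1..<n}" for i
    unfolding iwahori_hecke_def using that by (rule presented_gen_closed)
  have t_hold: "hecke_relations_hold R ?IH n q ?t"
  proof -
    let ?c = "\<lambda>f. genideal ?IF ?rels +>\<^bsub>?IF\<^esub> f"
    have "\<forall>f\<in>?rels. ?c f = \<zero>\<^bsub>?IH\<^esub>"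
      unfolding iwahori_hecke_def using presented_relation[OF rels] by blast
    moreover have "?c \<in> alg_hom R ?IF ?IH"
      unfolding iwahori_hecke_def by (rule presented_coset_alg_hom[OF rels])
    ultimately have "hecke_relations_hold R ?IH n q (\<lambda>i. ?c (free_gen R i))"
      using hecke_relations_eval[OF IH.assoc_algebra_axioms _ _ q_unit, of ?c "{1..<n}" n] by blast
    then show ?thesis by (simp add: presented_gen_def[abs_def])
  qed
  \<comment> \<open>The relations see only the indices 1, ..., n - 1, so families with different
    values at 0 are interchangeable here.\<close>
  have hold_cong: "hecke_relations_hold R B n q s \<longleftrightarrow> hecke_relations_hold R B n q s'"
    if "\<And>i. i \<in> {1..<n} \<Longrightarrow> s i = s' i" for B :: "('r, 'x) module" and s s'
    unfolding hecke_relations_hold_def using that by (intro conj_cong all_cong1 imp_cong) auto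
  \<comment> \<open>The natural map from the presented Hecke algebra; its injectivity is the content
    of the lemma and will come from the left inverse \<open>g\<close> constructed next.\<close>
  obtain k where k: "k \<in> alg_hom R ?IH AK" and kt: "\<And>i. i \<in> {1..<n} \<Longrightarrow> k (?t i) = T i"
  proof -
    obtain h where h: "h \<in> alg_hom R ?IF AK" and hX: "\<And>i. i \<in> {1..<n} \<Longrightarrow> h (free_gen R i) = T i"
      by (rule free_universal[OF AK_assoc_algebra, of "{1..<n}" T]) (use T_closed in auto)
    have "hecke_relations_hold R AK n q (\<lambda>i. h (free_gen R i))"
      using AK_hecke_relations_hold hold_cong[of "\<lambda>i. h (free_gen R i)" T AK] hX by blast
    then have "\<forall>f\<in>?rels. h f = \<zero>\<^bsub>AK\<^esub>"
      using hecke_relations_eval[OF AK_assoc_algebra h _ q_unit, of n] by blast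
    then obtain k where "k \<in> alg_hom R ?IH AK" "\<And>f. f \<in> carrier ?IF \<Longrightarrow>
        k (genideal ?IF ?rels +>\<^bsub>?IF\<^esub> f) = h f"
      unfolding iwahori_hecke_def by (metis presented_universal[OF rels AK_assoc_algebra h])
    then have "k (?t i) = T i" if "i \<in> {1..<n}" for i
      using that hX free_gen_closed[of i "{1..<n}"] by (simp add: presented_gen_def)
    then show thesis by (rule that[OF \<open>k \<in> _\<close>])
  qed
  obtain g where g: "g \<in> alg_hom R AK ?IH" and gT: "\<And>i. i \<in> {1..<n} \<Longrightarrow> g (T i) = ?t i"
  proof -
    \<comment> \<open>Any of the roots Q_1, ..., Q_r could serve as the image of \<open>T 0\<close>;
      the choice of \<open>Q 1\<close> puts the vanishing factor at the head of the cyclotomic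
      product.\<close>
    define s where "s i = (if i = 0 then Q 1 \<odot>\<^bsub>?IH\<^esub> \<one>\<^bsub>?IH\<^esub> else ?t i)" for i
    have Q1: "Q 1 \<in> carrier R" using Q_closed r_ge_2 by auto
    have s: "s i \<in> carrier ?IH" if "i < n" for i using that t Q1 by (auto simp: s_def)
    obtain h where h: "h \<in> alg_hom R AKF ?IH" and hX: "\<And>i. i < n \<Longrightarrow> h (free_gen R i) = s i"
      by (rule free_universal[OF IH.assoc_algebra_axioms, of "{..<n}" s]) (use s in auto)
    interpret h: ring_hom_ring AKF ?IH h
      by (rule alg_hom_ring_hom_ring[OF F.assoc_algebra_axioms IH.assoc_algebra_axioms h])
    have X: "free_gen R i \<in> carrier AKF" if "i < n" for i
      using that by (auto intro!: free_gen_closed)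
    \<comment> \<open>A scalar multiple of the unit is central, which settles every relation between
      \<open>T 0\<close> and the other generators.\<close>
    have central: "s 0 \<otimes>\<^bsub>?IH\<^esub> y = y \<otimes>\<^bsub>?IH\<^esub> s 0" if "y \<in> carrier ?IH" for y
      using that Q1 by (simp add: s_def IH.smult_mult_l IH.smult_mult_r)
    have "hecke_relations_hold R ?IH n q (\<lambda>i. h (free_gen R i))"
      using t_hold hold_cong[of "\<lambda>i. h (free_gen R i)" ?t ?IH] hX by (auto simp: s_def)
    then have A: "\<forall>f\<in>hecke_relations R AKF n q. h f = \<zero>\<^bsub>?IH\<^esub>"
      using hecke_relations_eval[OF IH.assoc_algebra_axioms h _ q_unit, of n] ivl_subset_lessThan by blast
    let ?p = "\<lambda>k. free_gen R 0 \<ominus>\<^bsub>AKF\<^esub> Q k \<odot>\<^bsub>AKF\<^esub> \<one>\<^bsub>AKF\<^esub>"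
    have p: "?p k \<in> carrier AKF" if "k \<in> {1..r}" for k
      using that X[of 0] n_pos Q_closed by (simp del: free_algebra_simps)
    \<comment> \<open>The factor belonging to \<open>Q 1\<close> is killed, and with it the whole
      cyclotomic product.\<close>
    have "h (?p 1) = \<zero>\<^bsub>?IH\<^esub>"
      using X[of 0] n_pos Q1 hX[of 0] alg_homD(5)[OF h Q1 F.M.one_closed]
      by (simp add: h.hom_a_minus s_def IH.M.r_neg a_minus_def[of ?IH] del: free_algebra_simps)
    moreover have "[1..<r + 1] = 1 # [2..<r + 1]" using r_ge_2 by (simp add: upt_conv_Cons numeral_2_eq_2)
    moreover have "set (map ?p [2..<r + 1]) \<subseteq> carrier AKF" using p by auto
    ultimately have B: "h (lprod AKF (map ?p [1..<r + 1])) = \<zero>\<^bsub>?IH\<^esub>"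
      using p[of 1] r_ge_2 F.lprod_closed[of "map ?p [2..<r + 1]"]
      by (simp add: lprod_def del: free_algebra_simps upt_Suc)
    let ?X = "free_gen R :: nat \<Rightarrow> _"
    have C: "h ((?X 0 \<otimes>\<^bsub>AKF\<^esub> ?X 1 \<otimes>\<^bsub>AKF\<^esub> ?X 0 \<otimes>\<^bsub>AKF\<^esub> ?X 1) \<ominus>\<^bsub>AKF\<^esub>
        (?X 1 \<otimes>\<^bsub>AKF\<^esub> ?X 0 \<otimes>\<^bsub>AKF\<^esub> ?X 1 \<otimes>\<^bsub>AKF\<^esub> ?X 0)) = \<zero>\<^bsub>?IH\<^esub>" if "1 < n"
    proof -
      have s01: "s 0 \<in> carrier ?IH" "s 1 \<in> carrier ?IH" using s that by auto
      \<comment> \<open>The two sides of the relation of length four are the squares of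
        \<open>s 0 s 1\<close> and of \<open>s 1 s 0\<close>, which coincide.\<close>
      have "s 0 \<otimes>\<^bsub>?IH\<^esub> s 1 \<otimes>\<^bsub>?IH\<^esub> s 0 \<otimes>\<^bsub>?IH\<^esub> s 1 = (s 0 \<otimes>\<^bsub>?IH\<^esub> s 1) \<otimes>\<^bsub>?IH\<^esub> (s 0 \<otimes>\<^bsub>?IH\<^esub> s 1)"
        using s01 by (simp add: IH.M.m_assoc)
      also have "\<dots> = (s 1 \<otimes>\<^bsub>?IH\<^esub> s 0) \<otimes>\<^bsub>?IH\<^esub> (s 1 \<otimes>\<^bsub>?IH\<^esub> s 0)"
        by (simp only: central[OF s01(2)])
      also have "\<dots> = s 1 \<otimes>\<^bsub>?IH\<^esub> s 0 \<otimes>\<^bsub>?IH\<^esub> s 1 \<otimes>\<^bsub>?IH\<^esub> s 0"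
        using s01 by (simp add: IH.M.m_assoc)
      finally show ?thesis
        using that X[of 0] X[of 1] s[of 0] s[of 1] hX[of 0] hX[of 1]
        by (simp add: h.hom_a_minus a_minus_def[of ?IH] IH.M.r_neg del: free_algebra_simps)
    qed
    have D: "h ((?X 0 \<otimes>\<^bsub>AKF\<^esub> ?X j) \<ominus>\<^bsub>AKF\<^esub> (?X j \<otimes>\<^bsub>AKF\<^esub> ?X 0)) = \<zero>\<^bsub>?IH\<^esub>" if "j < n" for j
      using that n_pos X[of 0] X[of j] s[of 0] s[of j] hX[of 0] hX[of j] central[of "s j"]
      by (simp add: h.hom_a_minus a_minus_def[of ?IH] IH.M.r_neg del: free_algebra_simps)
    have "h f = \<zero>\<^bsub>?IH\<^esub>" if "f \<in> AK_rels" for f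
      using that A B C D unfolding ariki_koike_relations_def Let_def
      by (auto simp del: free_algebra_simps upt_Suc split: if_splits)
    then obtain g where "g \<in> alg_hom R AK ?IH" "\<And>f. f \<in> carrier AKF \<Longrightarrow>
        g (genideal AKF AK_rels +>\<^bsub>AKF\<^esub> f) = h f"
      unfolding AK_def by (metis presented_universal[OF AK_rels_closed IH.assoc_algebra_axioms h])
    then have "g (T i) = ?t i" if "i \<in> {1..<n}" for i
      using that hX[of i] X[of i] by (simp add: T_def presented_gen_def s_def)
    then show thesis by (rule that[OF \<open>g \<in> _\<close>])
  qed
  have TM: "T ` {1..<n} \<subseteq> carrier AK" using T_closed by auto
  \<comment> \<open>The fixed points of \<open>k\<close> after \<open>g\<close> form a subalgebra
    containing T_1, ..., T_(n-1); on the subalgebra these generate, \<open>k\<close> therefore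
    inverts \<open>g\<close>.\<close>
  have "subalgebra_of {x \<in> carrier AK. k (g x) = x} R AK"
    by (rule H.subalgebra_ofI) (auto simp: alg_homD[OF g] alg_homD[OF k])
  then have "carrier (generated_subalgebra R AK (T ` {1..<n})) \<subseteq> {x \<in> carrier AK. k (g x) = x}"
    by (rule H.generated_minimal) (use TM kt gT in auto)
  then have "inj_on g (carrier (generated_subalgebra R AK (T ` {1..<n})))"
    by (intro inj_on_inverseI[of _ k]) auto
  then have "g \<in> alg_iso R hecke_subalgebra (generated_subalgebra R ?IH (g ` T ` {1..<n}))"
    unfolding hecke_subalgebra_def
    by (rule alg_iso_generated[OF AK_assoc_algebra IH.assoc_algebra_axioms g TM])
  moreover have "g ` T ` {1..<n} = ?t ` {1..<n}" using gT by (auto simp: image_image)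
  moreover have "generated_subalgebra R ?IH (?t ` {1..<n}) = ?IH"
    using presented_generated[OF rels] by (simp add: generated_subalgebra_def iwahori_hecke_def)
  ultimately show ?thesis by (auto simp: alg_isomorphic_def)
qed

end

section \<open>Words in the simple transpositions\<close>

lemma word_perm_simps [simp]:
  "word_perm [] = id" "word_perm (j # js) = transpose j (j + 1) \<circ> word_perm js"
  by (simp_all add: word_perm_def)

lemma word_perm_append: "word_perm (us @ vs) = word_perm us \<circ> word_perm vs"
  by (induction us) (simp_all add: comp_assoc)

lemma word_perm_permutes: "js \<in> lists {1..<n} \<Longrightarrow> word_perm js permutes {1..n}"
proof (induction js)
  case (Cons j js)
  then have "transpose j (j + 1) permutes {1..n}" by (intro permutes_swap_id) auto
  moreover have "word_perm js permutes {1..n}" using Cons by simp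
  ultimately show ?case unfolding word_perm_simps by (intro permutes_compose)
qed simp

text \<open>Conjugating (a b) by the simple transposition (b, b + 1) gives (a, b + 1), so words grow
  by one letter at either end.\<close>

lemma transpose_word:
  assumes "1 \<le> a" "a < b" "b \<le> n"
  shows "\<exists>js\<in>lists {1..<n}. word_perm js = transpose a b"
  using assms(2,3)
proof (induction b)
  case (Suc b)
  show ?case
  proof (cases "a = b")
    case True
    then have "word_perm [b] = transpose a (Suc b)" "[b] \<in> lists {1..<n}"
      using Suc.prems assms(1) by auto
    then show ?thesis by blast
  next
    case False
    then obtain js where js: "js \<in> lists {1..<n}" "word_perm js = transpose a b"
      using Suc by auto
    have "transpose (Suc b) b \<circ> transpose b a \<circ> transpose (Suc b) b = transpose (Suc b) a"
      using False Suc.prems by (intro transpose_comp_triple) auto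
    then have "word_perm ([b] @ js @ [b]) = transpose a (Suc b)"
      by (simp only: word_perm_append js(2) comp_assoc word_perm_simps comp_id)
        (simp add: transpose_commute)
    moreover have "[b] @ js @ [b] \<in> lists {1..<n}" using js(1) False Suc.prems assms(1) by auto
    ultimately show ?thesis by blast
  qed
qed simp

lemma permutes_word:
  assumes "p permutes {1..n}"
  shows "\<exists>js\<in>lists {1..<n}. word_perm js = p"
  using assms
proof (induction n arbitrary: p)
  case 0
  then show ?case by (intro bexI[of _ "[]"]) auto
next
  case (Suc n)
  let ?a = "Suc n"
  have p: "p permutes insert ?a {1..n}" using Suc.prems by (simp add: atLeastAtMostSuc_conv)
  \<comment> \<open>Correcting p by the transposition of \<open>?a\<close> and \<open>p ?a\<close>
    fixes the last point, so the induction hypothesis applies; the transposition is then put back in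
    front as a word.\<close>
  obtain js where js: "js \<in> lists {1..<n}" "word_perm js = transpose ?a (p ?a) \<circ> p"
    using Suc.IH[OF permutes_insert_lemma[OF p]] by blast
  have pa: "p ?a \<in> {1..Suc n}" using Suc.prems permutes_in_image[of p "{1..Suc n}" ?a] by simp
  obtain us where us: "us \<in> lists {1..<Suc n}" "word_perm us = transpose ?a (p ?a)"
  proof (cases "p ?a = ?a")
    case True
    then show ?thesis using that[of "[]"] by simp
  next
    case False
    then show ?thesis
      using that transpose_word[of "p ?a" ?a "Suc n"] pa by (auto simp: transpose_commute[of ?a])
  qed
  have "word_perm (us @ js) = p"
    by (simp add: word_perm_append us(2) js(2) flip: comp_assoc)
  moreover have "us @ js \<in> lists {1..<Suc n}" using us(1) js(1) by auto
  ultimately show ?case by blast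
qed

text \<open>Guarantees that the word chosen in \<open>T_perm\<close> is a genuine reduced word, with
  letters in 1, ..., n - 1.\<close>

lemma reduced_word_exists:
  assumes "p permutes {1..n}"
  shows "\<exists>js. reduced_word n p js"
proof -
  let ?P = "\<lambda>l. \<exists>js\<in>lists {1..<n}. word_perm js = p \<and> length js = l"
  obtain js where "js \<in> lists {1..<n}" "word_perm js = p" using permutes_word[OF assms] by blast
  then have "?P (length js)" by blast
  then have "?P (perm_length n p)" unfolding perm_length_def by (rule LeastI)
  then show ?thesis by (auto simp: reduced_word_def)
qed

lemma perm_length_id: "perm_length n id = 0"
  unfolding perm_length_def by (intro Least_eq_0) auto

lemma reduced_word_id: "reduced_word n id js \<longleftrightarrow> js = []"
  by (auto simp: reduced_word_def perm_length_id)

lemma simple_transposition_neq_id: "transpose i (Suc i) \<noteq> id"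
  by (simp add: transpose_eq_id_iff)

lemma perm_length_simple:
  assumes "i \<in> {1..<n}"
  shows "perm_length n (transpose i (Suc i)) = 1"
  unfolding perm_length_def
proof (rule Least_equality)
  show "\<exists>js\<in>lists {1..<n}. word_perm js = transpose i (Suc i) \<and> length js = 1"
    using assms by (intro bexI[of _ "[i]"]) auto
  fix l assume "\<exists>js\<in>lists {1..<n}. word_perm js = transpose i (Suc i) \<and> length js = l"
  then show "1 \<le> l" using simple_transposition_neq_id[of i] by (cases l) auto
qed

text \<open>Uniqueness of the reduced word pins down the choice made in \<open>T_perm\<close>;
  together with the empty word for \<open>id\<close> this covers all permutations that enter
  \<open>C i\<close>.\<close>

lemma reduced_word_simple:
  assumes "i \<in> {1..<n}"
  shows "reduced_word n (transpose i (Suc i)) js \<longleftrightarrow> js = [i]"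
proof
  assume "reduced_word n (transpose i (Suc i)) js"
  then have "word_perm js = transpose i (Suc i)" "length js = 1"
    by (auto simp: reduced_word_def perm_length_simple[OF assms])
  then obtain j where j: "js = [j]" by (cases js) auto
  \<comment> \<open>At the point j the left side is \<open>Suc j\<close>, and the right side raises
    its argument only at i.\<close>
  then have "transpose j (Suc j) j = transpose i (Suc i) j"
    using \<open>word_perm js = _\<close> by simp
  then have "j = i" by (simp add: transpose_def split: if_splits)
  then show "js = [i]" using j by simp
next
  assume "js = [i]"
  then show "reduced_word n (transpose i (Suc i)) js"
    using assms by (simp add: reduced_word_def perm_length_simple)
qed

section \<open>Box counts of compositions\<close>

text \<open>\<open>boxes_upto\<close> before truncation to natural numbers. In this form it is
  additive in \<mu>, so the effect of a simple root can be computed on its own, although a simple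
  root is not a composition.\<close>

definition box_sum :: "(nat \<Rightarrow> nat) \<Rightarrow> (nat \<times> nat \<Rightarrow> int) \<Rightarrow> nat \<times> nat \<Rightarrow> int" where
  "box_sum m \<mu> = (\<lambda>(i, k). (\<Sum>l\<in>{1..<k}. part_size m \<mu> l) + (\<Sum>j\<in>{1..i}. \<mu> (j, k)))"

lemma boxes_upto_eq: "boxes_upto m \<mu> c = nat (box_sum m \<mu> c)"
  by (auto simp: boxes_upto_def box_sum_def split: prod.splits)

lemma part_size_add: "part_size m (\<mu> + \<nu>) k = part_size m \<mu> k + part_size m \<nu> k"
  by (simp add: part_size_def sum.distrib)

lemma part_size_diff: "part_size m (\<mu> - \<nu>) k = part_size m \<mu> k - part_size m \<nu> k"
  by (simp add: part_size_def sum_subtractf)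

lemma box_sum_add: "box_sum m (\<mu> + \<nu>) c = box_sum m \<mu> c + box_sum m \<nu> c"
  by (cases c) (simp add: box_sum_def part_size_add sum.distrib)

lemma box_sum_diff: "box_sum m (\<mu> - \<nu>) c = box_sum m \<mu> c - box_sum m \<nu> c"
  by (cases c) (simp add: box_sum_def part_size_diff sum_subtractf)

lemma sum_Gam: "(\<Sum>c\<in>Gam r m. \<mu> c) = (\<Sum>k\<in>{1..r}. part_size m \<mu> k)"
proof -
  have "Gam r m = (\<lambda>(k, i). (i, k)) ` (SIGMA k:{1..r}. {1..m k})"
    by (auto simp: Gam_def image_iff)
  moreover have "inj_on (\<lambda>(k, i). (i, k)) (SIGMA k:{1..r}. {1..m k})"
    by (auto simp: inj_on_def)
  ultimately have "(\<Sum>c\<in>Gam r m. \<mu> c) = (\<Sum>(k, i)\<in>(SIGMA k:{1..r}. {1..m k}). \<mu> (i, k))"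
    by (simp add: sum.reindex case_prod_unfold)
  then show ?thesis by (simp add: sum.Sigma part_size_def)
qed

lemma compositions_nonneg: "\<mu> \<in> compositions n r m \<Longrightarrow> 0 \<le> \<mu> c"
  unfolding compositions_def by blast

lemma part_size_nonneg: "\<mu> \<in> compositions n r m \<Longrightarrow> 0 \<le> part_size m \<mu> k"
  by (simp add: part_size_def compositions_nonneg sum_nonneg)

lemma part_sizes_le:
  assumes "\<mu> \<in> compositions n r m" "k \<le> r + 1"
  shows "(\<Sum>l\<in>{1..<k}. part_size m \<mu> l) \<le> int n"
proof -
  have "(\<Sum>l\<in>{1..<k}. part_size m \<mu> l) \<le> (\<Sum>l\<in>{1..r}. part_size m \<mu> l)"
    using assms(2) by (intro sum_mono2) (auto intro: part_size_nonneg[OF assms(1)])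
  then show ?thesis using assms(1) by (simp add: compositions_def sum_Gam)
qed

lemma boxes_before_le: "\<lbrakk>\<mu> \<in> compositions n r m; k \<le> r\<rbrakk> \<Longrightarrow> boxes_before m \<mu> k \<le> n"
  using part_sizes_le[of \<mu> n r m k] by (simp add: boxes_before_def)

lemma box_sum_le:
  assumes "\<mu> \<in> compositions n r m" "c \<in> Gam r m"
  shows "box_sum m \<mu> c \<le> int n"
proof -
  obtain i k where c: "c = (i, k)" "i \<le> m k" "1 \<le> k" "k \<le> r" using assms(2) by (auto simp: Gam_def)
  have "(\<Sum>j\<in>{1..i}. \<mu> (j, k)) \<le> part_size m \<mu> k"
    unfolding part_size_def using c compositions_nonneg[OF assms(1)] by (intro sum_mono2) auto
  then have "box_sum m \<mu> c \<le> (\<Sum>l\<in>{1..<k + 1}. part_size m \<mu> l)"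
    using c by (simp add: box_sum_def)
  also have "\<dots> \<le> int n" by (rule part_sizes_le[OF assms(1)]) (use c in simp)
  finally show ?thesis .
qed

lemma box_sum_ge:
  assumes "\<mu> \<in> compositions n r m" "c \<in> Gam r m"
  shows "\<mu> c \<le> box_sum m \<mu> c"
proof -
  obtain i k where c: "c = (i, k)" "1 \<le> i" using assms(2) by (auto simp: Gam_def)
  have "\<mu> (i, k) \<le> (\<Sum>j\<in>{1..i}. \<mu> (j, k))"
    using c compositions_nonneg[OF assms(1)] by (intro member_le_sum) auto
  moreover have "0 \<le> (\<Sum>l\<in>{1..<k}. part_size m \<mu> l)"
    using part_size_nonneg[OF assms(1)] by (intro sum_nonneg) auto
  ultimately show ?thesis by (simp add: c box_sum_def)
qed

text \<open>At the end of a component the row sum has become the full size of that component, so the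
  convention (m_k + 1, k) = (1, k + 1) fits the count without a correction.\<close>

lemma box_sum_next_row:
  assumes "c \<in> Gam r m"
  shows "box_sum m \<mu> (next_row m c) = box_sum m \<mu> c + \<mu> (next_row m c)"
proof -
  obtain i k where c: "c = (i, k)" "1 \<le> i" "1 \<le> k" using assms by (auto simp: Gam_def)
  show ?thesis using c by (cases "i = m k") (simp_all add: box_sum_def next_row_def part_size_def)
qed

text \<open>The bound that keeps the letters N + 1, ..., N + p - 1 of the words in
  \<open>e_value\<close> below n.\<close>

lemma boxes_upto_next_row_le:
  assumes "\<mu> \<in> compositions n r m" "c \<in> Gam r m" "next_row m c \<in> Gam r m"
  shows "boxes_upto m \<mu> c + nat (\<mu> (next_row m c)) \<le> n"
proof -
  have "0 \<le> box_sum m \<mu> c"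
    using box_sum_ge[OF assms(1,2)] compositions_nonneg[OF assms(1), of c] by linarith
  moreover have "0 \<le> \<mu> (next_row m c)" by (rule compositions_nonneg[OF assms(1)])
  moreover have "box_sum m \<mu> c + \<mu> (next_row m c) \<le> int n"
    using box_sum_le[OF assms(1,3)] box_sum_next_row[OF assms(2), of \<mu>] by simp
  ultimately show ?thesis by (simp add: boxes_upto_eq)
qed

lemma part_size_eps:
  assumes "c \<in> Gam r m"
  shows "part_size m (eps c) k = (if k = snd c then 1 else 0)"
proof -
  obtain i l where c: "c = (i, l)" "1 \<le> i" "i \<le> m l" using assms by (auto simp: Gam_def)
  have "part_size m (eps c) k = (\<Sum>j\<in>{1..m k}. if j = i then (if k = l then 1 else 0) else 0)"
    unfolding part_size_def by (intro sum.cong) (auto simp: eps_def c)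
  then show ?thesis using c by (auto simp: sum.delta)
qed

lemma box_sum_eps:
  assumes "c \<in> Gam r m" "1 \<le> k"
  shows "box_sum m (eps c) (i, k) = (if snd c < k \<or> snd c = k \<and> fst c \<le> i then 1 else 0)"
proof -
  obtain j l where c: "c = (j, l)" "1 \<le> j" "1 \<le> l" using assms by (auto simp: Gam_def)
  have "(\<Sum>l'\<in>{1..<k}. part_size m (eps c) l') = (if l < k then 1 else 0)"
    unfolding part_size_eps[OF assms(1)] using c by (simp add: sum.delta)
  moreover have "(\<Sum>j'\<in>{1..i}. eps c (j', k)) = (\<Sum>j'\<in>{1..i}. if j' = j then (if k = l then 1 else 0) else 0)"
    by (intro sum.cong) (auto simp: eps_def c)
  then have "(\<Sum>j'\<in>{1..i}. eps c (j', k)) = (if l = k \<and> j \<le> i then 1 else 0)"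
    using c by (auto simp: sum.delta)
  ultimately show ?thesis by (auto simp: box_sum_def c(1))
qed

text \<open>The row c adds 1 to every count from c onwards and the following row takes it back from
  there onwards. No row of \<open>Gam r m\<close> lies in between, so only the count at c itself
  changes.\<close>

lemma box_sum_simple_root:
  assumes "c \<in> Gam r m" "next_row m c \<in> Gam r m" "d \<in> Gam r m"
  shows "box_sum m (simple_root m c) d = (if d = c then 1 else 0)"
proof -
  obtain i k where d: "d = (i, k)" "1 \<le> k" "1 \<le> i" "i \<le> m k" using assms(3) by (auto simp: Gam_def)
  obtain j l where c: "c = (j, l)" "j \<le> m l" using assms(1) by (auto simp: Gam_def)
  have "box_sum m (simple_root m c) d = box_sum m (eps c) (i, k) - box_sum m (eps (next_row m c)) (i, k)"
    by (simp add: simple_root_def box_sum_diff d(1))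
  also have "\<dots> = (if d = c then 1 else 0)"
    using box_sum_eps[OF assms(1) d(2), of i] box_sum_eps[OF assms(2) d(2), of i] c d
    by (cases "j = m l") (auto simp: next_row_def)
  finally show ?thesis .
qed

lemma next_row_neq: "c \<in> Gam r m \<Longrightarrow> next_row m c \<noteq> c"
  by (auto simp: next_row_def Gam_def split: if_splits)

lemma compositions_add_simple_root:
  assumes \<mu>: "\<mu> \<in> compositions n r m" and c: "c \<in> Gam r m" "next_row m c \<in> Gam r m"
    and pos: "0 < \<mu> (next_row m c)"
  shows "\<mu> + simple_root m c \<in> compositions n r m"
proof -
  have "(\<Sum>k\<in>{1..r}. part_size m (eps d) k) = 1" if "d \<in> Gam r m" for d
    using that by (auto simp: part_size_eps[OF that] sum.delta Gam_def)
  then have "(\<Sum>d\<in>Gam r m. (\<mu> + simple_root m c) d) = int n"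
    using \<mu> c unfolding sum_Gam
    by (simp add: part_size_add simple_root_def part_size_diff sum.distrib sum_subtractf
        compositions_def flip: sum_Gam) (simp add: sum_Gam)
  moreover have "0 \<le> (\<mu> + simple_root m c) d" for d
    using compositions_nonneg[OF \<mu>, of d] pos by (auto simp: simple_root_def eps_def)
  moreover have "(\<mu> + simple_root m c) d = 0" if "d \<notin> Gam r m" for d
  proof -
    have "\<mu> d = 0" "d \<noteq> c" "d \<noteq> next_row m c" using that \<mu> c unfolding compositions_def by blast+
    then show ?thesis by (simp add: simple_root_def eps_def)
  qed
  ultimately show ?thesis unfolding compositions_def by blast
qed

section \<open>The elements of the Ariki-Koike algebra attached to compositions\<close>

lemma omega_apply: "omega n r (i, k) = (if k = r \<and> 1 \<le> i \<and> i \<le> n then 1 else 0)"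
  by (simp add: omega_def)

context ariki_koike
begin

abbreviation "CS \<equiv> compositions n r m"
abbreviation "om \<equiv> omega n r"

lemma n_le_m_r: "n \<le> m r"
  using m_ge[of r] r_ge_2 by simp

lemma part_size_omega: "part_size m om k = (if k = r then int n else 0)"
proof -
  have "part_size m om k = (\<Sum>i\<in>{1..m k} \<inter> {i. k = r \<and> i \<le> n}. 1)"
    unfolding part_size_def by (intro sum.mono_neutral_cong_right) (auto simp: omega_apply)
  moreover have "{1..m k} \<inter> {i. k = r \<and> i \<le> n} = (if k = r then {1..n} else {})"
    using n_le_m_r by auto
  ultimately show ?thesis by simp
qed

lemma omega_composition: "om \<in> CS"
proof -
  have "(\<Sum>c\<in>Gam r m. om c) = int n"
    using r_ge_2 by (simp add: sum_Gam part_size_omega sum.delta)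
  moreover have "om c = 0" if "c \<notin> Gam r m" for c
    using that n_le_m_r r_ge_2 by (cases c) (auto simp: omega_apply Gam_def)
  moreover have "0 \<le> om c" for c by (cases c) (simp add: omega_apply)
  ultimately show ?thesis unfolding compositions_def by blast
qed

lemma omega_partition: "om \<in> partitions n r m"
  using omega_composition by (auto simp: partitions_def omega_apply)

lemma box_sum_omega:
  assumes "1 \<le> k" "k \<le> r"
  shows "box_sum m om (i, k) = (if k = r then int (min i n) else 0)"
proof -
  have "(\<Sum>j\<in>{1..i}. om (j, k)) = (\<Sum>j\<in>{1..i} \<inter> {j. k = r \<and> j \<le> n}. 1)"
    by (intro sum.mono_neutral_cong_right) (auto simp: omega_apply)
  moreover have "{1..i} \<inter> {j. k = r \<and> j \<le> n} = (if k = r then {1..min i n} else {})"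
    by auto
  moreover have "(\<Sum>l\<in>{1..<k}. part_size m om l) = 0"
    using assms by (intro sum.neutral) (auto simp: part_size_omega)
  ultimately show ?thesis by (simp add: box_sum_def)
qed

text \<open>The row \<open>c\<close> with \<open>C\<^sub>i = 1\<^sub>\<omega> f\<^sub>c e\<^sub>c 1\<^sub>\<omega>\<close>, and the composition \<open>\<omega> + \<alpha>\<^sub>c\<close>.\<close>

definition gen_row :: "nat \<Rightarrow> nat \<times> nat" where
  "gen_row i = (if i = 0 then (m (r - 1), r - 1) else (i, r))"

definition bump :: "nat \<Rightarrow> nat \<times> nat \<Rightarrow> int" where
  "bump i = om + simple_root m (gen_row i)"

lemma gen_row_Gam: "i < n \<Longrightarrow> gen_row i \<in> Gam r m"
proof -
  assume "i < n"
  moreover have "1 \<le> r - 1" "r - 1 \<le> r" using r_ge_2 by auto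
  then have "n \<le> m (r - 1)" by (intro m_ge) auto
  ultimately show ?thesis
    using n_le_m_r r_ge_2 n_pos \<open>1 \<le> r - 1\<close> by (auto simp: gen_row_def Gam_def)
qed

lemma next_gen_row: "i < n \<Longrightarrow> next_row m (gen_row i) = (Suc i, r)"
  using r_ge_2 n_le_m_r by (auto simp: gen_row_def next_row_def)

lemma next_gen_row_Gam: "i < n \<Longrightarrow> next_row m (gen_row i) \<in> Gam r m"
  using r_ge_2 n_le_m_r by (auto simp: next_gen_row Gam_def)

lemma Suc_row_Gam: "i < n \<Longrightarrow> (Suc i, r) \<in> Gam r m"
  using next_gen_row_Gam[of i] by (simp add: next_gen_row)

lemma bump_composition: "i < n \<Longrightarrow> bump i \<in> CS"
  unfolding bump_def
  by (rule compositions_add_simple_root[OF omega_composition gen_row_Gam next_gen_row_Gam])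
    (simp_all add: next_gen_row omega_apply)

lemma bump_apply:
  "i < n \<Longrightarrow> bump i d = om d + (if d = gen_row i then 1 else 0) - (if d = (Suc i, r) then 1 else 0)"
  by (simp add: bump_def simple_root_def eps_def next_gen_row)

lemma box_sum_bump:
  "\<lbrakk>i < n; d \<in> Gam r m\<rbrakk> \<Longrightarrow> box_sum m (bump i) d = box_sum m om d + (if d = gen_row i then 1 else 0)"
  by (simp add: bump_def box_sum_add box_sum_simple_root[OF gen_row_Gam next_gen_row_Gam])

lemma boxes_before_omega: "k \<le> r \<Longrightarrow> boxes_before m om k = 0"
  by (simp add: boxes_before_def part_size_omega sum.delta)

text \<open>For i = 0 the simple root moves a box from component r to component r - 1, so exactly
  one box precedes component r; for i \<ge> 1 the box stays inside component r. This is the origin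
  of the single factor L_1 - Q_r.\<close>

lemma boxes_before_bump:
  assumes "i < n" "1 \<le> k" "k \<le> r"
  shows "boxes_before m (bump i) k = (if i = 0 \<and> k = r then 1 else 0)"
proof -
  have "(\<Sum>l\<in>{1..<k}. part_size m (bump i) l)
      = (\<Sum>l\<in>{1..<k}. (if l = snd (gen_row i) then 1 else 0))"
    using assms by (intro sum.cong)
      (simp_all add: bump_def part_size_add simple_root_def part_size_diff part_size_omega
        part_size_eps[OF gen_row_Gam] part_size_eps[OF Suc_row_Gam] next_gen_row)
  also have "\<dots> = (if i = 0 \<and> k = r then 1 else 0)"
    using assms r_ge_2 by (auto simp: sum.delta gen_row_def)
  finally show ?thesis by (simp add: boxes_before_def)
qed

section \<open>Young subgroups of \<omega> and of its neighbours \<omega> + \<alpha>\<close>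

lemma id_young_subgroup: "id \<in> young_subgroup n r m \<mu>"
  by (simp add: young_subgroup_def Let_def)

text \<open>The block of a row with a single box, up to which j boxes are counted, is {j}; stability
  of that block leaves no freedom.\<close>

lemma young_subgroup_fixes:
  assumes w: "w \<in> young_subgroup n r m \<mu>" and j: "1 \<le> j" "j \<le> n"
    and box: "boxes_upto m \<mu> (j, r) = j" "\<mu> (j, r) = 1"
  shows "w j = j"
proof -
  have "(j, r) \<in> Gam r m" using j n_le_m_r r_ge_2 by (auto simp: Gam_def)
  then have "w ` {boxes_upto m \<mu> (j, r) - nat (\<mu> (j, r))<..boxes_upto m \<mu> (j, r)} =
      {boxes_upto m \<mu> (j, r) - nat (\<mu> (j, r))<..boxes_upto m \<mu> (j, r)}"
    using w unfolding young_subgroup_def Let_def by blast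
  then have "w ` {j - nat 1<..j} = {j - nat 1<..j}" by (simp only: box)
  moreover have "{j - nat 1<..j} = {j}" using j by auto
  ultimately show ?thesis by simp
qed

lemma young_subgroup_omega: "young_subgroup n r m om = {id}"
proof -
  have "w = id" if w: "w \<in> young_subgroup n r m om" for w
  proof
    fix j
    have "w permutes {1..n}" using w by (simp add: young_subgroup_def)
    moreover have "w j = j" if "1 \<le> j" "j \<le> n"
      using that r_ge_2 by (intro young_subgroup_fixes[OF w])
        (auto simp: boxes_upto_eq box_sum_omega omega_apply)
    ultimately show "w j = id j"
      using permutes_not_in[of w "{1..n}" j] by auto
  qed
  then show ?thesis using id_young_subgroup by auto
qed

lemma bump_singleton:
  assumes "i < n" "1 \<le> j" "j \<le> n" "j \<noteq> i" "j \<noteq> Suc i"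
  shows "boxes_upto m (bump i) (j, r) = j" "bump i (j, r) = 1"
proof -
  have "(j, r) \<in> Gam r m" using assms n_le_m_r r_ge_2 by (auto simp: Gam_def)
  moreover have "(j, r) \<noteq> gen_row i" using assms r_ge_2 by (auto simp: gen_row_def)
  ultimately show "boxes_upto m (bump i) (j, r) = j" "bump i (j, r) = 1"
    using assms r_ge_2 by (simp_all add: boxes_upto_eq box_sum_bump box_sum_omega bump_apply omega_apply)
qed

text \<open>Rows of component r other than i and i + 1 keep their single box and pin their entries.
  For i = 0 the intersection with {1..n} discards the point 0 and leaves only 1.\<close>

lemma young_subgroup_bump_permutes:
  assumes "i < n" "w \<in> young_subgroup n r m (bump i)"
  shows "w permutes ({i, Suc i} \<inter> {1..n})"
proof (rule permutes_superset)
  show "w permutes {1..n}" using assms(2) by (simp add: young_subgroup_def)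
  fix j assume "j \<in> {1..n} - {i, Suc i} \<inter> {1..n}"
  then show "w j = j"
    using assms by (intro young_subgroup_fixes[OF assms(2)] bump_singleton) auto
qed

lemma young_subgroup_bump_0: "young_subgroup n r m (bump 0) = {id}"
proof -
  have "{0, Suc 0} \<inter> {1..n} = {1}" using n_pos by auto
  then have "w = id" if "w \<in> young_subgroup n r m (bump 0)" for w
    using young_subgroup_bump_permutes[OF _ that] n_pos by (simp add: permutes_sing)
  then show ?thesis using id_young_subgroup by auto
qed

lemma young_subgroup_bump:
  assumes i: "i \<in> {1..<n}"
  shows "young_subgroup n r m (bump i) = {id, transpose i (Suc i)}"
proof
  have "{i, Suc i} \<inter> {1..n} = {i, Suc i}" using i by auto
  then show "young_subgroup n r m (bump i) \<subseteq> {id, transpose i (Suc i)}"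
    using young_subgroup_bump_permutes[of i] i by (auto simp: permutes_doubleton_iff)
  have "transpose i (Suc i) \<in> young_subgroup n r m (bump i)"
    unfolding young_subgroup_def Let_def
  proof (intro CollectI conjI ballI)
    show "transpose i (Suc i) permutes {1..n}" using i by (intro permutes_swap_id) auto
    fix d assume d: "d \<in> Gam r m"
    obtain j k where jk: "d = (j, k)" "1 \<le> j" "1 \<le> k" "k \<le> r" using d by (auto simp: Gam_def)
    let ?B = "{boxes_upto m (bump i) d - nat (bump i d)<..boxes_upto m (bump i) d}"
    consider "k \<noteq> r" | "k = r" "j = i" | "k = r" "j = Suc i" | "k = r" "n < j"
      | "k = r" "j \<le> n" "j \<noteq> i" "j \<noteq> Suc i" by linarith
    \<comment> \<open>A transposition preserves a set that contains both or neither of its two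
      points. Row i now has the block {i, i + 1}, row i + 1 is empty, and the remaining blocks avoid
      both points.\<close>
    then have "i \<in> ?B \<longleftrightarrow> Suc i \<in> ?B"
    proof cases
      case 1
      then have "bump i d = 0" using i jk by (auto simp: bump_apply omega_apply gen_row_def)
      then show ?thesis by simp
    next
      case 2
      then have "bump i d = 2" "boxes_upto m (bump i) d = i + 1"
        using i jk d by (auto simp: bump_apply omega_apply gen_row_def boxes_upto_eq box_sum_bump box_sum_omega)
      then show ?thesis using i by simp
    next
      case 3
      then have "bump i d = 0" using i jk by (auto simp: bump_apply omega_apply gen_row_def)
      then show ?thesis by simp
    next
      case 4
      then have "bump i d = 0" using i jk by (auto simp: bump_apply omega_apply gen_row_def)
      then show ?thesis by simp
    next
      case 5
      then have "bump i d = 1" "boxes_upto m (bump i) d = j"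
        using bump_singleton[of i j] i jk by auto
      then show ?thesis using 5 by auto
    qed
    then show "transpose i (Suc i) ` ?B = ?B" by (rule transpose_image_eq)
  qed
  then show "{id, transpose i (Suc i)} \<subseteq> young_subgroup n r m (bump i)"
    using id_young_subgroup by auto
qed

section \<open>The elements T_w, their weighted sums, and \<open>m_elem\<close>\<close>

lemma T_perm_closed:
  assumes "p permutes {1..n}"
  shows "T_perm p \<in> carrier AK"
proof -
  have "reduced_word n p (SOME js. reduced_word n p js)"
    using reduced_word_exists[OF assms] by (rule someI_ex)
  then obtain js where js: "T_perm p = lprod AK (map T js)" "js \<in> lists {1..<n}"
    unfolding T_perm_def reduced_word_def by blast
  then have "set (map T js) \<subseteq> carrier AK" using T_closed by auto
  then show ?thesis unfolding js(1) by (rule H.lprod_closed)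
qed

lemma T_perm_id: "T_perm id = \<one>\<^bsub>AK\<^esub>"
  by (simp add: T_perm_def reduced_word_id lprod_def)

lemma T_perm_simple: "i \<in> {1..<n} \<Longrightarrow> T_perm (transpose i (Suc i)) = T i"
  by (simp add: T_perm_def reduced_word_simple lprod_def T_closed)

lemma q_pow_closed: "q [^] (k :: nat) \<in> carrier R"
  using q_unit by (intro R.nat_pow_closed) auto

lemma q_int_pow_closed: "q [^] (z :: int) \<in> carrier R"
proof (cases "z < 0")
  case True
  then show ?thesis
    by (simp only: int_pow_def2 if_True R.Units_inv_closed[OF R.Units_pow_closed[OF q_unit]])
qed (simp only: int_pow_def2 if_False q_pow_closed)

lemma weighted_sum_closed:
  assumes "\<And>w. w \<in> W \<Longrightarrow> w permutes {1..n}"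
  shows "weighted_sum W \<in> carrier AK"
  unfolding weighted_sum_def
  using assms by (intro H.M.finsum_closed) (auto intro!: H.smult_closed q_pow_closed T_perm_closed)

lemma weighted_sum_id: "weighted_sum {id} = \<one>\<^bsub>AK\<^esub>"
  by (simp add: weighted_sum_def perm_length_id T_perm_id)

lemma weighted_sum_simple:
  assumes "i \<in> {1..<n}"
  shows "weighted_sum {id, transpose i (Suc i)} = \<one>\<^bsub>AK\<^esub> \<oplus>\<^bsub>AK\<^esub> q \<odot>\<^bsub>AK\<^esub> T i"
proof -
  define f where "f w = q [^] perm_length n w \<odot>\<^bsub>AK\<^esub> T_perm w" for w
  have q: "q \<in> carrier R" using q_unit by auto
  have f: "f id = \<one>\<^bsub>AK\<^esub>" "f (transpose i (Suc i)) = q \<odot>\<^bsub>AK\<^esub> T i"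
    using q by (simp_all add: f_def perm_length_id T_perm_id perm_length_simple[OF assms] T_perm_simple[OF assms])
  have T: "T i \<in> carrier AK" using assms by (intro T_closed) simp
  have "weighted_sum {id, transpose i (Suc i)} = (\<Oplus>\<^bsub>AK\<^esub>w\<in>{id, transpose i (Suc i)}. f w)"
    by (simp add: weighted_sum_def f_def)
  also have "\<dots> = f id \<oplus>\<^bsub>AK\<^esub> (\<Oplus>\<^bsub>AK\<^esub>w\<in>{transpose i (Suc i)}. f w)"
    using simple_transposition_neq_id[of i, symmetric] q T by (intro H.M.finsum_insert) (auto simp: f)
  also have "(\<Oplus>\<^bsub>AK\<^esub>w\<in>{transpose i (Suc i)}. f w) = f (transpose i (Suc i))"
    using q T by (simp add: f)
  finally show ?thesis by (simp only: f)
qed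

lemma JM_closed: "\<lbrakk>1 \<le> i; i \<le> n\<rbrakk> \<Longrightarrow> JM i \<in> carrier AK"
proof (induction i)
  case (Suc i)
  then show ?case using T_closed[of i] n_pos T_closed[of 0] by auto
qed simp

lemma m_elem_closed:
  assumes "\<mu> \<in> CS"
  shows "m_elem \<mu> \<in> carrier AK"
proof -
  have "weighted_sum (young_subgroup n r m \<mu>) \<in> carrier AK"
    by (rule weighted_sum_closed) (simp add: young_subgroup_def)
  moreover have "JM i \<ominus>\<^bsub>AK\<^esub> Q k \<odot>\<^bsub>AK\<^esub> \<one>\<^bsub>AK\<^esub> \<in> carrier AK"
    if "k \<in> {1..r}" "i \<in> {1..boxes_before m \<mu> k}" for i k
    using that boxes_before_le[OF assms, of k] JM_closed[of i] Q_closed[of k] by auto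
  then have "lprod AK (map (\<lambda>k. lprod AK (map (\<lambda>i. JM i \<ominus>\<^bsub>AK\<^esub> Q k \<odot>\<^bsub>AK\<^esub> \<one>\<^bsub>AK\<^esub>)
      [1..<boxes_before m \<mu> k + 1])) [1..<r + 1]) \<in> carrier AK"
    by (intro H.lprod_closed image_subsetI subsetI) (force intro!: H.lprod_closed)
  ultimately show ?thesis by (simp add: m_elem_def)
qed

lemma lprod_ones: "set xs \<subseteq> {\<one>\<^bsub>AK\<^esub>} \<Longrightarrow> lprod AK xs = \<one>\<^bsub>AK\<^esub>"
  by (induction xs) (auto simp: lprod_def)

lemma m_elem_omega: "m_elem om = \<one>\<^bsub>AK\<^esub>"
proof -
  have "lprod AK (map (\<lambda>k. lprod AK (map (\<lambda>i. JM i \<ominus>\<^bsub>AK\<^esub> Q k \<odot>\<^bsub>AK\<^esub> \<one>\<^bsub>AK\<^esub>)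
      [1..<boxes_before m om k + 1])) [1..<r + 1]) = \<one>\<^bsub>AK\<^esub>"
    by (rule lprod_ones) (auto simp: boxes_before_omega lprod_def)
  then show ?thesis by (simp add: m_elem_def young_subgroup_omega weighted_sum_id)
qed

lemma m_elem_bump_0: "m_elem (bump 0) = T 0 \<ominus>\<^bsub>AK\<^esub> Q r \<odot>\<^bsub>AK\<^esub> \<one>\<^bsub>AK\<^esub>"
proof -
  let ?p = "\<lambda>k. lprod AK (map (\<lambda>i. JM i \<ominus>\<^bsub>AK\<^esub> Q k \<odot>\<^bsub>AK\<^esub> \<one>\<^bsub>AK\<^esub>) [1..<boxes_before m (bump 0) k + 1])"
  have c: "T 0 \<ominus>\<^bsub>AK\<^esub> Q r \<odot>\<^bsub>AK\<^esub> \<one>\<^bsub>AK\<^esub> \<in> carrier AK"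
    using T_closed[of 0] n_pos Q_closed[of r] r_ge_2 by simp
  have p1: "?p k = \<one>\<^bsub>AK\<^esub>" if "k \<in> {1..<r}" for k
    using that n_pos by (simp add: boxes_before_bump lprod_def)
  have pr: "?p r = T 0 \<ominus>\<^bsub>AK\<^esub> Q r \<odot>\<^bsub>AK\<^esub> \<one>\<^bsub>AK\<^esub>"
    using n_pos r_ge_2 c by (simp add: boxes_before_bump lprod_def)
  \<comment> \<open>Only the last component contributes a factor different from the unit, so it is
    split off.\<close>
  have "[1..<r + 1] = [1..<r] @ [r]" using r_ge_2 by simp
  then have "lprod AK (map ?p [1..<r + 1]) = lprod AK (map ?p [1..<r]) \<otimes>\<^bsub>AK\<^esub> lprod AK [?p r]"
    using p1 pr c by (simp only: map_append list.map) (intro H.lprod_append, auto)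
  also have "lprod AK (map ?p [1..<r]) = \<one>\<^bsub>AK\<^esub>"
    by (rule lprod_ones) (use p1 in auto)
  finally show ?thesis
    using c n_pos by (simp only: m_elem_def young_subgroup_bump_0 weighted_sum_id pr H.lprod_singleton H.M.l_one)
qed

lemma m_elem_bump:
  assumes "i \<in> {1..<n}"
  shows "m_elem (bump i) = \<one>\<^bsub>AK\<^esub> \<oplus>\<^bsub>AK\<^esub> q \<odot>\<^bsub>AK\<^esub> T i"
proof -
  have "lprod AK (map (\<lambda>k. lprod AK (map (\<lambda>i. JM i \<ominus>\<^bsub>AK\<^esub> Q k \<odot>\<^bsub>AK\<^esub> \<one>\<^bsub>AK\<^esub>)
      [1..<boxes_before m (bump i) k + 1])) [1..<r + 1]) = \<one>\<^bsub>AK\<^esub>"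
    by (rule lprod_ones) (use assms in \<open>auto simp: boxes_before_bump lprod_def\<close>)
  moreover have "\<one>\<^bsub>AK\<^esub> \<oplus>\<^bsub>AK\<^esub> q \<odot>\<^bsub>AK\<^esub> T i \<in> carrier AK"
    using assms T_closed[of i] q_unit by auto
  ultimately show ?thesis
    using assms by (simp add: m_elem_def young_subgroup_bump weighted_sum_simple)
qed

section \<open>Values of e and f on the generators of the summands\<close>

lemma e_value_omega:
  assumes "i < n"
  shows "e_value (gen_row i) om = m_elem (bump i)"
proof -
  \<comment> \<open>The row of \<omega> from which \<open>e\<close> takes its box has p = 1, so the
    sum is trivial and the power of q has exponent 0.\<close>
  have "{word_perm [N + 1..<N + 1 + j] | j. j < nat 1} = {id}" for N by auto
  then show ?thesis
    using assms m_elem_closed[OF bump_composition[OF assms]]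
    by (simp add: e_value_def Let_def next_gen_row omega_apply weighted_sum_id bump_def)
qed

lemma bump_minus: "bump i - simple_root m (gen_row i) = om"
  by (simp add: bump_def)

text \<open>The box returns from the last row of component r - 1 to component r, so \<open>f\<close>
  carries the factor L_N - Q_r with N = 1, which is exactly \<open>m_elem (bump 0)\<close>. The box
  is alone in its row, which makes the sum and the power of q trivial.\<close>

lemma f_value_bump_0: "f_value (gen_row 0) (bump 0) = m_elem (bump 0)"
proof -
  have c: "m_elem (bump 0) \<in> carrier AK"
    using n_pos by (intro m_elem_closed bump_composition) simp
  have "boxes_upto m (bump 0) (gen_row 0) = 1"
    using n_pos r_ge_2 gen_row_Gam[of 0]
    by (simp add: boxes_upto_eq box_sum_bump) (simp add: gen_row_def box_sum_omega)
  moreover have "r - Suc 0 \<noteq> r" using r_ge_2 by simp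
  then have "bump 0 (gen_row 0) = 1"
    using n_pos by (simp add: bump_apply) (simp add: gen_row_def omega_apply)
  moreover have "{word_perm (rev [N - j..<N]) | j. j < nat 1} = {id}" for N by auto
  ultimately show ?thesis
    using c r_ge_2
    by (simp add: f_value_def Let_def bump_minus m_elem_omega weighted_sum_id)
      (simp add: gen_row_def m_elem_bump_0)
qed

text \<open>Row i holds p = 2 boxes and N = i + 1: the exponent 1 - p is -1, and the sum runs over 1
  and s_i, which is the Young subgroup of \<open>bump i\<close>. As the generator at \<omega> is 1,
  the sum is again \<open>m_elem (bump i)\<close>.\<close>

lemma f_value_bump:
  assumes "i \<in> {1..<n}"
  shows "f_value (gen_row i) (bump i) = inv q \<odot>\<^bsub>AK\<^esub> m_elem (bump i)"
proof -
  have c: "m_elem (bump i) \<in> carrier AK"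
    using assms by (intro m_elem_closed bump_composition) simp
  have "boxes_upto m (bump i) (gen_row i) = Suc i"
    using assms r_ge_2 gen_row_Gam[of i]
    by (simp add: boxes_upto_eq box_sum_bump) (simp add: gen_row_def box_sum_omega)
  moreover have "bump i (gen_row i) = 2"
    using assms r_ge_2 by (simp add: bump_apply) (simp add: gen_row_def omega_apply)
  moreover have "{word_perm (rev [Suc i - j..<Suc i]) | j. j < nat 2} = {id, transpose i (Suc i)}"
  proof -
    have "{word_perm (rev [Suc i - j..<Suc i]) | j. j < nat 2}
        = (\<lambda>j. word_perm (rev [Suc i - j..<Suc i])) ` {j. j < nat 2}" by blast
    also have "{j. j < nat 2} = {0, 1}" by auto
    finally show ?thesis by simp
  qed
  moreover have "q [^] (1 - 2 :: int) = inv q"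
    using R.Units_closed[OF q_unit] by (simp add: int_pow_def2)
  \<comment> \<open>Here i < n \<le> m_r keeps the row away from the end of component r, so the
    extra factor of \<open>f\<close> is 1.\<close>
  moreover have "fst (gen_row i) \<noteq> m (snd (gen_row i))"
    using assms n_le_m_r by (auto simp: gen_row_def)
  moreover have "m_elem (bump i) = weighted_sum {id, transpose i (Suc i)}"
    using assms by (simp only: m_elem_bump weighted_sum_simple)
  ultimately show ?thesis
    using c by (simp add: f_value_def Let_def bump_minus m_elem_omega)
qed

text \<open>Places the prescribed value in the right ideal of the target composition; this is what
  keeps \<open>e_map\<close> inside the tensor space.\<close>

lemma e_value_mem:
  assumes \<mu>: "\<mu> \<in> CS" and c: "c \<in> Gam r m" "next_row m c \<in> Gam r m"
    and \<nu>: "\<mu> + simple_root m c \<in> CS"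
  shows "\<exists>h\<in>carrier AK. e_value c \<mu> = m_elem (\<mu> + simple_root m c) \<otimes>\<^bsub>AK\<^esub> h"
proof -
  let ?N = "boxes_upto m \<mu> c" and ?p = "\<mu> (next_row m c)"
  let ?W = "weighted_sum {word_perm [?N + 1..<?N + 1 + j] | j. j < nat ?p}"
  have "?N + nat ?p \<le> n" by (rule boxes_upto_next_row_le[OF \<mu> c])
  then have "w permutes {1..n}" if "w \<in> {word_perm [?N + 1..<?N + 1 + j] | j. j < nat ?p}" for w
  proof -
    obtain j where "w = word_perm [?N + 1..<?N + 1 + j]" "j < nat ?p"
      using \<open>w \<in> _\<close> by blast
    moreover have "[?N + 1..<?N + 1 + j] \<in> lists {1..<n}"
      using \<open>j < nat ?p\<close> \<open>?N + nat ?p \<le> n\<close> unfolding in_lists_conv_set set_upt by force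
    ultimately show ?thesis using word_perm_permutes by blast
  qed
  then have W: "?W \<in> carrier AK" by (rule weighted_sum_closed)
  have "e_value c \<mu> = m_elem (\<mu> + simple_root m c) \<otimes>\<^bsub>AK\<^esub> ((q [^] (1 - ?p)) \<odot>\<^bsub>AK\<^esub> ?W)"
    unfolding e_value_def Let_def using W m_elem_closed[OF \<nu>] q_int_pow_closed
    by (simp add: H.smult_mult_r)
  then show ?thesis using W q_int_pow_closed by blast
qed

lemma f_value_mem:
  assumes \<mu>: "\<mu> \<in> CS" and c: "c \<in> Gam r m" "next_row m c \<in> Gam r m"
    and \<nu>: "\<mu> - simple_root m c \<in> CS"
  shows "\<exists>h\<in>carrier AK. f_value c \<mu> = m_elem (\<mu> - simple_root m c) \<otimes>\<^bsub>AK\<^esub> h"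
proof -
  let ?N = "boxes_upto m \<mu> c" and ?p = "\<mu> c"
  let ?W = "weighted_sum {word_perm (rev [?N - j..<?N]) | j. j < nat ?p}"
  let ?h = "if fst c = m (snd c) then JM ?N \<ominus>\<^bsub>AK\<^esub> Q (snd c + 1) \<odot>\<^bsub>AK\<^esub> \<one>\<^bsub>AK\<^esub> else \<one>\<^bsub>AK\<^esub>"
  have pN: "nat ?p \<le> ?N" and N: "?N \<le> n"
    using box_sum_ge[OF \<mu> c(1)] box_sum_le[OF \<mu> c(1)] by (auto simp: boxes_upto_eq)
  then have "w permutes {1..n}" if "w \<in> {word_perm (rev [?N - j..<?N]) | j. j < nat ?p}" for w
  proof -
    obtain j where "w = word_perm (rev [?N - j..<?N])" "j < nat ?p"
      using \<open>w \<in> _\<close> by blast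
    moreover have "rev [?N - j..<?N] \<in> lists {1..<n}"
      using \<open>j < nat ?p\<close> pN N unfolding in_lists_conv_set set_rev set_upt by force
    ultimately show ?thesis using word_perm_permutes by blast
  qed
  then have W: "?W \<in> carrier AK" by (rule weighted_sum_closed)
  \<comment> \<open>Since \<mu> - \<alpha> is a composition, row c of \<mu> is nonempty; hence N
    \<ge> 1 and the unspecified value \<open>JM 0\<close> is never met.\<close>
  have "0 \<le> (\<mu> - simple_root m c) c" by (rule compositions_nonneg[OF \<nu>])
  then have "1 \<le> ?p" using next_row_neq[OF c(1)] by (auto simp: simple_root_def eps_def split: if_splits)
  then have "1 \<le> ?N" using pN by linarith
  \<comment> \<open>At the end of a component the next row starts the following one, which must
    exist because that row lies in \<open>Gam r m\<close>.\<close>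
  moreover have "snd c + 1 \<in> {1..r}" if "fst c = m (snd c)"
    using that c by (cases c) (auto simp: next_row_def Gam_def)
  ultimately have h: "?h \<in> carrier AK" using N JM_closed Q_closed by simp
  have "f_value c \<mu> = m_elem (\<mu> - simple_root m c) \<otimes>\<^bsub>AK\<^esub> ((q [^] (1 - ?p)) \<odot>\<^bsub>AK\<^esub> (?h \<otimes>\<^bsub>AK\<^esub> ?W))"
    unfolding f_value_def Let_def
    using W h m_elem_closed[OF \<nu>] q_int_pow_closed[of "1 - ?p"] H.M.m_assoc[OF m_elem_closed[OF \<nu>] h W]
    by (simp only: H.smult_mult_r H.M.m_closed)
  moreover have "(q [^] (1 - ?p)) \<odot>\<^bsub>AK\<^esub> (?h \<otimes>\<^bsub>AK\<^esub> ?W) \<in> carrier AK"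
    by (intro H.smult_closed q_int_pow_closed H.M.m_closed h W)
  ultimately show ?thesis by blast
qed

end

section \<open>The corner of the Schur algebra at \<open>\<omega>\<close>\<close>

context ariki_koike
begin

lemma perm_module_simps [simp]:
  "vzero (perm_module \<mu>) = \<zero>\<^bsub>AK\<^esub>" "vadd (perm_module \<mu>) = ring.add AK"
  "vact (perm_module \<mu>) = monoid.mult AK"
  by (simp_all add: perm_module_def principal_right_ideal_def)

lemma perm_module_carrier: "x \<in> carrier (perm_module \<mu>) \<longleftrightarrow> (\<exists>h\<in>carrier AK. x = m_elem \<mu> \<otimes>\<^bsub>AK\<^esub> h)"
  by (auto simp: perm_module_def principal_right_ideal_def)

lemma perm_module_omega: "carrier (perm_module om) = carrier AK"
  by (auto simp: perm_module_carrier m_elem_omega)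

lemma perm_module_closed:
  assumes "\<mu> \<in> CS"
  shows "\<zero>\<^bsub>AK\<^esub> \<in> carrier (perm_module \<mu>)"
    and "\<lbrakk>x \<in> carrier (perm_module \<mu>); y \<in> carrier (perm_module \<mu>)\<rbrakk> \<Longrightarrow> x \<oplus>\<^bsub>AK\<^esub> y \<in> carrier (perm_module \<mu>)"
    and "\<lbrakk>x \<in> carrier (perm_module \<mu>); h \<in> carrier AK\<rbrakk> \<Longrightarrow> x \<otimes>\<^bsub>AK\<^esub> h \<in> carrier (perm_module \<mu>)"
proof -
  note mc = m_elem_closed[OF assms]
  show "\<zero>\<^bsub>AK\<^esub> \<in> carrier (perm_module \<mu>)"
    unfolding perm_module_carrier using mc by (intro bexI[of _ "\<zero>\<^bsub>AK\<^esub>"]) simp_all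
  show "x \<oplus>\<^bsub>AK\<^esub> y \<in> carrier (perm_module \<mu>)"
    if x: "x \<in> carrier (perm_module \<mu>)" and y: "y \<in> carrier (perm_module \<mu>)"
  proof -
    obtain a b where "a \<in> carrier AK" "x = m_elem \<mu> \<otimes>\<^bsub>AK\<^esub> a" "b \<in> carrier AK" "y = m_elem \<mu> \<otimes>\<^bsub>AK\<^esub> b"
      using x[unfolded perm_module_carrier] y[unfolded perm_module_carrier] by (elim bexE)
    then show ?thesis
      unfolding perm_module_carrier using mc by (intro bexI[of _ "a \<oplus>\<^bsub>AK\<^esub> b"]) (simp_all add: H.M.r_distr)
  qed
  show "x \<otimes>\<^bsub>AK\<^esub> h \<in> carrier (perm_module \<mu>)"
    if x: "x \<in> carrier (perm_module \<mu>)" and h: "h \<in> carrier AK"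
  proof -
    obtain a where "a \<in> carrier AK" "x = m_elem \<mu> \<otimes>\<^bsub>AK\<^esub> a"
      using x[unfolded perm_module_carrier] by (elim bexE)
    then show ?thesis
      unfolding perm_module_carrier using mc h
      by (intro bexI[of _ "a \<otimes>\<^bsub>AK\<^esub> h"]) (simp_all add: H.M.m_assoc)
  qed
qed

abbreviation "TS \<equiv> carrier tensor_space"

lemma tensor_space_carrier: "TS = (\<Pi>\<^sub>E \<mu>\<in>CS. carrier (perm_module \<mu>))"
  by (simp add: tensor_space_def direct_sum_def)

lemma tensor_space_simps [simp]:
  "vzero tensor_space = (\<lambda>\<mu>\<in>CS. \<zero>\<^bsub>AK\<^esub>)"
  "vadd tensor_space x y = (\<lambda>\<mu>\<in>CS. x \<mu> \<oplus>\<^bsub>AK\<^esub> y \<mu>)"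
  "vact tensor_space x h = (\<lambda>\<mu>\<in>CS. x \<mu> \<otimes>\<^bsub>AK\<^esub> h)"
  by (simp_all add: tensor_space_def direct_sum_def)

lemma tensor_space_add_closed: "\<lbrakk>x \<in> TS; y \<in> TS\<rbrakk> \<Longrightarrow> vadd tensor_space x y \<in> TS"
  by (simp add: tensor_space_carrier PiE_iff perm_module_closed(2))

lemma tensor_space_act_closed: "\<lbrakk>x \<in> TS; h \<in> carrier AK\<rbrakk> \<Longrightarrow> vact tensor_space x h \<in> TS"
  by (simp add: tensor_space_carrier PiE_iff perm_module_closed(3))

lemma tensor_space_omega: "x \<in> TS \<Longrightarrow> x om \<in> carrier AK"
  using omega_composition perm_module_omega unfolding tensor_space_carrier by blast

lemma incl_closed: "v \<in> carrier AK \<Longrightarrow> incl om v \<in> TS"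
  by (auto simp: incl_def tensor_space_carrier perm_module_omega perm_module_closed(1))

lemma incl_omega [simp]: "incl om v om = v"
  by (simp add: incl_def omega_composition)

lemma incl_add:
  "\<lbrakk>a \<in> carrier AK; b \<in> carrier AK\<rbrakk> \<Longrightarrow> incl om (a \<oplus>\<^bsub>AK\<^esub> b) = vadd tensor_space (incl om a) (incl om b)"
  by (auto simp: incl_def fun_eq_iff)

lemma incl_act:
  "\<lbrakk>a \<in> carrier AK; h \<in> carrier AK\<rbrakk> \<Longrightarrow> incl om (a \<otimes>\<^bsub>AK\<^esub> h) = vact tensor_space (incl om a) h"
  by (auto simp: incl_def fun_eq_iff)

lemma incl_zero: "incl om \<zero>\<^bsub>AK\<^esub> = vzero tensor_space"
  by (auto simp: incl_def fun_eq_iff)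

lemma schur_simps [simp]:
  "monoid.mult schur \<phi> \<psi> = compose TS \<phi> \<psi>"
  "ring.zero schur = (\<lambda>x\<in>TS. vzero tensor_space)"
  "ring.add schur \<phi> \<psi> = (\<lambda>x\<in>TS. vadd tensor_space (\<phi> x) (\<psi> x))"
  "module.smult schur a \<phi> = (\<lambda>x\<in>TS. vact tensor_space (\<phi> x) (a \<odot>\<^bsub>AK\<^esub> \<one>\<^bsub>AK\<^esub>))"
  by (simp_all add: schur_def end_algebra_def)

lemma schur_carrier:
  "\<phi> \<in> carrier schur \<longleftrightarrow> \<phi> \<in> TS \<rightarrow>\<^sub>E TS \<and>
    (\<forall>x\<in>TS. \<forall>y\<in>TS. \<phi> (vadd tensor_space x y) = vadd tensor_space (\<phi> x) (\<phi> y)) \<and>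
    (\<forall>x\<in>TS. \<forall>h\<in>carrier AK. \<phi> (vact tensor_space x h) = vact tensor_space (\<phi> x) h)"
  by (simp add: schur_def end_algebra_def)

lemma omega_corner_simps [simp]:
  "monoid.mult omega_corner = monoid.mult schur" "monoid.one omega_corner = proj om"
  "ring.zero omega_corner = ring.zero schur" "ring.add omega_corner = ring.add schur"
  "module.smult omega_corner = module.smult schur"
  by (simp_all add: omega_corner_def corner_def)

section \<open>The corner at \<omega> as left multiplications\<close>

definition left_mult_corner where
  "left_mult_corner h = (\<lambda>x\<in>TS. incl om (h \<otimes>\<^bsub>AK\<^esub> x om))"

lemma left_mult_corner_schur:
  assumes "h \<in> carrier AK"
  shows "left_mult_corner h \<in> carrier schur"
  unfolding schur_carrier
proof (intro conjI ballI)
  have "incl om (h \<otimes>\<^bsub>AK\<^esub> x om) \<in> TS" if "x \<in> TS" for x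
    by (intro incl_closed H.M.m_closed assms tensor_space_omega[OF that])
  then show "left_mult_corner h \<in> TS \<rightarrow>\<^sub>E TS" by (simp add: left_mult_corner_def)
  fix x y g assume x: "x \<in> TS"
  note xo = tensor_space_omega[OF x]
  show "left_mult_corner h (vact tensor_space x g) = vact tensor_space (left_mult_corner h x) g"
    if "g \<in> carrier AK"
    using that assms xo x tensor_space_act_closed[OF x that] omega_composition
    by (simp add: left_mult_corner_def H.M.m_assoc[symmetric] incl_act del: tensor_space_simps)
      (simp add: H.M.m_assoc incl_act[symmetric] del: tensor_space_simps(3), simp)
  assume y: "y \<in> TS"
  show "left_mult_corner h (vadd tensor_space x y) =
      vadd tensor_space (left_mult_corner h x) (left_mult_corner h y)"
    using assms xo x y tensor_space_omega[OF y] tensor_space_add_closed[OF x y] omega_composition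
    by (simp add: left_mult_corner_def incl_add[symmetric] del: tensor_space_simps)
      (simp add: H.M.r_distr)
qed

lemma proj_apply: "x \<in> TS \<Longrightarrow> proj om x = incl om (x om)"
  by (simp add: proj_def)

text \<open>The summand at \<omega> is generated by the unit, so right linearity reduces every value
  on it to the value at 1.\<close>

lemma schur_apply_incl:
  assumes "\<phi> \<in> carrier schur" "v \<in> carrier AK"
  shows "\<phi> (incl om v) om = \<phi> (incl om \<one>\<^bsub>AK\<^esub>) om \<otimes>\<^bsub>AK\<^esub> v"
proof -
  have "incl om v = vact tensor_space (incl om \<one>\<^bsub>AK\<^esub>) v"
    using incl_act[of "\<one>\<^bsub>AK\<^esub>" v] assms(2) by simp
  then have "\<phi> (incl om v) = vact tensor_space (\<phi> (incl om \<one>\<^bsub>AK\<^esub>)) v"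
    using assms incl_closed[of "\<one>\<^bsub>AK\<^esub>"] by (simp add: schur_carrier)
  then show ?thesis by (simp add: omega_composition)
qed

lemma omega_corner_carrier: "carrier omega_corner = left_mult_corner ` carrier AK"
proof -
  \<comment> \<open>Compressing \<phi> keeps only its \<omega>-to-\<omega> entry, and that entry is
    left multiplication by its value at 1.\<close>
  have key: "proj om \<otimes>\<^bsub>schur\<^esub> \<phi> \<otimes>\<^bsub>schur\<^esub> proj om = left_mult_corner (\<phi> (incl om \<one>\<^bsub>AK\<^esub>) om)"
    and cl: "\<phi> (incl om \<one>\<^bsub>AK\<^esub>) om \<in> carrier AK" if \<phi>: "\<phi> \<in> carrier schur" for \<phi>
  proof -
    have \<phi>TS: "\<phi> x \<in> TS" if "x \<in> TS" for x using \<phi> that by (auto simp: schur_carrier)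
    show "\<phi> (incl om \<one>\<^bsub>AK\<^esub>) om \<in> carrier AK"
      by (rule tensor_space_omega[OF \<phi>TS[OF incl_closed]]) simp
    show "proj om \<otimes>\<^bsub>schur\<^esub> \<phi> \<otimes>\<^bsub>schur\<^esub> proj om = left_mult_corner (\<phi> (incl om \<one>\<^bsub>AK\<^esub>) om)"
    proof
      fix x
      show "(proj om \<otimes>\<^bsub>schur\<^esub> \<phi> \<otimes>\<^bsub>schur\<^esub> proj om) x = left_mult_corner (\<phi> (incl om \<one>\<^bsub>AK\<^esub>) om) x"
      proof (cases "x \<in> TS")
        case True
        note x = tensor_space_omega[OF True]
        have "(proj om \<otimes>\<^bsub>schur\<^esub> \<phi> \<otimes>\<^bsub>schur\<^esub> proj om) x = incl om (\<phi> (incl om (x om)) om)"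
          using True x by (simp add: compose_def proj_apply incl_closed \<phi>TS)
        then show ?thesis
          using True by (simp only: left_mult_corner_def restrict_apply' schur_apply_incl[OF \<phi> x])
      qed (simp add: compose_def left_mult_corner_def)
    qed
  qed
  have "carrier omega_corner = (\<lambda>\<phi>. proj om \<otimes>\<^bsub>schur\<^esub> \<phi> \<otimes>\<^bsub>schur\<^esub> proj om) ` carrier schur"
    by (auto simp: omega_corner_def corner_def simp del: schur_simps)
  also have "\<dots> = left_mult_corner ` carrier AK"
  proof
    show "(\<lambda>\<phi>. proj om \<otimes>\<^bsub>schur\<^esub> \<phi> \<otimes>\<^bsub>schur\<^esub> proj om) ` carrier schur \<subseteq> left_mult_corner ` carrier AK"
      using key cl by (auto simp del: schur_simps)
    show "left_mult_corner ` carrier AK \<subseteq> (\<lambda>\<phi>. proj om \<otimes>\<^bsub>schur\<^esub> \<phi> \<otimes>\<^bsub>schur\<^esub> proj om) ` carrier schur"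
    proof
      fix \<phi> assume "\<phi> \<in> left_mult_corner ` carrier AK"
      then obtain h where h: "h \<in> carrier AK" "\<phi> = left_mult_corner h" by blast
      \<comment> \<open>The value at 1 recovers h, so a left multiplication equals its own
        compression and lies in the corner.\<close>
      have "left_mult_corner h (incl om \<one>\<^bsub>AK\<^esub>) om = h"
        using h(1) by (simp add: left_mult_corner_def incl_closed)
      then have "\<phi> = proj om \<otimes>\<^bsub>schur\<^esub> \<phi> \<otimes>\<^bsub>schur\<^esub> proj om"
        using key[OF left_mult_corner_schur[OF h(1)]] h(2) by (simp del: schur_simps)
      then show "\<phi> \<in> (\<lambda>\<phi>. proj om \<otimes>\<^bsub>schur\<^esub> \<phi> \<otimes>\<^bsub>schur\<^esub> proj om) ` carrier schur"
        using left_mult_corner_schur[OF h(1)] h(2) by blast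
    qed
  qed
  finally show ?thesis .
qed

lemma left_mult_corner_apply: "x \<in> TS \<Longrightarrow> left_mult_corner h x = incl om (h \<otimes>\<^bsub>AK\<^esub> x om)"
  by (simp add: left_mult_corner_def)

lemma left_mult_corner_eqI: "(\<And>x. x \<in> TS \<Longrightarrow> \<phi> x = incl om (h \<otimes>\<^bsub>AK\<^esub> x om)) \<Longrightarrow> restrict \<phi> TS = left_mult_corner h"
  by (auto simp: left_mult_corner_def restrict_def)

lemma left_mult_corner_alg_hom: "left_mult_corner \<in> alg_hom R AK omega_corner"
proof (rule alg_homI)
  show "left_mult_corner h \<in> carrier omega_corner" if "h \<in> carrier AK" for h
    using that by (auto simp: omega_corner_carrier)
  show "left_mult_corner (a \<otimes>\<^bsub>AK\<^esub> b) = left_mult_corner a \<otimes>\<^bsub>omega_corner\<^esub> left_mult_corner b"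
    if "a \<in> carrier AK" "b \<in> carrier AK" for a b
    unfolding omega_corner_simps schur_simps compose_def
    using that by (intro left_mult_corner_eqI[symmetric])
      (simp add: left_mult_corner_apply incl_closed tensor_space_omega H.M.m_assoc)
  show "left_mult_corner (a \<oplus>\<^bsub>AK\<^esub> b) = left_mult_corner a \<oplus>\<^bsub>omega_corner\<^esub> left_mult_corner b"
    if "a \<in> carrier AK" "b \<in> carrier AK" for a b
    unfolding omega_corner_simps schur_simps
    using that by (intro left_mult_corner_eqI[symmetric])
      (simp add: left_mult_corner_apply tensor_space_omega H.M.l_distr incl_add[symmetric] del: tensor_space_simps)
  show "left_mult_corner \<one>\<^bsub>AK\<^esub> = \<one>\<^bsub>omega_corner\<^esub>"
    unfolding omega_corner_simps proj_def
    by (intro left_mult_corner_eqI[symmetric]) (simp add: tensor_space_omega)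
  show "left_mult_corner (a \<odot>\<^bsub>AK\<^esub> h) = a \<odot>\<^bsub>omega_corner\<^esub> left_mult_corner h"
    if "a \<in> carrier R" "h \<in> carrier AK" for a h
    unfolding omega_corner_simps schur_simps
    using that by (intro left_mult_corner_eqI[symmetric])
      (simp add: left_mult_corner_apply tensor_space_omega incl_act[symmetric] H.smult_mult_l H.smult_mult_r
        del: tensor_space_simps)
qed

text \<open>The laws are carried over from the Ariki-Koike algebra along
  \<open>left_mult_corner\<close>, instead of being checked for endomorphisms of the tensor
  space.\<close>

lemma omega_corner_assoc_algebra: "assoc_algebra R omega_corner"
proof (rule assoc_algebra_image[OF AK_assoc_algebra left_mult_corner_alg_hom])
  show "left_mult_corner \<zero>\<^bsub>AK\<^esub> = \<zero>\<^bsub>omega_corner\<^esub>"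
    unfolding omega_corner_simps schur_simps(2)
    by (intro left_mult_corner_eqI[symmetric]) (simp add: tensor_space_omega incl_zero del: tensor_space_simps)
qed (simp add: omega_corner_carrier)

lemma left_mult_corner_eval: "h \<in> carrier AK \<Longrightarrow> left_mult_corner h (incl om \<one>\<^bsub>AK\<^esub>) om = h"
  by (simp add: left_mult_corner_apply incl_closed)

lemma left_mult_corner_inj: "inj_on left_mult_corner (carrier AK)"
  by (rule inj_on_inverseI[of _ "\<lambda>\<phi>. \<phi> (incl om \<one>\<^bsub>AK\<^esub>) om"]) (rule left_mult_corner_eval)

lemma left_mult_corner_iso: "left_mult_corner \<in> alg_iso R AK omega_corner"
  using left_mult_corner_alg_hom left_mult_corner_inj by (simp add: alg_iso_iff bij_betw_def omega_corner_carrier)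

section \<open>Endomorphisms of the summand at \<omega>\<close>

definition left_mult_end where "left_mult_end h = (\<lambda>v\<in>carrier AK. h \<otimes>\<^bsub>AK\<^esub> v)"

lemma left_mult_end_iso: "left_mult_end \<in> alg_iso R AK omega_end"
proof -
  note simps = omega_end_def end_algebra_def perm_module_omega left_mult_end_def
  have "left_mult_end \<in> alg_hom R AK omega_end"
    by (rule alg_homI)
      (auto simp: simps fun_eq_iff compose_def H.M.m_assoc H.M.l_distr H.M.r_distr H.smult_mult_l H.smult_mult_r)
  moreover have "inj_on left_mult_end (carrier AK)"
    by (rule inj_on_inverseI[of _ "\<lambda>\<psi>. \<psi> \<one>\<^bsub>AK\<^esub>"]) (simp add: left_mult_end_def)
  moreover have "carrier omega_end \<subseteq> left_mult_end ` carrier AK"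
  proof
    fix \<psi> assume "\<psi> \<in> carrier omega_end"
    then have \<psi>: "\<psi> \<in> carrier AK \<rightarrow>\<^sub>E carrier AK"
      and lin: "\<And>x h. \<lbrakk>x \<in> carrier AK; h \<in> carrier AK\<rbrakk> \<Longrightarrow> \<psi> (x \<otimes>\<^bsub>AK\<^esub> h) = \<psi> x \<otimes>\<^bsub>AK\<^esub> h"
      by (auto simp: omega_end_def end_algebra_def perm_module_omega)
    \<comment> \<open>An endomorphism of the regular right module is left multiplication by its
      value at 1; outside the carrier both sides are \<open>undefined\<close>.\<close>
    have "\<psi> v = left_mult_end (\<psi> \<one>\<^bsub>AK\<^esub>) v" for v
    proof (cases "v \<in> carrier AK")
      case True
      then show ?thesis using lin[of "\<one>\<^bsub>AK\<^esub>" v] by (simp add: left_mult_end_def)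
    next
      case False
      then show ?thesis using PiE_arb[OF \<psi> False] by (simp add: left_mult_end_def)
    qed
    then have "\<psi> = left_mult_end (\<psi> \<one>\<^bsub>AK\<^esub>)" by (rule ext)
    moreover have "\<psi> \<one>\<^bsub>AK\<^esub> \<in> carrier AK" using \<psi> by auto
    ultimately show "\<psi> \<in> left_mult_end ` carrier AK" by blast
  qed
  ultimately show ?thesis
    by (auto simp: alg_iso_iff bij_betw_def dest: alg_homD(1))
qed

lemma eval_omega_iso: "eval_omega \<in> alg_iso R omega_end AK"
  by (rule alg_iso_inverse[OF left_mult_end_iso AK_assoc_algebra])
    (simp add: eval_omega_def m_elem_omega left_mult_end_def)

lemma restrict_omega_left_mult: "a \<in> carrier AK \<Longrightarrow> restrict_omega (left_mult_corner a) = left_mult_end a"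
  unfolding restrict_omega_def left_mult_end_def perm_module_omega
  by (intro restrict_ext) (simp add: left_mult_corner_apply incl_closed)

text \<open>On the corner, restriction coincides with evaluation at 1 followed by
  \<open>left_mult_end\<close>, a composite of isomorphisms through the Ariki-Koike algebra.\<close>

lemma restrict_omega_iso: "restrict_omega \<in> alg_iso R omega_corner omega_end"
proof -
  let ?g = "\<lambda>\<phi>. \<phi> (incl om \<one>\<^bsub>AK\<^esub>) om"
  have g: "?g \<in> alg_iso R omega_corner AK"
    by (rule alg_iso_inverse[OF left_mult_corner_iso AK_assoc_algebra]) (rule left_mult_corner_eval)
  then have "(\<lambda>\<phi>. left_mult_end (?g \<phi>)) \<in> alg_iso R omega_corner omega_end"
    using left_mult_end_iso alg_hom_compose[of ?g R omega_corner AK left_mult_end omega_end]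
      bij_betw_trans[of ?g "carrier omega_corner" "carrier AK" left_mult_end "carrier omega_end"]
    by (simp add: alg_iso_iff comp_def)
  then show ?thesis
    by (rule alg_iso_cong)
      (auto simp: omega_corner_assoc_algebra omega_corner_carrier restrict_omega_left_mult left_mult_corner_eval)
qed

lemma eval_restrict: "a \<in> carrier AK \<Longrightarrow> eval_omega (restrict_omega (left_mult_corner a)) = a"
  by (simp add: restrict_omega_left_mult) (simp add: eval_omega_def m_elem_omega left_mult_end_def)

section \<open>The generators \<open>C\<^sub>i\<close>\<close>

text \<open>Whichever \<open>h\<close> is chosen, the result is v times \<open>h\<close>, and v
  already lies in the right ideal of \<nu>.\<close>

lemma map_of_generator_mem:
  assumes \<mu>: "\<mu> \<in> CS" and \<nu>: "\<nu> \<in> CS" and x: "x \<in> carrier (perm_module \<mu>)"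
    and v: "\<exists>h\<in>carrier AK. v = m_elem \<nu> \<otimes>\<^bsub>AK\<^esub> h"
  shows "map_of_generator AK (m_elem \<mu>) v x \<in> carrier (perm_module \<nu>)"
proof -
  have "\<exists>h. h \<in> carrier AK \<and> x = m_elem \<mu> \<otimes>\<^bsub>AK\<^esub> h" using x by (auto simp: perm_module_carrier)
  then have "(SOME h. h \<in> carrier AK \<and> x = m_elem \<mu> \<otimes>\<^bsub>AK\<^esub> h) \<in> carrier AK"
    by (rule someI2_ex) simp
  then show ?thesis
    unfolding map_of_generator_def using v by (intro perm_module_closed(3)[OF \<nu>]) (simp add: perm_module_carrier)
qed

text \<open>If the prescribed value is a scalar multiple of the generator, the result is that
  multiple of the argument, so different choices of \<open>h\<close> agree.\<close>

lemma map_of_generator_smult: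
  assumes \<mu>: "\<mu> \<in> CS" and s: "s \<in> carrier R" and h: "h \<in> carrier AK"
  shows "map_of_generator AK (m_elem \<mu>) (s \<odot>\<^bsub>AK\<^esub> m_elem \<mu>) (m_elem \<mu> \<otimes>\<^bsub>AK\<^esub> h) = s \<odot>\<^bsub>AK\<^esub> m_elem \<mu> \<otimes>\<^bsub>AK\<^esub> h"
proof -
  define h' where "h' = (SOME h'. h' \<in> carrier AK \<and> m_elem \<mu> \<otimes>\<^bsub>AK\<^esub> h = m_elem \<mu> \<otimes>\<^bsub>AK\<^esub> h')"
  have "h' \<in> carrier AK \<and> m_elem \<mu> \<otimes>\<^bsub>AK\<^esub> h = m_elem \<mu> \<otimes>\<^bsub>AK\<^esub> h'"
    unfolding h'_def by (rule someI[of _ h]) (simp add: h)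
  then have "s \<odot>\<^bsub>AK\<^esub> m_elem \<mu> \<otimes>\<^bsub>AK\<^esub> h' = s \<odot>\<^bsub>AK\<^esub> m_elem \<mu> \<otimes>\<^bsub>AK\<^esub> h"
    using m_elem_closed[OF \<mu>] s h by (simp add: H.smult_mult_l)
  then show ?thesis unfolding map_of_generator_def h'_def .
qed

text \<open>Products in \<open>schur\<close> are compositions cut off at the tensor space and are
  \<open>undefined\<close> elsewhere, so the intermediate vectors in \<open>C i\<close> have to be
  located inside it.\<close>

lemma e_map_closed:
  assumes i: "i < n" and x: "x \<in> TS"
  shows "e_map (gen_row i) x \<in> TS"
proof -
  let ?c = "gen_row i"
  have "(let \<mu> = \<nu> - simple_root m ?c in if \<mu> \<in> CS
      then map_of_generator AK (m_elem \<mu>) (e_value ?c \<mu>) (x \<mu>) else \<zero>\<^bsub>AK\<^esub>) \<in> carrier (perm_module \<nu>)"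
    if \<nu>: "\<nu> \<in> CS" for \<nu>
  proof (cases "\<nu> - simple_root m ?c \<in> CS")
    case True
    have "\<nu> - simple_root m ?c + simple_root m ?c = \<nu>" by simp
    then have "\<exists>h\<in>carrier AK. e_value ?c (\<nu> - simple_root m ?c) = m_elem \<nu> \<otimes>\<^bsub>AK\<^esub> h"
      using e_value_mem[OF True gen_row_Gam[OF i] next_gen_row_Gam[OF i]] \<nu> by simp
    moreover have "x (\<nu> - simple_root m ?c) \<in> carrier (perm_module (\<nu> - simple_root m ?c))"
      using x True unfolding tensor_space_carrier by blast
    ultimately show ?thesis
      using True map_of_generator_mem[OF True \<nu>] by (simp add: Let_def)
  qed (simp add: Let_def perm_module_closed(1)[OF \<nu>])
  then show ?thesis
    using x by (simp add: e_map_def) (simp add: tensor_space_carrier)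
qed

lemma f_map_closed:
  assumes i: "i < n" and x: "x \<in> TS"
  shows "f_map (gen_row i) x \<in> TS"
proof -
  let ?c = "gen_row i"
  have "(let \<mu> = \<nu> + simple_root m ?c in if \<mu> \<in> CS
      then map_of_generator AK (m_elem \<mu>) (f_value ?c \<mu>) (x \<mu>) else \<zero>\<^bsub>AK\<^esub>) \<in> carrier (perm_module \<nu>)"
    if \<nu>: "\<nu> \<in> CS" for \<nu>
  proof (cases "\<nu> + simple_root m ?c \<in> CS")
    case True
    have "\<nu> + simple_root m ?c - simple_root m ?c = \<nu>" by simp
    then have "\<exists>h\<in>carrier AK. f_value ?c (\<nu> + simple_root m ?c) = m_elem \<nu> \<otimes>\<^bsub>AK\<^esub> h"
      using f_value_mem[OF True gen_row_Gam[OF i] next_gen_row_Gam[OF i]] \<nu> by simp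
    moreover have "x (\<nu> + simple_root m ?c) \<in> carrier (perm_module (\<nu> + simple_root m ?c))"
      using x True unfolding tensor_space_carrier by blast
    ultimately show ?thesis
      using True map_of_generator_mem[OF True \<nu>] by (simp add: Let_def)
  qed (simp add: Let_def perm_module_closed(1)[OF \<nu>])
  then show ?thesis
    using x by (simp add: f_map_def) (simp add: tensor_space_carrier)
qed

text \<open>At \<omega> the generator is the unit, so the chosen \<open>h\<close> can only be
  v.\<close>

lemma e_map_incl:
  assumes i: "i < n" and v: "v \<in> carrier AK"
  shows "e_map (gen_row i) (incl om v) (bump i) = m_elem (bump i) \<otimes>\<^bsub>AK\<^esub> v"
proof -
  have "(SOME h. h \<in> carrier AK \<and> v = \<one>\<^bsub>AK\<^esub> \<otimes>\<^bsub>AK\<^esub> h) = v"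
    using v by (intro some_equality) auto
  then show ?thesis
    using incl_closed[OF v] bump_composition[OF i]
    by (simp add: e_map_def bump_minus omega_composition e_value_omega[OF i] m_elem_omega map_of_generator_def)
qed

lemma f_map_omega:
  assumes i: "i < n" and x: "x \<in> TS" and xb: "x (bump i) = m_elem (bump i) \<otimes>\<^bsub>AK\<^esub> v" and v: "v \<in> carrier AK"
    and s: "s \<in> carrier R" "f_value (gen_row i) (bump i) = s \<odot>\<^bsub>AK\<^esub> m_elem (bump i)"
  shows "f_map (gen_row i) x om = s \<odot>\<^bsub>AK\<^esub> m_elem (bump i) \<otimes>\<^bsub>AK\<^esub> v"
  using x omega_composition bump_composition[OF i] map_of_generator_smult[OF bump_composition[OF i] s(1) v]
  by (simp add: f_map_def bump_def[symmetric] xb s(2))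

text \<open>The scalar by which \<open>C i\<close> exceeds \<open>T i\<close>; a single name for
  both cases lets all generators be translated at once.\<close>

definition C_shift :: "nat \<Rightarrow> 'r" where
  "C_shift i = (if i = 0 then \<ominus> Q r else inv q)"

lemma C_shift_closed: "C_shift i \<in> carrier R"
  using Q_closed[of r] r_ge_2 q_unit by (simp add: C_shift_def)

lemma C_eq:
  assumes i: "i < n"
  shows "C i = left_mult_corner (T i \<oplus>\<^bsub>AK\<^esub> C_shift i \<odot>\<^bsub>AK\<^esub> \<one>\<^bsub>AK\<^esub>)"
proof -
  have T: "T i \<in> carrier AK" using i by (rule T_closed)
  have q: "q \<in> carrier R" "inv q \<in> carrier R" "inv q \<otimes> q = \<one>"
    using q_unit by (auto simp: R.Units_closed)
  have Qr: "Q r \<in> carrier R" using Q_closed[of r] r_ge_2 by simp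
  \<comment> \<open>The power of q in \<open>f_value\<close>: exponent 0 for a row with one box,
    exponent -1 for a row with two.\<close>
  define s where "s = (if i = 0 then \<one> else inv q)"
  have s: "s \<in> carrier R" using q by (simp add: s_def)
  have mb: "m_elem (bump i) \<in> carrier AK" by (intro m_elem_closed bump_composition i)
  have f: "f_value (gen_row i) (bump i) = s \<odot>\<^bsub>AK\<^esub> m_elem (bump i)"
  proof (cases "i = 0")
    case True
    then show ?thesis using f_value_bump_0 mb by (simp add: s_def)
  next
    case False
    then show ?thesis using f_value_bump[of i] i by (simp add: s_def)
  qed
  have val: "s \<odot>\<^bsub>AK\<^esub> m_elem (bump i) = T i \<oplus>\<^bsub>AK\<^esub> C_shift i \<odot>\<^bsub>AK\<^esub> \<one>\<^bsub>AK\<^esub>"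
  proof (cases "i = 0")
    case True
    then show ?thesis
      using T Qr by (simp add: s_def m_elem_bump_0 C_shift_def H.smult_l_minus a_minus_def)
  next
    case False
    then have "s \<odot>\<^bsub>AK\<^esub> m_elem (bump i) = inv q \<odot>\<^bsub>AK\<^esub> \<one>\<^bsub>AK\<^esub> \<oplus>\<^bsub>AK\<^esub> (inv q \<otimes> q) \<odot>\<^bsub>AK\<^esub> T i"
      using T q(1,2) i by (simp add: s_def m_elem_bump H.smult_r_distr H.smult_assoc1)
    then show ?thesis using T q False by (simp add: C_shift_def H.M.a_comm)
  qed
  \<comment> \<open>The right projection leaves only the \<omega>-entry of x, \<open>e\<close> moves
    it to \<open>bump i\<close>, \<open>f\<close> brings it back, and the left projection drops all
    entries but the one at \<omega>. Outside the tensor space both sides are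
    \<open>undefined\<close>.\<close>
  have "C i x = left_mult_corner (s \<odot>\<^bsub>AK\<^esub> m_elem (bump i)) x" for x
  proof (cases "x \<in> TS")
    case True
    note xo = tensor_space_omega[OF True]
    let ?e = "e_map (gen_row i) (incl om (x om))"
    have e: "?e \<in> TS" by (rule e_map_closed[OF i incl_closed[OF xo]])
    have "C i x = proj om (f_map (gen_row i) ?e)"
      using True e incl_closed[OF xo]
      by (simp add: C_def Let_def gen_row_def[symmetric] compose_def proj_apply[OF True])
    also have "\<dots> = incl om (f_map (gen_row i) ?e om)"
      by (rule proj_apply[OF f_map_closed[OF i e]])
    also have "f_map (gen_row i) ?e om = s \<odot>\<^bsub>AK\<^esub> m_elem (bump i) \<otimes>\<^bsub>AK\<^esub> x om"
      by (rule f_map_omega[OF i e e_map_incl[OF i xo] xo s f])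
    finally show ?thesis by (simp add: left_mult_corner_apply[OF True])
  qed (simp add: C_def Let_def compose_def left_mult_corner_def)
  then show ?thesis using val by auto
qed

text \<open>\<open>S\<close> is kept general because the statement is used twice: with the index 0
  for the Ariki-Koike algebra and without it for the Hecke algebra.\<close>

lemma C_generated_iso:
  assumes "S \<subseteq> {..<n}"
  shows "alg_isomorphic R (generated_subalgebra R omega_corner (C ` S)) (generated_subalgebra R AK (T ` S))"
proof -
  let ?X = "(\<lambda>i. T i \<oplus>\<^bsub>AK\<^esub> C_shift i \<odot>\<^bsub>AK\<^esub> \<one>\<^bsub>AK\<^esub>) ` S"
  have Tc: "T i \<in> carrier AK" if "i \<in> S" for i using that assms T_closed by auto
  then have X: "?X \<subseteq> carrier AK" using C_shift_closed by auto
  have gen: "generated_subalgebra R AK ?X = generated_subalgebra R AK (T ` S)"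
    by (rule H.generated_translate) (use Tc C_shift_closed in auto)
  have "left_mult_corner \<in> alg_iso R (generated_subalgebra R AK ?X)
      (generated_subalgebra R omega_corner (left_mult_corner ` ?X))"
    using H.subalgebra_ofD(1)[OF H.subalgebra_of_generated[OF X]]
    by (intro alg_iso_generated[OF AK_assoc_algebra omega_corner_assoc_algebra left_mult_corner_alg_hom X]
        inj_on_subset[OF left_mult_corner_inj])
  moreover have "left_mult_corner ` ?X = C ` S"
    unfolding image_image using assms by (intro image_cong) (auto simp: C_eq)
  ultimately have "alg_isomorphic R (generated_subalgebra R AK ?X) (generated_subalgebra R omega_corner (C ` S))"
    by (auto simp: alg_isomorphic_def)
  then show ?thesis
    unfolding gen[symmetric] by (rule alg_isomorphic_sym[OF assoc_algebra_generated[OF AK_assoc_algebra X]])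
qed

lemma T_0_eq: "T 0 = eval_omega (restrict_omega (C 0 \<oplus>\<^bsub>omega_corner\<^esub> Q r \<odot>\<^bsub>omega_corner\<^esub> \<one>\<^bsub>omega_corner\<^esub>))"
proof -
  have T: "T 0 \<in> carrier AK" using n_pos by (intro T_closed) simp
  have Qr: "Q r \<in> carrier R" using Q_closed[of r] r_ge_2 by simp
  let ?a = "T 0 \<oplus>\<^bsub>AK\<^esub> C_shift 0 \<odot>\<^bsub>AK\<^esub> \<one>\<^bsub>AK\<^esub>"
  have a: "?a \<in> carrier AK" using T C_shift_closed by simp
  note hD = alg_homD[OF left_mult_corner_alg_hom]
  have "C 0 \<oplus>\<^bsub>omega_corner\<^esub> Q r \<odot>\<^bsub>omega_corner\<^esub> \<one>\<^bsub>omega_corner\<^esub> =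
      left_mult_corner (?a \<oplus>\<^bsub>AK\<^esub> Q r \<odot>\<^bsub>AK\<^esub> \<one>\<^bsub>AK\<^esub>)"
    using n_pos a Qr by (simp only: C_eq hD H.M.one_closed H.smult_closed less_le_trans[OF zero_less_one])
  also have "?a \<oplus>\<^bsub>AK\<^esub> Q r \<odot>\<^bsub>AK\<^esub> \<one>\<^bsub>AK\<^esub> = T 0"
    using T Qr by (simp add: C_shift_def H.smult_l_minus H.M.a_assoc H.M.l_neg)
  finally show ?thesis by (simp only: eval_restrict[OF T])
qed

lemma T_eq:
  assumes "i \<in> {1..n - 1}"
  shows "T i = eval_omega (restrict_omega (C i \<ominus>\<^bsub>omega_corner\<^esub> inv q \<odot>\<^bsub>omega_corner\<^esub> \<one>\<^bsub>omega_corner\<^esub>))"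
proof -
  interpret E: assoc_algebra R omega_corner by (rule omega_corner_assoc_algebra)
  interpret h: ring_hom_ring AK omega_corner left_mult_corner
    by (rule alg_hom_ring_hom_ring[OF AK_assoc_algebra omega_corner_assoc_algebra left_mult_corner_alg_hom])
  have i: "i < n" "i \<noteq> 0" using assms by auto
  have T: "T i \<in> carrier AK" using i by (intro T_closed)
  have q: "inv q \<in> carrier R" using q_unit by simp
  let ?a = "T i \<oplus>\<^bsub>AK\<^esub> C_shift i \<odot>\<^bsub>AK\<^esub> \<one>\<^bsub>AK\<^esub>"
  have a: "?a \<in> carrier AK" using T C_shift_closed by simp
  note hD = alg_homD[OF left_mult_corner_alg_hom]
  have "C i \<ominus>\<^bsub>omega_corner\<^esub> inv q \<odot>\<^bsub>omega_corner\<^esub> \<one>\<^bsub>omega_corner\<^esub> =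
      left_mult_corner (?a \<ominus>\<^bsub>AK\<^esub> inv q \<odot>\<^bsub>AK\<^esub> \<one>\<^bsub>AK\<^esub>)"
    using a q by (simp only: C_eq[OF i(1)] h.hom_a_minus hD(4,5) H.M.one_closed H.smult_closed)
  also have "?a \<ominus>\<^bsub>AK\<^esub> inv q \<odot>\<^bsub>AK\<^esub> \<one>\<^bsub>AK\<^esub> = T i"
    using T q i(2) by (simp add: C_shift_def a_minus_def H.M.a_assoc H.M.r_neg)
  finally show ?thesis by (simp only: eval_restrict[OF T])
qed

end

theorem proposition6p3:
  fixes R :: "('r, 'b) ring_scheme"
    and n r :: nat
    and m :: "nat \<Rightarrow> nat"
    and q :: 'r
    and Q :: "nat \<Rightarrow> 'r"
  assumes "cring R"
    and "n \<ge> 1"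
    and "r \<ge> 2"
    and "\<And>k. k \<in> {1..r} \<Longrightarrow> 0 < m k \<and> n \<le> m k"
    and "q \<in> Units R"
    and "\<And>k. k \<in> {1..r} \<Longrightarrow> Q k \<in> carrier R"
  shows "omega n r \<in> partitions n r m \<and>
    (let H = cyclotomic.AK R n r q Q;
         T = cyclotomic.T R n r q Q;
         H_n = cyclotomic.hecke_subalgebra R n r q Q;
         E = cyclotomic.omega_corner R n r m q Q;
         C = cyclotomic.C R n r m q Q;
         M_end = cyclotomic.omega_end R n r m q Q;
         res = cyclotomic.restrict_omega R n r m q Q;
         ev = cyclotomic.eval_omega R n r m q Q
     in
      (alg_isomorphic R (generated_subalgebra R E (C ` {0..<n})) H \<and>
       alg_isomorphic R (generated_subalgebra R E (C ` {1..<n})) H_n \<and>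
       alg_isomorphic R (generated_subalgebra R E (C ` {1..<n})) (iwahori_hecke R n q))
      \<and>
      (cyclotomic.m_elem R n r m q Q (omega n r) = \<one>\<^bsub>H\<^esub> \<and>
       res \<in> alg_iso R E M_end \<and>
       ev \<in> alg_iso R M_end H \<and>
       T 0 = ev (res (C 0 \<oplus>\<^bsub>E\<^esub> Q r \<odot>\<^bsub>E\<^esub> \<one>\<^bsub>E\<^esub>)) \<and>
       (\<forall>i\<in>{1..n - 1}. T i = ev (res (C i \<ominus>\<^bsub>E\<^esub> (inv\<^bsub>R\<^esub> q) \<odot>\<^bsub>E\<^esub> \<one>\<^bsub>E\<^esub>)))))"
proof -
  interpret ariki_koike R n r m q Q
    using assms by (intro ariki_koike.intro ariki_koike_axioms.intro) auto
  \<comment> \<open>A generated subalgebra differs from its ambient record only in the carrier, so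
    equality of carriers gives equality of algebras.\<close>
  have "generated_subalgebra R AK (T ` {0..<n}) = AK"
    using AK_generated by (simp add: generated_subalgebra_def lessThan_atLeast0)
  then have AK: "alg_isomorphic R (generated_subalgebra R omega_corner (C ` {0..<n})) AK"
    using C_generated_iso[of "{0..<n}"] by (simp add: lessThan_atLeast0)
  have Hn: "alg_isomorphic R (generated_subalgebra R omega_corner (C ` {1..<n})) hecke_subalgebra"
    using C_generated_iso[OF ivl_subset_lessThan] by (simp only: hecke_subalgebra_def)
  show ?thesis
    unfolding Let_def
    using omega_partition AK Hn alg_isomorphic_trans[OF Hn hecke_subalgebra_iso] m_elem_omega
      restrict_omega_iso eval_omega_iso T_0_eq T_eq
    by (intro conjI ballI)
qed

end
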